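(* For every $\epsilon > 0$, $\mathsf{NP} \subseteq \mathsf{MIP1}[2, 1-\epsilon, 1/2 + \epsilon]$.
   Context: $\mathsf{MIP1}[k,c,s]$ denotes the class of languages $L$ having a multi-prover interactive proof system with a probabilistic polynomial-time verifier and $k$ computationally unbounded provers, where the verifier formulates and sends all $k$ questions simultaneously (one to each prover, before receiving any answer), each prover answers with a single bit, and then the verifier accepts or rejects; completeness $c$ means that for every $x \in L$ there are prover strategies making the verifier accept with probability at least $c$, and soundness $s$ means that for every $x \notin L$ and all prover strategies the verifier accepts with probability at most $s$. *)

theory Defs
  imports "HOL-Probability.Probability" "HOL-Computational_Algebra.Polynomial"
begin

section \<open>Deterministic multi-tape Turing machines\<close>

datatype move = L_move | N_move | R_move

text \<open>
  States are \<open>0, \<dots>, states M - 1\<close>; state 0 is initial and state 1 is halting. Tape symbols are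
  \<open>0, \<dots>, symbols M - 1\<close>; symbol 0 is the blank. The transition function maps a state and the list
  of scanned symbols to a new state and, for each tape, a symbol to write and a head move.
\<close>

record tm =
  tapes :: nat
  states :: nat
  symbols :: nat
  delta :: "nat \<Rightarrow> nat list \<Rightarrow> nat \<times> (nat \<times> move) list"

definition wf_tm :: "tm \<Rightarrow> bool" where
  "wf_tm M \<longleftrightarrow> tapes M \<ge> 1 \<and> states M \<ge> 2 \<and> symbols M \<ge> 4 \<and>
    (\<forall>q ss. q < states M \<longrightarrow> length ss = tapes M \<longrightarrow> (\<forall>s\<in>set ss. s < symbols M) \<longrightarrow>
      (case delta M q ss of (q', acts) \<Rightarrow>
        q' < states M \<and> length acts = tapes M \<and> (\<forall>(s, m)\<in>set acts. s < symbols M)))"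

text \<open>A tape is infinite in both directions and is paired with its head position.\<close>

type_synonym tape = "(int \<Rightarrow> nat) \<times> int"
type_synonym config = "nat \<times> tape list"

fun move_offset :: "move \<Rightarrow> int" where
  "move_offset L_move = -1"
| "move_offset N_move = 0"
| "move_offset R_move = 1"

definition scan :: "tape \<Rightarrow> nat" where
  "scan t = fst t (snd t)"

definition act :: "nat \<times> move \<Rightarrow> tape \<Rightarrow> tape" where
  "act a t = ((fst t)(snd t := fst a), snd t + move_offset (snd a))"

definition step :: "tm \<Rightarrow> config \<Rightarrow> config" where
  "step M c = (case c of (q, ts) \<Rightarrow>
     if q = 1 then c
     else (case delta M q (map scan ts) of (q', acts) \<Rightarrow> (q', map2 act acts ts)))"

definition contents :: "nat list \<Rightarrow> int \<Rightarrow> nat" where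
  "contents w i = (if 0 \<le> i \<and> nat i < length w then w ! nat i else 0)"

definition init :: "tm \<Rightarrow> nat list \<Rightarrow> config" where
  "init M w = (0, (contents w, 0) # replicate (tapes M - 1) (contents [], 0))"

text \<open>The input is on the first tape, the output on the last one.\<close>

definition outputs_within :: "tm \<Rightarrow> nat list \<Rightarrow> nat list \<Rightarrow> nat \<Rightarrow> bool" where
  "outputs_within M w v T \<longleftrightarrow>
     (\<exists>t\<le>T. case (step M ^^ t) (init M w) of (q, ts) \<Rightarrow> q = 1 \<and> fst (last ts) = contents v)"


section \<open>Polynomial-time computability\<close>

text \<open>
  A list of bit strings is written on a tape with 1 for \<open>False\<close>, 2 for \<open>True\<close>, and every string
  terminated by the symbol 3.
\<close>

definition enc :: "bool list list \<Rightarrow> nat list" where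
  "enc ws = concat (map (\<lambda>w. map (\<lambda>b. if b then 2 else 1) w @ [3]) ws)"

definition polytime_on :: "bool list list set \<Rightarrow> (bool list list \<Rightarrow> bool list list) \<Rightarrow> bool" where
  "polytime_on A f \<longleftrightarrow> (\<exists>M (p :: nat poly). wf_tm M \<and>
     (\<forall>ws\<in>A. outputs_within M (enc ws) (enc (f ws)) (poly p (length (enc ws)))))"

definition polytime_decides_on :: "bool list list set \<Rightarrow> (bool list list \<Rightarrow> bool) \<Rightarrow> bool" where
  "polytime_decides_on A R \<longleftrightarrow> polytime_on A (\<lambda>ws. [[R ws]])"


section \<open>Complexity classes\<close>

type_synonym language = "bool list set"

definition NP :: "language set" where
  "NP = {L. \<exists>(p :: nat poly) R.
     polytime_decides_on {[x, w] | x w. True} R \<and>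
     (\<forall>x. x \<in> L \<longleftrightarrow> (\<exists>w. length w \<le> poly p (length x) \<and> R [x, w]))}"

text \<open>
  A one-round verifier with \<open>k\<close> provers and one-bit answers: on input \<open>x\<close> it tosses
  \<open>poly p (length x)\<close> coins \<open>r\<close> (all its coins, including those only used for the final decision),
  sends the \<open>i\<close>-th entry of \<open>Q [x, r]\<close> to prover \<open>i\<close> for each \<open>i < k\<close>, receives the bit string \<open>a\<close>
  of the \<open>k\<close> answers, and accepts iff \<open>V [x, r, a]\<close>.
\<close>

definition verifier ::
  "nat \<Rightarrow> nat poly \<Rightarrow> (bool list list \<Rightarrow> bool list list) \<Rightarrow> (bool list list \<Rightarrow> bool) \<Rightarrow> bool" where
  "verifier k p Q V \<longleftrightarrow>
     polytime_on {[x, r] | x r. length r = poly p (length x)} Q \<and>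
     polytime_decides_on {[x, r, a] | x r a. length r = poly p (length x) \<and> length a = k} V \<and>
     (\<forall>x r. length r = poly p (length x) \<longrightarrow> length (Q [x, r]) = k)"

text \<open>
  A strategy of a prover is an arbitrary function from questions to answer bits. It does not see
  the coins or the other questions. Strategies are chosen per input, so they need not take \<open>x\<close>
  as an argument.
\<close>

definition accept_prob ::
  "nat \<Rightarrow> nat poly \<Rightarrow> (bool list list \<Rightarrow> bool list list) \<Rightarrow> (bool list list \<Rightarrow> bool) \<Rightarrow>
   (nat \<Rightarrow> bool list \<Rightarrow> bool) \<Rightarrow> bool list \<Rightarrow> real" where
  "accept_prob k p Q V P x =
     measure_pmf.prob (pmf_of_set {r. length r = poly p (length x)})
       {r. V [x, r, map (\<lambda>i. P i (Q [x, r] ! i)) [0..<k]]}"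

definition MIP1 :: "nat \<Rightarrow> real \<Rightarrow> real \<Rightarrow> language set" where
  "MIP1 k c s = {L. \<exists>p Q V. verifier k p Q V \<and>
     (\<forall>x\<in>L. \<exists>P. accept_prob k p Q V P x \<ge> c) \<and>
     (\<forall>x. x \<notin> L \<longrightarrow> (\<forall>P. accept_prob k p Q V P x \<le> s))}"

end

theory Submission
  imports Defs "HOL-Library.Countable" "HOL-Real_Asymp.Real_Asymp"
begin

text \<open>
  No PCP theorem is needed, because the verifier may use polynomially many coins and may send
  polynomially long questions. By Cook and Levin, membership of \<open>x\<close> amounts to the solvability of
  quadratic equations over \<open>F\<^sub>2\<close>, that is, to a matrix \<open>X\<close> of rank one that satisfies linear
  equations. Put \<open>Z = X\<^sup>\<otimes>\<^sup>m\<close> for a large constant \<open>m\<close>. The second question is the first one shifted by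
  a random vector \<open>z\<close>, and the two answers have to differ by a random bit \<open>b\<close>; the honest provers
  answer \<open>Z \<bullet> q\<close>. The shift adds to \<open>b\<close> times the first unit vector a random combination of
  the equations, applied to every tensor factor, and \<open>t\<close> random products of \<open>2m\<close> vectors.

  By Fourier analysis the bias of any strategy is at most the largest eigenvalue of the shift over
  all tensors \<open>Z\<close>. The eigenvalue is 0 unless \<open>Z\<close> satisfies the equations, and otherwise the
  \<open>t\<close>-th power of the expectation of the sign of \<open>Z(u)\<close> over random products \<open>u\<close>. A bilinear
  form is 1 at random vectors with probability 1/4 if it has rank one and at least 3/8 if it has
  larger rank. Hence the expectation is
  \<open>1 - 2(1/4)\<^sup>m\<close> for a solution and at most \<open>1 - 2(3/8)\<^sup>m\<close> if there is none, and
  \<open>t \<approx> \<epsilon> 4\<^sup>m\<close> brings the bias above \<open>1 - 2\<epsilon>\<close> and below \<open>2\<epsilon>\<close>, respectively.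
\<close>

section \<open>A while language on tapes\<close>

text \<open>The power \<open>m\<close> amplifies: one bilinear form separates the probabilities 1/4
  and 3/8 by a constant factor only, an \<open>m\<close>-th power by (3/2)^m, and this unbounded gap
  leaves room for noise that spares solutions and destroys all else. The provers may use any tensor,
  not only powers. Hence the equations are imposed on each factor with all other coordinates fixed;
  this survives the contraction of a factor and allows induction on \<open>m\<close>. The bit
  \<open>b\<close> forces coordinate 0 of the tensor to be 1, since otherwise the zero tensor, that
  is constant answers, would satisfy everything.

  The other obstacle is that the verifier must be an explicit Turing machine. Each bit of a question
  is the parity of a number of assignments satisfying formulas from a list that depends only on the
  NP machine, \<open>m\<close> and \<open>t\<close>; variables range over the positions of a word of
  length N built from the input, and nested loops over heads do the counting. So all indices are
  tuples of numbers below N, and the equations are finitely many schemas instantiated at all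
  positions. A tableau variable is a triple of time, column and type, a matrix entry a pair of
  those, whence the exponent \<open>6 * m\<close>.\<close>

datatype com =
    Skip
  | Op nat "(nat \<Rightarrow> nat) \<Rightarrow> nat" move
  | Seq com com
  | Cond "(nat \<Rightarrow> nat) \<Rightarrow> bool" com com
  | While "(nat \<Rightarrow> nat) \<Rightarrow> bool" com

type_synonym state = "nat \<Rightarrow> tape"

definition scans :: "state \<Rightarrow> nat \<Rightarrow> nat" where
  "scans \<sigma> i = scan (\<sigma> i)"

text \<open>The additive constants are the steps of the compiled code: one for each branch, and one
  for the jump over an else part or back to the head of a loop.\<close>

inductive big :: "com \<Rightarrow> state \<Rightarrow> nat \<Rightarrow> state \<Rightarrow> bool" where
  Skip: "big Skip \<sigma> 0 \<sigma>"
| Op: "big (Op k g m) \<sigma> 1 (\<sigma>(k := act (g (scans \<sigma>), m) (\<sigma> k)))"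
| Seq: "big c \<sigma> t \<sigma>' \<Longrightarrow> big d \<sigma>' t' \<sigma>'' \<Longrightarrow> big (Seq c d) \<sigma> (t + t') \<sigma>''"
| IfT: "b (scans \<sigma>) \<Longrightarrow> big c \<sigma> t \<sigma>' \<Longrightarrow> big (Cond b c d) \<sigma> (t + 2) \<sigma>'"
| IfF: "\<not> b (scans \<sigma>) \<Longrightarrow> big d \<sigma> t \<sigma>' \<Longrightarrow> big (Cond b c d) \<sigma> (t + 1) \<sigma>'"
| WhileF: "\<not> b (scans \<sigma>) \<Longrightarrow> big (While b c) \<sigma> 1 \<sigma>"
| WhileT: "b (scans \<sigma>) \<Longrightarrow> big c \<sigma> t \<sigma>' \<Longrightarrow> big (While b c) \<sigma>' t' \<sigma>'' \<Longrightarrow>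
    big (While b c) \<sigma> (t + t' + 2) \<sigma>''"

fun wf_com :: "nat \<Rightarrow> nat \<Rightarrow> com \<Rightarrow> bool" where
  "wf_com K S Skip \<longleftrightarrow> True"
| "wf_com K S (Op k g m) \<longleftrightarrow> k < K \<and> (\<forall>f. (\<forall>i. f i < S) \<longrightarrow> g f < S)"
| "wf_com K S (Seq c d) \<longleftrightarrow> wf_com K S c \<and> wf_com K S d"
| "wf_com K S (Cond b c d) \<longleftrightarrow> wf_com K S c \<and> wf_com K S d"
| "wf_com K S (While b c) \<longleftrightarrow> wf_com K S c"

section \<open>Compilation of programs to Turing machines\<close>

datatype instr = Exec nat "(nat \<Rightarrow> nat) \<Rightarrow> nat" move | Branch "(nat \<Rightarrow> nat) \<Rightarrow> bool" nat

fun clen :: "com \<Rightarrow> nat" where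
  "clen Skip = 0"
| "clen (Op k g m) = 1"
| "clen (Seq c d) = clen c + clen d"
| "clen (Cond b c d) = clen c + clen d + 2"
| "clen (While b c) = clen c + 2"

fun compile :: "com \<Rightarrow> nat \<Rightarrow> instr list" where
  "compile Skip n = []"
| "compile (Op k g m) n = [Exec k g m]"
| "compile (Seq c d) n = compile c n @ compile d (n + clen c)"
| "compile (Cond b c d) n =
     Branch b (n + clen c + 2) # compile c (n + 1) @
     Branch (\<lambda>_. False) (n + clen c + clen d + 2) # compile d (n + clen c + 2)"
| "compile (While b c) n =
     Branch b (n + clen c + 2) # compile c (n + 1) @ [Branch (\<lambda>_. False) n]"

lemma length_compile [simp]: "length (compile c n) = clen c"
  by (induction c arbitrary: n) auto

fun wf_instr :: "nat \<Rightarrow> nat \<Rightarrow> nat \<Rightarrow> instr \<Rightarrow> bool" where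
  "wf_instr K S l (Exec k g m) \<longleftrightarrow> k < K \<and> (\<forall>f. (\<forall>i. f i < S) \<longrightarrow> g f < S)"
| "wf_instr K S l (Branch b n) \<longleftrightarrow> n \<le> l"

lemma wf_instr_mono: "wf_instr K S l i \<Longrightarrow> l \<le> l' \<Longrightarrow> wf_instr K S l' i"
  by (cases i) auto

lemma wf_compile: "wf_com K S c \<Longrightarrow> i \<in> set (compile c n) \<Longrightarrow> wf_instr K S (n + clen c) i"
proof (induction c arbitrary: n i)
  case (Seq c d)
  then show ?case
    by (fastforce intro: wf_instr_mono simp: add.assoc)
next
  case (Cond b c d)
  then have "i = Branch b (n + clen c + 2) \<or> i = Branch (\<lambda>_. False) (n + clen c + clen d + 2)
    \<or> i \<in> set (compile c (n + 1)) \<or> i \<in> set (compile d (n + clen c + 2))" by auto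
  moreover have "wf_instr K S (n + clen (Cond b c d)) i" if "i \<in> set (compile c (n + 1))"
    using Cond.IH(1)[OF _ that] Cond.prems by (auto intro: wf_instr_mono)
  moreover have "wf_instr K S (n + clen (Cond b c d)) i" if "i \<in> set (compile d (n + clen c + 2))"
    using Cond.IH(2)[OF _ that] Cond.prems by (auto intro: wf_instr_mono)
  ultimately show ?case by auto
next
  case (While b c)
  then have "i = Branch b (n + clen c + 2) \<or> i = Branch (\<lambda>_. False) n
    \<or> i \<in> set (compile c (n + 1))" by auto
  moreover have "wf_instr K S (n + clen (While b c)) i" if "i \<in> set (compile c (n + 1))"
    using While.IH(1)[OF _ that] While.prems by (auto intro: wf_instr_mono)
  ultimately show ?case by auto
qed auto

fun exec_instr :: "instr list \<Rightarrow> nat \<times> state \<Rightarrow> nat \<times> state" where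
  "exec_instr P (pc, \<sigma>) = (if length P \<le> pc then (pc, \<sigma>) else
     (case P ! pc of
        Exec k g m \<Rightarrow> (Suc pc, \<sigma>(k := act (g (scans \<sigma>), m) (\<sigma> k)))
      | Branch b n \<Rightarrow> (if b (scans \<sigma>) then Suc pc else n, \<sigma>)))"

definition code_at :: "instr list \<Rightarrow> nat \<Rightarrow> instr list \<Rightarrow> bool" where
  "code_at P n C \<longleftrightarrow> (\<exists>A B. P = A @ C @ B \<and> length A = n)"

lemma code_at_append:
  "code_at P n (C @ D) \<longleftrightarrow> code_at P n C \<and> code_at P (n + length C) D"
proof
  assume "code_at P n (C @ D)"
  then obtain A B where "P = A @ (C @ D) @ B" "length A = n" unfolding code_at_def by blast
  then have "P = A @ C @ (D @ B)" "P = (A @ C) @ D @ B" "length (A @ C) = n + length C" "length A = n" by auto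
  then show "code_at P n C \<and> code_at P (n + length C) D" unfolding code_at_def by blast
next
  assume "code_at P n C \<and> code_at P (n + length C) D"
  then obtain A B A' B' where *: "P = A @ C @ B" "length A = n" "P = A' @ D @ B'" "length A' = n + length C"
    unfolding code_at_def by blast
  then have "A' = A @ C" "B = D @ B'"
    by (metis append_assoc append_eq_append_conv length_append)+
  then show "code_at P n (C @ D)" using * unfolding code_at_def by auto
qed

lemma code_at_Cons:
  "code_at P n (i # C) \<longleftrightarrow> n < length P \<and> P ! n = i \<and> code_at P (Suc n) C"
proof -
  have "code_at P n [i] \<longleftrightarrow> n < length P \<and> P ! n = i"
  proof
    assume "n < length P \<and> P ! n = i"
    then show "code_at P n [i]" unfolding code_at_def
      by (intro exI[of _ "take n P"] exI[of _ "drop (Suc n) P"]) (auto simp: id_take_nth_drop)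
  qed (auto simp: code_at_def nth_append)
  then show ?thesis using code_at_append[of P n "[i]" C] by simp
qed

text \<open>The fragment sits at its absolute address inside an arbitrary program, so the induction
  hypotheses apply to subprograms in place and jumps need no relocation.\<close>

lemma exec_compile:
  assumes "big c \<sigma> t \<sigma>'" "code_at P n (compile c n)"
  shows "\<exists>t'\<le>t. (exec_instr P ^^ t') (n, \<sigma>) = (n + clen c, \<sigma>')"
  using assms
proof (induction arbitrary: n rule: big.induct)
  case (Skip \<sigma>)
  then show ?case by auto
next
  case (Op k g m \<sigma>)
  then have "n < length P" "P ! n = Exec k g m" by (auto simp: code_at_Cons)
  then show ?case by (intro exI[of _ 1]) auto
next
  case (Seq c \<sigma> t \<sigma>' d t' \<sigma>'')
  obtain u where u: "u \<le> t" "(exec_instr P ^^ u) (n, \<sigma>) = (n + clen c, \<sigma>')"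
    using Seq.IH(1)[of n] Seq.prems by (auto simp: code_at_append)
  obtain v where v: "v \<le> t'" "(exec_instr P ^^ v) (n + clen c, \<sigma>') = (n + clen c + clen d, \<sigma>'')"
    using Seq.IH(2)[of "n + clen c"] Seq.prems by (auto simp: code_at_append)
  have "(exec_instr P ^^ (v + u)) (n, \<sigma>) = (n + clen (Seq c d), \<sigma>'')"
    using u v by (simp add: funpow_add add.assoc)
  then show ?case using u v by (intro exI[of _ "v + u"]) auto
next
  case (IfT b \<sigma> c t \<sigma>' d)
  from IfT.prems have p: "n < length P" "P ! n = Branch b (n + clen c + 2)" "code_at P (Suc n) (compile c (n + 1))"
    "Suc n + clen c < length P" "P ! (Suc n + clen c) = Branch (\<lambda>_. False) (n + clen c + clen d + 2)"
    by (auto simp: code_at_Cons code_at_append)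
  obtain u where u: "u \<le> t" "(exec_instr P ^^ u) (Suc n, \<sigma>) = (Suc n + clen c, \<sigma>')"
    using IfT.IH[of "Suc n"] p by auto
  have "(exec_instr P ^^ (1 + u + 1)) (n, \<sigma>) = (n + clen (Cond b c d), \<sigma>')"
    using u p IfT.hyps by (simp add: funpow_add del: funpow.simps) (simp add: funpow_swap1)
  then show ?case using u by (intro exI[of _ "1 + u + 1"]) auto
next
  case (IfF b \<sigma> d t \<sigma>' c)
  from IfF.prems have p: "n < length P" "P ! n = Branch b (n + clen c + 2)"
    "code_at P (n + clen c + 2) (compile d (n + clen c + 2))"
    by (auto simp: code_at_Cons code_at_append)
  obtain u where u: "u \<le> t" "(exec_instr P ^^ u) (n + clen c + 2, \<sigma>) = (n + clen c + 2 + clen d, \<sigma>')"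
    using IfF.IH[OF p(3)] by auto
  have "(exec_instr P ^^ (u + 1)) (n, \<sigma>) = (n + clen (Cond b c d), \<sigma>')"
    using u p IfF.hyps by (simp add: funpow_swap1)
  then show ?case using u by (intro exI[of _ "u + 1"]) auto
next
  case (WhileF b \<sigma> c)
  from WhileF.prems have p: "n < length P" "P ! n = Branch b (n + clen c + 2)"
    by (auto simp: code_at_Cons code_at_append)
  then show ?case using WhileF.hyps by (intro exI[of _ 1]) auto
next
  case (WhileT b \<sigma> c t \<sigma>' t' \<sigma>'')
  from WhileT.prems have p: "n < length P" "P ! n = Branch b (n + clen c + 2)" "code_at P (Suc n) (compile c (n + 1))"
    "Suc n + clen c < length P" "P ! (Suc n + clen c) = Branch (\<lambda>_. False) n"
    by (auto simp: code_at_Cons code_at_append)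
  obtain u where u: "u \<le> t" "(exec_instr P ^^ u) (Suc n, \<sigma>) = (Suc n + clen c, \<sigma>')"
    using WhileT.IH(1)[of "Suc n"] p by auto
  obtain v where v: "v \<le> t'" "(exec_instr P ^^ v) (n, \<sigma>') = (n + clen (While b c), \<sigma>'')"
    using WhileT.IH(2)[OF WhileT.prems] by auto
  have "(exec_instr P ^^ (1 + u + 1)) (n, \<sigma>) = (n, \<sigma>')"
    using u p WhileT.hyps by (simp add: funpow_add del: funpow.simps) (simp add: funpow_swap1)
  then have "(exec_instr P ^^ (v + (1 + u + 1))) (n, \<sigma>) = (n + clen (While b c), \<sigma>'')"
    using v by (simp only: funpow_add o_apply)
  then show ?case using u v by (intro exI[of _ "v + (1 + u + 1)"]) auto
qed

text \<open>The machine model fixes 0 as the initial and 1 as the halting state. The end address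
  therefore becomes 1 and the other positive addresses move up by one. Truncated subtraction of 1
  decodes every state except 1, including 0.\<close>

definition pc_state :: "nat \<Rightarrow> nat \<Rightarrow> nat" where
  "pc_state l pc = (if pc = l then 1 else if pc = 0 then 0 else pc + 1)"

definition list_fun :: "nat list \<Rightarrow> nat \<Rightarrow> nat" where
  "list_fun ss i = (if i < length ss then ss ! i else 0)"

definition machine :: "nat \<Rightarrow> nat \<Rightarrow> instr list \<Rightarrow> tm" where
  "machine K S P = \<lparr>tapes = K, states = length P + 1, symbols = S, delta = (\<lambda>q ss.
     let pc = q - 1; f = list_fun ss in
     if q = 1 \<or> length P \<le> pc then (1, map (\<lambda>i. (f i, N_move)) [0..<K])
     else (case P ! pc of
         Exec k g m \<Rightarrow> (pc_state (length P) (Suc pc), map (\<lambda>i. if i = k then (g f, m) else (f i, N_move)) [0..<K])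
       | Branch b n \<Rightarrow> (pc_state (length P) (if b f then Suc pc else n), map (\<lambda>i. (f i, N_move)) [0..<K])))\<rparr>"

lemma pc_state_less: "l \<ge> 1 \<Longrightarrow> pc \<le> l \<Longrightarrow> pc_state l pc < l + 1"
  by (auto simp: pc_state_def)

lemma wf_machine:
  assumes "K \<ge> 1" "S \<ge> 4" "length P \<ge> 1" "\<And>i. i \<in> set P \<Longrightarrow> wf_instr K S (length P) i"
  shows "wf_tm (machine K S P)"
proof -
  have "case delta (machine K S P) q ss of (q', acts) \<Rightarrow>
        q' < length P + 1 \<and> length acts = K \<and> (\<forall>(s, m)\<in>set acts. s < S)"
    if "length ss = K" "\<forall>s\<in>set ss. s < S" for q ss
  proof -
    have f: "list_fun ss i < S" for i using that assms by (auto simp: list_fun_def)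
    show ?thesis
    proof (cases "q = 1 \<or> length P \<le> q - 1")
      case True
      then show ?thesis using f assms by (auto simp: machine_def Let_def)
    next
      case False
      then have w: "wf_instr K S (length P) (P ! (q - 1))" using assms(4) by auto
      show ?thesis using False w f assms(1-3)
        by (cases "P ! (q - 1)") (auto simp: machine_def Let_def intro!: pc_state_less[of "length P", simplified])
    qed
  qed
  then show ?thesis using assms unfolding wf_tm_def by (auto simp: machine_def)
qed

lemma act_scan [simp]: "act (scan t, N_move) t = t"
  by (auto simp: act_def scan_def)

lemma map2_map_upt: "map2 f (map g [0..<n]) (map h [0..<n]) = map (\<lambda>i. f (g i) (h i)) [0..<n]"
  by (rule nth_equalityI) auto

text \<open>Guards and operations see a function on all tape numbers, while the machine has only
  \<open>K\<close> tapes. The two views agree as long as the tapes from \<open>K\<close> on scan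
  blanks, because \<open>list_fun\<close> supplies 0 there.\<close>

lemma step_machine:
  assumes len: "length P \<ge> 1" and pc: "pc < length P" and blank: "\<forall>i\<ge>K. scan (\<sigma> i) = 0"
  shows "step (machine K S P) (pc_state (length P) pc, map \<sigma> [0..<K]) =
    (case exec_instr P (pc, \<sigma>) of (pc', \<sigma>') \<Rightarrow> (pc_state (length P) pc', map \<sigma>' [0..<K]))"
proof -
  have f: "list_fun (map scan (map \<sigma> [0..<K])) = scans \<sigma>"
    using blank by (auto simp: list_fun_def scans_def fun_eq_iff)
  have q: "pc_state (length P) pc \<noteq> 1"
    "pc_state (length P) pc - 1 = pc"
    using pc by (auto simp: pc_state_def)
  have d: "delta (machine K S P) (pc_state (length P) pc) (map scan (map \<sigma> [0..<K])) =
     (case P ! pc of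
         Exec k g m \<Rightarrow> (pc_state (length P) (Suc pc), map (\<lambda>i. if i = k then (g (scans \<sigma>), m) else (scans \<sigma> i, N_move)) [0..<K])
       | Branch b n \<Rightarrow> (pc_state (length P) (if b (scans \<sigma>) then Suc pc else n), map (\<lambda>i. (scans \<sigma> i, N_move)) [0..<K]))"
    using q pc unfolding machine_def by (cases "P ! pc") (simp_all add: f Let_def del: map_map)
  show ?thesis
    using q(1) pc unfolding step_def
    by (cases "P ! pc") (auto simp: d map2_map_upt scans_def simp del: map_map intro!: map_cong)
qed

lemma step_halted: "step M (Suc 0, ts) = (Suc 0, ts)"
  by (simp add: step_def)

lemma steps_machine:
  assumes "length P \<ge> 1" "\<And>i. i \<in> set P \<Longrightarrow> wf_instr K S (length P) i" "\<forall>i\<ge>K. scan (\<sigma> i) = 0" "pc \<le> length P"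
  shows "(step (machine K S P) ^^ t) (pc_state (length P) pc, map \<sigma> [0..<K]) =
    (case (exec_instr P ^^ t) (pc, \<sigma>) of (pc', \<sigma>') \<Rightarrow> (pc_state (length P) pc', map \<sigma>' [0..<K]))
    \<and> fst ((exec_instr P ^^ t) (pc, \<sigma>)) \<le> length P \<and> (\<forall>i\<ge>K. scan (snd ((exec_instr P ^^ t) (pc, \<sigma>)) i) = 0)"
proof (induction t)
  case 0
  then show ?case using assms by simp
next
  case (Suc t)
  obtain pc' \<sigma>' where e: "(exec_instr P ^^ t) (pc, \<sigma>) = (pc', \<sigma>')" by fastforce
  show ?case
  proof (cases "pc' = length P")
    case True
    then show ?thesis using Suc e by (simp add: step_halted pc_state_def)
  next
    case False
    then have pc': "pc' < length P" using Suc e by auto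
    then have "wf_instr K S (length P) (P ! pc')" using assms(2) by auto
    then show ?thesis using Suc e step_machine[OF assms(1) pc', of K \<sigma>' S] pc'
      by (cases "P ! pc'") (auto split: prod.splits)
  qed
qed

definition init_state :: "nat list \<Rightarrow> state" where
  "init_state w i = (if i = 0 then (contents w, 0) else (contents [], 0))"

lemma outputs_within_machine:
  assumes "K \<ge> 1" "S \<ge> 4" "wf_com K S c" "clen c \<ge> 1"
    "big c (init_state w) t \<sigma>'" "fst (\<sigma>' (K - 1)) = contents v" "t \<le> T"
  shows "outputs_within (machine K S (compile c 0)) w v T"
proof -
  let ?P = "compile c 0"
  have P: "length ?P \<ge> 1" "\<And>i. i \<in> set ?P \<Longrightarrow> wf_instr K S (length ?P) i"
    using assms wf_compile[OF assms(3), of _ 0] by auto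
  have "code_at ?P 0 (compile c 0)" unfolding code_at_def by auto
  from exec_compile[OF assms(5) this] obtain t' where t': "t' \<le> t" "(exec_instr ?P ^^ t') (0, init_state w) = (clen c, \<sigma>')"
    by auto
  have i: "init (machine K S ?P) w = (pc_state (length ?P) 0, map (init_state w) [0..<K])"
    using assms(1,4) by (auto simp: init_def machine_def pc_state_def init_state_def nth_Cons'
        intro!: nth_equalityI)
  have "(step (machine K S ?P) ^^ t') (init (machine K S ?P) w) = (1, map \<sigma>' [0..<K])"
    using steps_machine[OF P, where \<sigma> = "init_state w" and pc = 0 and t = t'] t'(2) assms
    by (auto simp: i init_state_def pc_state_def scan_def contents_def)
  then show ?thesis unfolding outputs_within_def using t' assms
    by (intro exI[of _ t']) (auto simp: last_map)
qed

lemma polytime_onI: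
  fixes p :: "nat poly"
  assumes "K \<ge> 1" "S \<ge> 4" "wf_com K S c" "clen c \<ge> 1"
    "\<And>ws. ws \<in> A \<Longrightarrow> \<exists>t \<sigma>'. big c (init_state (enc ws)) t \<sigma>' \<and> t \<le> poly p (length (enc ws)) \<and>
       fst (\<sigma>' (K - 1)) = contents (enc (f ws))"
  shows "polytime_on A f"
  unfolding polytime_on_def
proof (intro exI conjI ballI)
  show "wf_tm (machine K S (compile c 0))"
    using assms wf_compile[OF assms(3), of _ 0] by (intro wf_machine) auto
  fix ws assume "ws \<in> A"
  with assms(5) obtain t \<sigma>' where "big c (init_state (enc ws)) t \<sigma>'" "t \<le> poly p (length (enc ws))"
    "fst (\<sigma>' (K - 1)) = contents (enc (f ws))" by blast
  then show "outputs_within (machine K S (compile c 0)) (enc ws) (enc (f ws)) (poly p (length (enc ws)))"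
    using outputs_within_machine assms by blast
qed

section \<open>Running times as upper bounds, and loops driven by head positions\<close>

definition runs :: "com \<Rightarrow> state \<Rightarrow> nat \<Rightarrow> state \<Rightarrow> bool" where
  "runs c \<sigma> B \<sigma>' \<longleftrightarrow> (\<exists>t\<le>B. big c \<sigma> t \<sigma>')"

lemma runs_mono: "runs c \<sigma> B \<sigma>' \<Longrightarrow> B \<le> B' \<Longrightarrow> runs c \<sigma> B' \<sigma>'"
  unfolding runs_def by (meson order_trans)

lemma runs_Skip: "runs Skip \<sigma> B \<sigma>"
  unfolding runs_def using big.Skip by blast

lemma runs_Op: "\<sigma>' = \<sigma>(k := act (g (scans \<sigma>), m) (\<sigma> k)) \<Longrightarrow> 1 \<le> B \<Longrightarrow> runs (Op k g m) \<sigma> B \<sigma>'"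
  unfolding runs_def using big.Op by blast

lemma runs_Seq: "runs c \<sigma> B \<sigma>' \<Longrightarrow> runs d \<sigma>' B' \<sigma>'' \<Longrightarrow> runs (Seq c d) \<sigma> (B + B') \<sigma>''"
  unfolding runs_def using big.Seq add_mono by metis

lemma runs_Cond:
  assumes "runs (if b (scans \<sigma>) then c else d) \<sigma> B \<sigma>'"
  shows "runs (Cond b c d) \<sigma> (B + 2) \<sigma>'"
proof -
  from assms obtain t where t: "t \<le> B" "big (if b (scans \<sigma>) then c else d) \<sigma> t \<sigma>'"
    unfolding runs_def by blast
  show ?thesis
  proof (cases "b (scans \<sigma>)")
    case True
    then have "big (Cond b c d) \<sigma> (t + 2) \<sigma>'" using t by (intro big.IfT) auto
    then show ?thesis using t unfolding runs_def by (intro exI[of _ "t + 2"]) auto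
  next
    case False
    then have "big (Cond b c d) \<sigma> (t + 1) \<sigma>'" using t by (intro big.IfF) auto
    then show ?thesis using t unfolding runs_def by (intro exI[of _ "t + 1"]) auto
  qed
qed

lemma runs_While:
  assumes "\<And>i. i < n \<Longrightarrow> b (scans (f i))" "\<And>i. i < n \<Longrightarrow> runs c (f i) B (f (Suc i))"
    "\<not> b (scans (f n))"
  shows "runs (While b c) (f 0) (n * (B + 2) + 1) (f n)"
  using assms
proof (induction n arbitrary: f)
  case 0
  then show ?case unfolding runs_def using big.WhileF[of b "f 0" c] by auto
next
  case (Suc n)
  have "runs (While b c) (f (Suc 0)) (n * (B + 2) + 1) (f (Suc n))"
    using Suc.IH[of "\<lambda>i. f (Suc i)"] Suc.prems by auto
  then obtain t where t: "t \<le> n * (B + 2) + 1" "big (While b c) (f (Suc 0)) t (f (Suc n))"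
    unfolding runs_def by blast
  obtain u where u: "u \<le> B" "big c (f 0) u (f (Suc 0))" using Suc.prems(2)[of 0] unfolding runs_def by blast
  have "big (While b c) (f 0) (u + t + 2) (f (Suc n))"
    using Suc.prems(1)[of 0] u t by (intro big.WhileT) auto
  then show ?case unfolding runs_def using u t by (intro exI[of _ "u + t + 2"]) auto
qed

definition left :: "nat \<Rightarrow> com" where "left k = Op k (\<lambda>f. f k) L_move"
definition right :: "nat \<Rightarrow> com" where "right k = Op k (\<lambda>f. f k) R_move"

lemma runs_left: "runs (left k) \<sigma> 1 (\<sigma>(k := (fst (\<sigma> k), snd (\<sigma> k) - 1)))"
  unfolding left_def by (rule runs_Op) (auto simp: act_def scans_def scan_def)

lemma runs_right: "runs (right k) \<sigma> 1 (\<sigma>(k := (fst (\<sigma> k), snd (\<sigma> k) + 1)))"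
  unfolding right_def by (rule runs_Op) (auto simp: act_def scans_def scan_def)

definition rewind :: "nat \<Rightarrow> com" where
  "rewind v = Seq (left v) (Seq (While (\<lambda>f. f v \<noteq> 0) (left v)) (right v))"

text \<open>The loop counter is a head: the body runs once per letter of the blank-free word on tape
  \<open>v\<close>, and the final rewind makes the loop usable inside another one.\<close>

definition For :: "nat \<Rightarrow> com \<Rightarrow> com" where
  "For v c = Seq (While (\<lambda>f. f v \<noteq> 0) (Seq c (right v))) (rewind v)"

lemma contents_eq_0: "0 \<notin> set w \<Longrightarrow> contents w i = 0 \<longleftrightarrow> i < 0 \<or> int (length w) \<le> i"
  unfolding contents_def by (auto simp: nat_less_iff) (metis nat_less_iff nth_mem not_less)

lemma contents_snoc: "(contents w)(int (length w) := a) = contents (w @ [a])"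
  by (auto simp: fun_eq_iff contents_def nth_append)

lemma runs_rewind:
  assumes "0 \<notin> set w" "\<sigma> v = (contents w, int (length w))"
  shows "runs (rewind v) \<sigma> (length w * 3 + 3) (\<sigma>(v := (contents w, 0)))"
proof -
  let ?n = "length w"
  define f where "f i = \<sigma>(v := (contents w, int ?n - 1 - int i))" for i
  have 1: "runs (left v) \<sigma> 1 (f 0)" using runs_left[of v \<sigma>] assms by (simp add: f_def)
  have 2: "runs (While (\<lambda>f. f v \<noteq> 0) (left v)) (f 0) (?n * (1 + 2) + 1) (f ?n)"
  proof (rule runs_While)
    show "runs (left v) (f i) 1 (f (Suc i))" for i using runs_left[of v "f i"] by (simp add: f_def algebra_simps)
  qed (auto simp: f_def scans_def scan_def contents_eq_0[OF assms(1)])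
  have 3: "runs (right v) (f ?n) 1 (\<sigma>(v := (contents w, 0)))" using runs_right[of v "f ?n"] by (simp add: f_def)
  show ?thesis unfolding rewind_def
    by (rule runs_mono[OF runs_Seq[OF 1 runs_Seq[OF 2 3]]]) auto
qed

text \<open>\<open>g i\<close> is the state after \<open>i\<close> rounds with the counter head put
  back to 0; during the round only this head is overwritten by its true position, and the body may
  change everything else.\<close>

lemma runs_For:
  assumes w: "0 \<notin> set w" "length w = n" and g: "g n v = (contents w, 0)"
    and 0: "g 0 v = (contents w, 0)"
    and body: "\<And>i. i < n \<Longrightarrow> runs c ((g i)(v := (contents w, int i))) B ((g (Suc i))(v := (contents w, int i)))"
  shows "runs (For v c) (g 0) (n * (B + 6) + 4) (g n)"
proof -
  define f where "f i = (g i)(v := (contents w, int i))" for i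
  have "runs (While (\<lambda>f. f v \<noteq> 0) (Seq c (right v))) (f 0) (n * (B + 1 + 2) + 1) (f n)"
  proof (rule runs_While)
    show "runs (Seq c (right v)) (f i) (B + 1) (f (Suc i))" if "i < n" for i
    proof (rule runs_Seq)
      show "runs c (f i) B ((g (Suc i))(v := (contents w, int i)))" using body[OF that] by (simp add: f_def)
      show "runs (right v) ((g (Suc i))(v := (contents w, int i))) 1 (f (Suc i))"
        using runs_right[of v "(g (Suc i))(v := (contents w, int i))"] by (simp add: f_def algebra_simps)
    qed
  qed (use w in \<open>auto simp: f_def scans_def scan_def contents_eq_0\<close>)
  moreover have "f 0 = g 0" using 0 by (auto simp: f_def)
  moreover have "runs (rewind v) (f n) (n * 3 + 3) (g n)"
    using runs_rewind[of w "f n" v] w g by (auto simp: f_def fun_upd_idem)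
  ultimately have "runs (For v c) (g 0) ((n * (B + 1 + 2) + 1) + (n * 3 + 3)) (g n)"
    unfolding For_def using runs_Seq by metis
  then show ?thesis by (rule runs_mono) (auto simp: algebra_simps)
qed

fun nest :: "nat list \<Rightarrow> com \<Rightarrow> com" where
  "nest [] c = c"
| "nest (v # vs) c = For v (nest vs c)"

fun seqs :: "com list \<Rightarrow> com" where
  "seqs [] = Skip"
| "seqs (c # cs) = Seq c (seqs cs)"

lemma wf_left [simp]: "wf_com K S (left k) \<longleftrightarrow> k < K" by (simp add: left_def)
lemma wf_right [simp]: "wf_com K S (right k) \<longleftrightarrow> k < K" by (simp add: right_def)
lemma wf_rewind [simp]: "wf_com K S (rewind k) \<longleftrightarrow> k < K" by (auto simp: rewind_def)
lemma wf_For [simp]: "wf_com K S (For k c) \<longleftrightarrow> k < K \<and> wf_com K S c" by (auto simp: For_def)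
lemma wf_nest [simp]: "wf_com K S (nest vs c) \<longleftrightarrow> (\<forall>v\<in>set vs. v < K) \<and> wf_com K S c" by (induction vs) auto
lemma wf_seqs [simp]: "wf_com K S (seqs cs) \<longleftrightarrow> (\<forall>c\<in>set cs. wf_com K S c)" by (induction cs) auto

section \<open>Evaluating formulas on coin tables\<close>

text \<open>
  Variables are heads moving on copies of a common word, so that the value of a variable is the
  position of its head.
\<close>

datatype fm =
    TT
  | Sym nat "nat \<Rightarrow> bool"
  | EqC nat nat
  | Eq nat nat
  | Sc nat nat
  | Look nat "nat list"
  | And fm fm
  | Not fm

fun tidx :: "nat \<Rightarrow> nat list \<Rightarrow> nat" where
  "tidx N [] = 0"
| "tidx N (v # vs) = v * N ^ length vs + tidx N vs"

fun eval :: "nat list \<Rightarrow> (nat \<Rightarrow> nat list \<Rightarrow> bool) \<Rightarrow> (nat \<Rightarrow> nat) \<Rightarrow> fm \<Rightarrow> bool" where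
  "eval y R e TT \<longleftrightarrow> True"
| "eval y R e (Sym v A) \<longleftrightarrow> A (y ! e v)"
| "eval y R e (EqC v n) \<longleftrightarrow> e v = n"
| "eval y R e (Eq v w) \<longleftrightarrow> e v = e w"
| "eval y R e (Sc v w) \<longleftrightarrow> e w = Suc (e v)"
| "eval y R e (Look b vs) \<longleftrightarrow> R b (map e vs)"
| "eval y R e (And \<phi> \<psi>) \<longleftrightarrow> eval y R e \<phi> \<and> eval y R e \<psi>"
| "eval y R e (Not \<phi>) \<longleftrightarrow> \<not> eval y R e \<phi>"

text \<open>A move by \<open>N ^ e\<close> cells is \<open>e\<close> nested loops around a single
  step. Reading with tuples of length \<open>d\<close> uses tapes 3 to \<open>2 + d\<close> as
  counters, so the variables of formulas start at tape \<open>3 + d\<close>.\<close>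

fun adv :: "nat \<Rightarrow> com" where
  "adv 0 = right 0"
| "adv (Suc e) = For (3 + e) (adv e)"

text \<open>The head of tape 2 counts how often the heads in \<open>vs\<close> have been moved left;
  walking it back to the start pays these moves back.\<close>

definition restore :: "nat list \<Rightarrow> com" where
  "restore vs = Seq (left 2) (Seq (While (\<lambda>f. f 2 \<noteq> 0) (Seq (left 2) (seqs (map right vs)))) (right 2))"

definition adv_var :: "nat \<Rightarrow> nat \<Rightarrow> com" where
  "adv_var v e = Seq (left v) (Seq (While (\<lambda>f. f v \<noteq> 0) (Seq (adv e) (Seq (left v) (right 2))))
     (Seq (right v) (restore [v])))"

fun adv_vars :: "nat list \<Rightarrow> com" where
  "adv_vars [] = Skip"
| "adv_vars (v # vs) = Seq (adv_var v (length vs)) (adv_vars vs)"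

text \<open>The terminator 3 of the input string stands just before the coins, and coins are written
  with 1 and 2 only, so it serves as the landmark for returning.\<close>

definition unread :: com where
  "unread = Seq (While (\<lambda>f. f 0 \<noteq> 3) (left 0)) (right 0)"

text \<open>Both heads walk left in step; the positions are equal iff they leave the word at the
  same time.\<close>

definition equals :: "nat \<Rightarrow> nat \<Rightarrow> com \<Rightarrow> com \<Rightarrow> com" where
  "equals v w ct cf = Seq (While (\<lambda>f. f v \<noteq> 0 \<and> f w \<noteq> 0) (Seq (left v) (Seq (left w) (right 2))))
     (Cond (\<lambda>f. f v = 0 \<and> f w = 0) (Seq (restore [v, w]) ct) (Seq (restore [v, w]) cf))"

fun equals_const :: "nat \<Rightarrow> nat \<Rightarrow> com \<Rightarrow> com \<Rightarrow> com" where
  "equals_const v 0 ct cf = Seq (left v) (Cond (\<lambda>f. f v = 0) (Seq (right v) ct) (Seq (right v) cf))"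
| "equals_const v (Suc n) ct cf = Seq (left v) (Cond (\<lambda>f. f v = 0) (Seq (right v) cf)
     (equals_const v n (Seq (right v) ct) (Seq (right v) cf)))"

text \<open>A truth value is never stored on a tape. Both continuations are passed down instead,
  each branch restores the heads that were moved, and negation swaps the continuations.\<close>

fun test :: "nat \<Rightarrow> fm \<Rightarrow> com \<Rightarrow> com \<Rightarrow> com" where
  "test d TT ct cf = ct"
| "test d (Sym v A) ct cf = Cond (\<lambda>f. A (f v)) ct cf"
| "test d (EqC v n) ct cf = equals_const v n ct cf"
| "test d (Eq v w) ct cf = equals v w ct cf"
| "test d (Sc v w) ct cf = Seq (left w) (equals v w (Seq (right w) ct) (Seq (right w) cf))"
| "test d (Look b vs) ct cf = Seq (seqs (replicate b (adv d))) (Seq (adv_vars vs)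
     (Cond (\<lambda>f. f 0 = 2) (Seq unread ct) (Seq unread cf)))"
| "test d (And \<phi> \<psi>) ct cf = test d \<phi> (test d \<psi> ct cf) cf"
| "test d (Not \<phi>) ct cf = test d \<phi> cf ct"

fun wf_fm :: "nat \<Rightarrow> nat \<Rightarrow> nat \<Rightarrow> fm \<Rightarrow> bool" where
  "wf_fm d ny N TT \<longleftrightarrow> True"
| "wf_fm d ny N (Sym v A) \<longleftrightarrow> 3 + d \<le> v \<and> v < 2 + ny"
| "wf_fm d ny N (EqC v n) \<longleftrightarrow> 3 + d \<le> v \<and> v < 2 + ny"
| "wf_fm d ny N (Eq v w) \<longleftrightarrow> 3 + d \<le> v \<and> v < 2 + ny \<and> 3 + d \<le> w \<and> w < 2 + ny \<and> v \<noteq> w"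
| "wf_fm d ny N (Sc v w) \<longleftrightarrow> 3 + d \<le> v \<and> v < 2 + ny \<and> 3 + d \<le> w \<and> w < 2 + ny \<and> v \<noteq> w"
| "wf_fm d ny N (Look b vs) \<longleftrightarrow> b < N \<and> length vs \<le> d \<and> (\<forall>v\<in>set vs. 3 + d \<le> v \<and> v < 2 + ny)"
| "wf_fm d ny N (And \<phi> \<psi>) \<longleftrightarrow> wf_fm d ny N \<phi> \<and> wf_fm d ny N \<psi>"
| "wf_fm d ny N (Not \<phi>) \<longleftrightarrow> wf_fm d ny N \<phi>"

lemma tidx_less: "\<forall>v\<in>set vs. v < N \<Longrightarrow> tidx N vs < N ^ length vs"
proof (induction vs)
  case (Cons v vs)
  then have "tidx N vs < N ^ length vs" "Suc v \<le> N" by auto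
  then have "v * N ^ length vs + tidx N vs < Suc v * N ^ length vs" by simp
  also have "\<dots> \<le> N * N ^ length vs" using \<open>Suc v \<le> N\<close> by (rule mult_le_mono1)
  finally show ?case by simp
qed simp

section \<open>Correctness of formula tests on a fixed tape layout\<close>

locale layout =
  fixes inp :: "nat list" and ny nx :: nat
begin

text \<open>Tape 0 is the input and tape 1 a one-cell parity flag; then come \<open>ny\<close>
  copies of the word bounding the loops, \<open>nx\<close> copies of the input string, and the
  output. Head positions \<open>e\<close> are integers because heads step off the word on the
  left.\<close>

definition St :: "int \<Rightarrow> nat \<Rightarrow> nat list \<Rightarrow> nat list \<Rightarrow> (nat \<Rightarrow> int) \<Rightarrow> nat list \<Rightarrow> state" where
  "St rp fl y xs e out k =
     (if k = 0 then (contents inp, rp)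
      else if k = 1 then ((\<lambda>_. 0)(0 := fl), 0)
      else if k < 2 + ny then (contents y, e k)
      else if k < 2 + ny + nx then (contents xs, e k)
      else if k = 2 + ny + nx then (contents out, int (length out))
      else (contents [], 0))"

lemma scans_St [simp]:
  "scans (St rp fl y xs e out) 0 = contents inp rp"
  "scans (St rp fl y xs e out) (Suc 0) = fl"
  "2 \<le> k \<Longrightarrow> k < 2 + ny \<Longrightarrow> scans (St rp fl y xs e out) k = contents y (e k)"
  by (auto simp: scans_def scan_def St_def)

lemma St_move:
  assumes "2 \<le> k" "k < 2 + ny + nx"
  shows "(St rp fl y xs e out)(k := (fst (St rp fl y xs e out k), p)) = St rp fl y xs (e(k := p)) out"
  using assms by (auto simp: fun_eq_iff St_def)

lemma St_pos: "2 \<le> k \<Longrightarrow> k < 2 + ny + nx \<Longrightarrow> snd (St rp fl y xs e out k) = e k"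
  by (auto simp: St_def)

lemma St_0: "St rp fl y xs e out 0 = (contents inp, rp)"
  by (simp add: St_def)

lemma St_move_0: "(St rp fl y xs e out)(0 := (contents inp, p)) = St p fl y xs e out"
  by (auto simp: fun_eq_iff St_def)

lemma runs_left_var:
  "2 \<le> k \<Longrightarrow> k < 2 + ny + nx \<Longrightarrow> e' = e(k := e k - 1) \<Longrightarrow>
    runs (left k) (St rp fl y xs e out) 1 (St rp fl y xs e' out)"
  using runs_left[of k "St rp fl y xs e out"] by (simp add: St_move St_pos)

lemma runs_right_var:
  "2 \<le> k \<Longrightarrow> k < 2 + ny + nx \<Longrightarrow> e' = e(k := e k + 1) \<Longrightarrow>
    runs (right k) (St rp fl y xs e out) 1 (St rp fl y xs e' out)"
  using runs_right[of k "St rp fl y xs e out"] by (simp add: St_move St_pos)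

lemma runs_left_inp: "rp' = rp - 1 \<Longrightarrow> runs (left 0) (St rp fl y xs e out) 1 (St rp' fl y xs e out)"
  using runs_left[of 0 "St rp fl y xs e out"] by (simp add: St_0 St_move_0)

lemma runs_right_inp: "rp' = rp + 1 \<Longrightarrow> runs (right 0) (St rp fl y xs e out) 1 (St rp' fl y xs e out)"
  using runs_right[of 0 "St rp fl y xs e out"] by (simp add: St_0 St_move_0)

lemma runs_For_var:
  assumes "2 \<le> v" "v < 2 + ny + nx" "0 \<notin> set (if v < 2 + ny then y else xs)"
    "n = length (if v < 2 + ny then y else xs)"
    "\<And>i. i \<le> n \<Longrightarrow> e i v = 0"
    "\<And>i. i < n \<Longrightarrow> runs c (St (rp i) (fl i) y xs ((e i)(v := int i)) (out i)) B
        (St (rp (Suc i)) (fl (Suc i)) y xs ((e (Suc i))(v := int i)) (out (Suc i)))"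
  shows "runs (For v c) (St (rp 0) (fl 0) y xs (e 0) (out 0)) (n * (B + 6) + 4) (St (rp n) (fl n) y xs (e n) (out n))"
proof -
  let ?w = "if v < 2 + ny then y else xs"
  define g where "g i = St (rp i) (fl i) y xs (e i) (out i)" for i
  have g: "g i v = (contents ?w, e i v)" for i using assms(1,2) by (auto simp: g_def St_def)
  have g2: "(g i)(v := (contents ?w, p)) = St (rp i) (fl i) y xs ((e i)(v := p)) (out i)" for i p
    using St_move[OF assms(1,2), of "rp i" "fl i" y xs "e i" "out i" p] g[of i] unfolding g_def by simp
  have "runs (For v c) (g 0) (n * (B + 6) + 4) (g n)"
    by (rule runs_For[where w = ?w]) (use assms g g2 in \<open>auto simp del: fun_upd_apply\<close>)
  then show ?thesis by (simp add: g_def)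
qed

end

fun adv_time :: "nat \<Rightarrow> nat \<Rightarrow> nat" where
  "adv_time N 0 = 1"
| "adv_time N (Suc e) = N * (adv_time N e + 6) + 4"

definition adv_var_time :: "nat \<Rightarrow> nat \<Rightarrow> nat" where
  "adv_var_time N e = N * (adv_time N e + 4) + 4 * N + 6"

fun adv_vars_time :: "nat \<Rightarrow> nat list \<Rightarrow> nat" where
  "adv_vars_time N [] = 0"
| "adv_vars_time N (v # vs) = adv_var_time N (length vs) + adv_vars_time N vs"

fun test_time :: "nat \<Rightarrow> nat \<Rightarrow> fm \<Rightarrow> nat" where
  "test_time d N TT = 0"
| "test_time d N (Sym v A) = 2"
| "test_time d N (EqC v n) = 4 * Suc n"
| "test_time d N (Eq v w) = 10 * N + 6"
| "test_time d N (Sc v w) = 10 * N + 8"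
| "test_time d N (Look b vs) = b * adv_time N d + adv_vars_time N vs + 2 + (N ^ Suc d * 3 + 2)"
| "test_time d N (And \<phi> \<psi>) = test_time d N \<phi> + test_time d N \<psi>"
| "test_time d N (Not \<phi>) = test_time d N \<phi>"

text \<open>From \<open>base\<close> on, the input tape carries \<open>N\<close> coin tables of
  \<open>N ^ d\<close> entries each, where \<open>N\<close> is the length of \<open>y\<close>. A
  table is addressed by tuples of length at most \<open>d\<close>, read as numbers in base
  \<open>N\<close>.\<close>

locale reading = layout +
  fixes y xs :: "nat list" and base d :: nat
  assumes y0: "0 \<notin> set y"
    and base: "base \<ge> 1" "contents inp (int base - 1) = 3"
    and coins: "\<And>i. i < length y ^ Suc d \<Longrightarrow> contents inp (int (base + i)) \<in> {1, 2}"
    and ny: "d + 1 \<le> ny"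
begin

abbreviation "N \<equiv> length y"

definition coin :: "nat \<Rightarrow> nat list \<Rightarrow> bool" where
  "coin b vs \<longleftrightarrow> contents inp (int (base + b * N ^ d + tidx N vs)) = 2"

lemma runs_adv:
  assumes "e \<le> d" "\<And>i. i < e \<Longrightarrow> env (3 + i) = 0"
  shows "runs (adv e) (St rp fl y xs env out) (adv_time N e) (St (rp + int (N ^ e)) fl y xs env out)"
  using assms
proof (induction e arbitrary: rp env)
  case 0
  then show ?case using runs_right_inp[of "rp + 1"] by simp
next
  case (Suc e)
  have "runs (For (3 + e) (adv e)) (St (rp + int (0 * N ^ e)) fl y xs env out) (N * (adv_time N e + 6) + 4)
     (St (rp + int (N * N ^ e)) fl y xs env out)"
  proof (rule runs_For_var[where rp = "\<lambda>i. rp + int (i * N ^ e)" and e = "\<lambda>_. env" and fl = "\<lambda>_. fl" and out = "\<lambda>_. out"])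
    fix i assume "i < N"
    have "runs (adv e) (St (rp + int (i * N ^ e)) fl y xs (env(3 + e := int i)) out) (adv_time N e)
      (St (rp + int (i * N ^ e) + int (N ^ e)) fl y xs (env(3 + e := int i)) out)"
      using Suc.prems by (intro Suc.IH) auto
    then show "runs (adv e) (St (rp + int (i * N ^ e)) fl y xs (env(3 + e := int i)) out) (adv_time N e)
      (St (rp + int (Suc i * N ^ e)) fl y xs (env(3 + e := int i)) out)" by (simp add: algebra_simps)
  qed (use Suc.prems ny y0 in auto)
  then show ?case by simp
qed

lemma runs_rights:
  assumes "distinct vs" "\<forall>v\<in>set vs. 2 \<le> v \<and> v < 2 + ny + nx"
  shows "runs (seqs (map right vs)) (St rp fl y xs env out) (length vs)
    (St rp fl y xs (\<lambda>v. if v \<in> set vs then env v + 1 else env v) out)"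
  using assms
proof (induction vs arbitrary: env)
  case Nil
  then show ?case by (simp add: runs_Skip)
next
  case (Cons v vs)
  have 1: "runs (right v) (St rp fl y xs env out) 1 (St rp fl y xs (env(v := env v + 1)) out)"
    using Cons.prems by (intro runs_right_var) auto
  have "(\<lambda>w. if w \<in> set vs then (env(v := env v + 1)) w + 1 else (env(v := env v + 1)) w) =
    (\<lambda>w. if w \<in> set (v # vs) then env w + 1 else env w)"
    using Cons.prems by (auto simp: fun_eq_iff)
  then show ?case using runs_Seq[OF 1 Cons.IH[of "env(v := env v + 1)"]] Cons.prems by simp
qed

lemma runs_restore:
  assumes "distinct vs" "\<forall>v\<in>set vs. 3 \<le> v \<and> v < 2 + ny" "env 2 = int k" "k \<le> N"
  shows "runs (restore vs) (St rp fl y xs env out) (N * (length vs + 3) + 3)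
    (St rp fl y xs (\<lambda>v. if v \<in> set vs then env v + int k else if v = 2 then 0 else env v) out)"
proof -
  have two: "2 < 2 + ny" using ny by simp
  define f where "f i = St rp fl y xs (\<lambda>v. if v \<in> set vs then env v + int i else if v = 2 then int k - 1 - int i else env v) out" for i
  have 1: "runs (left 2) (St rp fl y xs env out) 1 (f 0)"
    unfolding f_def using assms two by (intro runs_left_var) (auto simp: fun_eq_iff)
  have 2: "runs (While (\<lambda>f. f 2 \<noteq> 0) (Seq (left 2) (seqs (map right vs)))) (f 0) (k * (1 + length vs + 2) + 1) (f k)"
  proof (rule runs_While)
    fix i assume "i < k"
    show "runs (Seq (left 2) (seqs (map right vs))) (f i) (1 + length vs) (f (Suc i))"
    proof (rule runs_Seq)
      let ?e = "\<lambda>v. if v \<in> set vs then env v + int i else if v = 2 then int k - 2 - int i else env v"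
      show "runs (left 2) (f i) 1 (St rp fl y xs ?e out)"
        unfolding f_def using assms two by (intro runs_left_var) (auto simp: fun_eq_iff)
      have "(\<lambda>v. if v \<in> set vs then ?e v + 1 else ?e v) = 
        (\<lambda>v. if v \<in> set vs then env v + int (Suc i) else if v = 2 then int k - 1 - int (Suc i) else env v)"
        by (auto simp: fun_eq_iff)
      then show "runs (seqs (map right vs)) (St rp fl y xs ?e out) (length vs) (f (Suc i))"
        unfolding f_def using runs_rights[of vs rp fl ?e out] assms by force
    qed
  qed (use assms two y0 in \<open>auto simp: f_def contents_eq_0\<close>)
  have 3: "runs (right 2) (f k) 1 (St rp fl y xs (\<lambda>v. if v \<in> set vs then env v + int k else if v = 2 then 0 else env v) out)"
    unfolding f_def using assms two by (intro runs_right_var) (auto simp: fun_eq_iff)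
  have "k * (1 + length vs + 2) \<le> N * (length vs + 3)" using assms(4) by (intro mult_mono) auto
  then show ?thesis unfolding restore_def
    by (intro runs_mono[OF runs_Seq[OF 1 runs_Seq[OF 2 3]]]) linarith
qed

lemma runs_adv_var:
  assumes v: "3 + d \<le> v" "v < 2 + ny" and e: "e \<le> d"
    and env: "env v = int n" "n < N" "env 2 = 0" "\<And>i. i < d \<Longrightarrow> env (3 + i) = 0"
  shows "runs (adv_var v e) (St rp fl y xs env out) (adv_var_time N e) (St (rp + int (n * N ^ e)) fl y xs env out)"
proof -
  have two: "2 < 2 + ny" using ny by simp
  define f where "f i = St (rp + int (i * N ^ e)) fl y xs (env(v := int n - 1 - int i, 2 := int i)) out" for i
  have 1: "runs (left v) (St rp fl y xs env out) 1 (f 0)"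
  proof -
    have "env(v := int n - 1 - int 0, 2 := int 0) = env(v := env v - 1)" using v env by (auto simp: fun_eq_iff)
    then show ?thesis unfolding f_def using v by (simp only: mult_0 of_nat_0 add_0_right) (intro runs_left_var, auto)
  qed
  have 2: "runs (While (\<lambda>f. f v \<noteq> 0) (Seq (adv e) (Seq (left v) (right 2)))) (f 0)
     (n * (adv_time N e + (1 + 1) + 2) + 1) (f n)"
  proof (rule runs_While)
    fix i assume "i < n"
    let ?e1 = "env(v := int n - 1 - int i, 2 := int i)"
    let ?rp = "rp + int (Suc i * N ^ e)"
    have a: "runs (adv e) (f i) (adv_time N e) (St ?rp fl y xs ?e1 out)"
    proof -
      have "rp + int (i * N ^ e) + int (N ^ e) = ?rp" by (simp add: algebra_simps)
      moreover have "?e1 (3 + j) = 0" if "j < e" for j using that v env e by auto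
      ultimately show ?thesis unfolding f_def using runs_adv[OF e, of ?e1 "rp + int (i * N ^ e)" fl out] by metis
    qed
    have b: "runs (left v) (St ?rp fl y xs ?e1 out) 1 (St ?rp fl y xs (?e1(v := int n - 1 - int (Suc i))) out)"
      using v by (intro runs_left_var) (auto simp: fun_eq_iff)
    have c: "runs (right 2) (St ?rp fl y xs (?e1(v := int n - 1 - int (Suc i))) out) 1 (f (Suc i))"
      unfolding f_def using v two by (intro runs_right_var) (auto simp: fun_eq_iff)
    show "runs (Seq (adv e) (Seq (left v) (right 2))) (f i) (adv_time N e + (1 + 1)) (f (Suc i))"
      by (rule runs_Seq[OF a runs_Seq[OF b c]])
  qed (use v env two y0 in \<open>auto simp: f_def contents_eq_0\<close>)
  let ?rp = "rp + int (n * N ^ e)"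
  have 3: "runs (right v) (f n) 1 (St ?rp fl y xs (env(v := 0, 2 := int n)) out)"
    unfolding f_def using v by (intro runs_right_var) (auto simp: fun_eq_iff)
  have "(\<lambda>w. if w \<in> set [v] then (env(v := 0, 2 := int n)) w + int n else if w = 2 then 0 else (env(v := 0, 2 := int n)) w) = env"
    using env v by (auto simp: fun_eq_iff)
  then have 4: "runs (restore [v]) (St ?rp fl y xs (env(v := 0, 2 := int n)) out) (N * 4 + 3) (St ?rp fl y xs env out)"
    using runs_restore[of "[v]" "env(v := 0, 2 := int n)" n ?rp fl out] v env by auto
  have "n * (adv_time N e + (1 + 1) + 2) \<le> N * (adv_time N e + 4)" using env by (intro mult_mono) auto
  then show ?thesis unfolding adv_var_def
    by (intro runs_mono[OF runs_Seq[OF 1 runs_Seq[OF 2 runs_Seq[OF 3 4]]]]) (simp add: adv_var_time_def)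
qed

lemma runs_adv_vars:
  assumes "\<forall>v\<in>set vs. 3 + d \<le> v \<and> v < 2 + ny \<and> e v < N" "length vs \<le> d" "e 2 = 0" "\<And>i. i < d \<Longrightarrow> e (3 + i) = 0"
  shows "runs (adv_vars vs) (St rp fl y xs (\<lambda>v. int (e v)) out) (adv_vars_time N vs)
    (St (rp + int (tidx N (map e vs))) fl y xs (\<lambda>v. int (e v)) out)"
  using assms(1,2)
proof (induction vs arbitrary: rp)
  case Nil
  then show ?case by (simp add: runs_Skip)
next
  case (Cons v vs)
  have 1: "runs (adv_var v (length vs)) (St rp fl y xs (\<lambda>v. int (e v)) out) (adv_var_time N (length vs))
    (St (rp + int (e v * N ^ length vs)) fl y xs (\<lambda>v. int (e v)) out)"
    using Cons.prems assms(3,4) by (intro runs_adv_var) auto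
  have 2: "runs (adv_vars vs) (St (rp + int (e v * N ^ length vs)) fl y xs (\<lambda>v. int (e v)) out) (adv_vars_time N vs)
    (St (rp + int (e v * N ^ length vs) + int (tidx N (map e vs))) fl y xs (\<lambda>v. int (e v)) out)"
    using Cons by auto
  show ?case using runs_Seq[OF 1 2] by (simp add: add.assoc)
qed

lemma runs_advs:
  assumes "e 2 = 0" "\<And>i. i < d \<Longrightarrow> e (3 + i) = 0"
  shows "runs (seqs (replicate b (adv d))) (St rp fl y xs (\<lambda>v. int (e v)) out) (b * adv_time N d)
    (St (rp + int (b * N ^ d)) fl y xs (\<lambda>v. int (e v)) out)"
proof (induction b arbitrary: rp)
  case 0
  then show ?case by (simp add: runs_Skip)
next
  case (Suc b)
  have 1: "runs (adv d) (St rp fl y xs (\<lambda>v. int (e v)) out) (adv_time N d) (St (rp + int (N ^ d)) fl y xs (\<lambda>v. int (e v)) out)"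
    using assms by (intro runs_adv) auto
  show ?case using runs_Seq[OF 1 Suc[of "rp + int (N ^ d)"]] by (simp add: add.assoc)
qed

lemma runs_unread:
  assumes "i < N ^ Suc d"
  shows "runs unread (St (int (base + i)) fl y xs env out) (N ^ Suc d * 3 + 2) (St (int base) fl y xs env out)"
proof -
  define f where "f j = St (int (base + i) - int j) fl y xs env out" for j
  have 1: "runs (While (\<lambda>f. f 0 \<noteq> 3) (left 0)) (f 0) (Suc i * (1 + 2) + 1) (f (Suc i))"
  proof (rule runs_While)
    fix j assume "j < Suc i"
    then have "int (base + i) - int j = int (base + (i - j))" "i - j < N ^ Suc d" using assms by auto
    then show "scans (f j) 0 \<noteq> 3" using coins[of "i - j"] by (auto simp: f_def)
    show "runs (left 0) (f j) 1 (f (Suc j))" unfolding f_def by (intro runs_left_inp) auto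
  qed (use base in \<open>auto simp: f_def algebra_simps\<close>)
  have 2: "runs (right 0) (f (Suc i)) 1 (St (int base) fl y xs env out)"
    unfolding f_def by (intro runs_right_inp) auto
  have "f 0 = St (int (base + i)) fl y xs env out" by (simp add: f_def)
  then show ?thesis unfolding unread_def
    using runs_mono[OF runs_Seq[OF 1 2], of "N ^ Suc d * 3 + 2"] assms by simp
qed

lemma runs_equals:
  assumes v: "3 \<le> v" "v < 2 + ny" "3 \<le> w" "w < 2 + ny" "v \<noteq> w"
    and env: "-1 \<le> env v" "env v < int N" "-1 \<le> env w" "env w < int N" "env 2 = 0"
    and c: "runs (if env v = env w then ct else cf) (St rp fl y xs env out) T \<sigma>'"
  shows "runs (equals v w ct cf) (St rp fl y xs env out) (10 * N + 6 + T) \<sigma>'"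
proof -
  have two: "2 < 2 + ny" using ny by simp
  \<comment> \<open>The walk stops when the smaller position reaches -1, that is, after one more
    round than its value.\<close>
  define k where "k = nat (min (env v) (env w) + 1)"
  have k: "int k = min (env v) (env w) + 1" "k \<le> N" using env by (auto simp: k_def)
  define f where "f i = St rp fl y xs (env(v := env v - int i, w := env w - int i, 2 := int i)) out" for i
  have 0: "f 0 = St rp fl y xs env out" 
  proof -
    have "env(v := env v - int 0, w := env w - int 0, 2 := int 0) = env" using env by (auto simp: fun_eq_iff)
    then show ?thesis unfolding f_def by (simp only:)
  qed
  have 1: "runs (While (\<lambda>f. f v \<noteq> 0 \<and> f w \<noteq> 0) (Seq (left v) (Seq (left w) (right 2)))) (f 0) (k * ((1 + (1 + 1)) + 2) + 1) (f k)"
  proof (rule runs_While)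
    fix i assume "i < k"
    let ?e = "env(v := env v - int i, w := env w - int i, 2 := int i)"
    have a: "runs (left v) (f i) 1 (St rp fl y xs (?e(v := env v - int (Suc i))) out)"
      unfolding f_def using v by (intro runs_left_var) (auto simp: fun_eq_iff)
    have b: "runs (left w) (St rp fl y xs (?e(v := env v - int (Suc i))) out) 1
        (St rp fl y xs (?e(v := env v - int (Suc i), w := env w - int (Suc i))) out)"
      using v by (intro runs_left_var) (auto simp: fun_eq_iff)
    have c: "runs (right 2) (St rp fl y xs (?e(v := env v - int (Suc i), w := env w - int (Suc i))) out) 1 (f (Suc i))"
      unfolding f_def using v two by (intro runs_right_var) (auto simp: fun_eq_iff)
    show "runs (Seq (left v) (Seq (left w) (right 2))) (f i) (1 + (1 + 1)) (f (Suc i))"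
      by (rule runs_Seq[OF a runs_Seq[OF b c]])
  qed (use v env two y0 k in \<open>auto simp: f_def contents_eq_0 min_def split: if_splits\<close>)
  have r: "runs (restore [v, w]) (f k) (N * 5 + 3) (St rp fl y xs env out)"
  proof -
    let ?e = "env(v := env v - int k, w := env w - int k, 2 := int k)"
    have "(\<lambda>u. if u \<in> set [v, w] then ?e u + int k else if u = 2 then 0 else ?e u) = env"
      using env v by (auto simp: fun_eq_iff)
    then show ?thesis unfolding f_def
      using runs_restore[of "[v, w]" ?e k rp fl out] v k by auto
  qed
  have cond: "(scans (f k) v = 0 \<and> scans (f k) w = 0) = (env v = env w)"
    using v env two y0 k by (auto simp: f_def contents_eq_0 min_def split: if_splits)
  have "runs (if scans (f k) v = 0 \<and> scans (f k) w = 0 then Seq (restore [v, w]) ct else Seq (restore [v, w]) cf) (f k) (N * 5 + 3 + T) \<sigma>'"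
    unfolding cond using c by (auto intro: runs_Seq[OF r])
  then have 2: "runs (Cond (\<lambda>f. f v = 0 \<and> f w = 0) (Seq (restore [v, w]) ct) (Seq (restore [v, w]) cf)) (f k) (N * 5 + 3 + T + 2) \<sigma>'"
    by (rule runs_Cond)
  have "k * 5 \<le> N * 5" using k by simp
  then show ?thesis unfolding equals_def 0[symmetric]
    by (intro runs_mono[OF runs_Seq[OF 1 2]]) simp
qed

lemma runs_equals_const:
  assumes v: "2 \<le> v" "v < 2 + ny" and env: "0 \<le> env v" "env v < int N"
    and c: "runs (if env v = int n then ct else cf) (St rp fl y xs env out) T \<sigma>'"
  shows "runs (equals_const v n ct cf) (St rp fl y xs env out) (4 * Suc n + T) \<sigma>'"
  using env c
proof (induction n arbitrary: ct cf env T)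
  case 0
  let ?e = "env(v := env v - 1)"
  have 1: "runs (left v) (St rp fl y xs env out) 1 (St rp fl y xs ?e out)"
    using v by (intro runs_left_var) auto
  have 2: "runs (right v) (St rp fl y xs ?e out) 1 (St rp fl y xs env out)"
    using v by (intro runs_right_var) (auto simp: fun_eq_iff)
  have cond: "(scans (St rp fl y xs ?e out) v = 0) = (env v = 0)"
    using v 0 y0 by (auto simp: contents_eq_0)
  have "runs (if scans (St rp fl y xs ?e out) v = 0 then Seq (right v) ct else Seq (right v) cf) (St rp fl y xs ?e out) (1 + T) \<sigma>'"
    unfolding cond using 0 runs_Seq[OF 2, of ct T \<sigma>'] runs_Seq[OF 2, of cf T \<sigma>'] by (cases "env v = 0") auto
  from runs_Seq[OF 1 runs_Cond[of "\<lambda>f. f v = 0", OF this]] show ?case by (simp add: runs_mono)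
next
  case (Suc n)
  let ?e = "env(v := env v - 1)"
  have 1: "runs (left v) (St rp fl y xs env out) 1 (St rp fl y xs ?e out)"
    using v by (intro runs_left_var) auto
  have 2: "runs (right v) (St rp fl y xs ?e out) 1 (St rp fl y xs env out)"
    using v by (intro runs_right_var) (auto simp: fun_eq_iff)
  have cond: "(scans (St rp fl y xs ?e out) v = 0) = (env v = 0)"
    using v Suc.prems y0 by (auto simp: contents_eq_0)
  have "runs (if scans (St rp fl y xs ?e out) v = 0 then Seq (right v) cf
     else equals_const v n (Seq (right v) ct) (Seq (right v) cf)) (St rp fl y xs ?e out) (4 * Suc n + (1 + T)) \<sigma>'"
  proof (cases "env v = 0")
    case True
    then show ?thesis unfolding cond using Suc.prems runs_mono[OF runs_Seq[OF 2, of cf T \<sigma>'], of "4 * Suc n + (1 + T)"]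
      by auto
  next
    case False
    have "runs (if ?e v = int n then Seq (right v) ct else Seq (right v) cf) (St rp fl y xs ?e out) (1 + T) \<sigma>'"
      using Suc.prems(3) runs_Seq[OF 2, of ct T \<sigma>'] runs_Seq[OF 2, of cf T \<sigma>']
      by (cases "env v = 1 + int n") auto
    moreover have "0 \<le> ?e v" "?e v < int N" using False Suc.prems by auto
    ultimately have "runs (equals_const v n (Seq (right v) ct) (Seq (right v) cf)) (St rp fl y xs ?e out) (4 * Suc n + (1 + T)) \<sigma>'"
      by (intro Suc.IH)
    then show ?thesis unfolding cond using False by simp
  qed
  from runs_Seq[OF 1 runs_Cond[of "\<lambda>f. f v = 0", OF this]] show ?case by (simp add: runs_mono)
qed

lemma runs_test:
  assumes "wf_fm d ny N \<phi>" and e: "\<And>v. 3 + d \<le> v \<Longrightarrow> v < 2 + ny \<Longrightarrow> e v < N" "e 2 = 0" "\<And>i. i < d \<Longrightarrow> e (3 + i) = 0"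
    and "runs (if eval y coin e \<phi> then ct else cf) (St (int base) fl y xs (\<lambda>v. int (e v)) out) T \<sigma>'"
  shows "runs (test d \<phi> ct cf) (St (int base) fl y xs (\<lambda>v. int (e v)) out) (test_time d N \<phi> + T) \<sigma>'"
  using assms(1,5)
proof (induction \<phi> arbitrary: ct cf T)
  case TT
  then show ?case by simp
next
  case (Sym v A)
  then have "scans (St (int base) fl y xs (\<lambda>v. int (e v)) out) v = y ! e v"
    using e(1)[of v] by (simp add: contents_def)
  then show ?case using Sym runs_Cond[of "\<lambda>f. A (f v)"] by (simp add: add.commute)
next
  case (EqC v n)
  then show ?case using e(1)[of v] by (auto intro!: runs_equals_const[where n = n, simplified])
next
  case (Eq v w)
  then show ?case using e(1)[of v] e(1)[of w] e(2) by (auto intro!: runs_equals)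
next
  case (Sc v w)
  let ?e = "\<lambda>v. int (e v)"
  let ?e' = "?e(w := ?e w - 1)"
  have 1: "runs (left w) (St (int base) fl y xs ?e out) 1 (St (int base) fl y xs ?e' out)"
    using Sc by (intro runs_left_var) auto
  have 2: "runs (right w) (St (int base) fl y xs ?e' out) 1 (St (int base) fl y xs ?e out)"
    using Sc by (intro runs_right_var) (auto simp: fun_eq_iff)
  have "runs (if ?e' v = ?e' w then Seq (right w) ct else Seq (right w) cf) (St (int base) fl y xs ?e' out) (1 + T) \<sigma>'"
    using Sc runs_Seq[OF 2, of ct T \<sigma>'] runs_Seq[OF 2, of cf T \<sigma>'] by (cases "e w = Suc (e v)") auto
  then have 3: "runs (equals v w (Seq (right w) ct) (Seq (right w) cf)) (St (int base) fl y xs ?e' out) (10 * N + 6 + (1 + T)) \<sigma>'"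
    using Sc e(1)[of v] e(1)[of w] e(2) by (intro runs_equals) auto
  show ?case using runs_mono[OF runs_Seq[OF 1 3]] by simp
next
  case (Look b vs)
  let ?e = "\<lambda>v. int (e v)"
  let ?rp = "int base + int (b * N ^ d)"
  let ?i = "b * N ^ d + tidx N (map e vs)"
  have 1: "runs (seqs (replicate b (adv d))) (St (int base) fl y xs ?e out) (b * adv_time N d) (St ?rp fl y xs ?e out)"
    using e by (intro runs_advs) auto
  have 2: "runs (adv_vars vs) (St ?rp fl y xs ?e out) (adv_vars_time N vs) (St (?rp + int (tidx N (map e vs))) fl y xs ?e out)"
    using e Look by (intro runs_adv_vars) auto
  have rp: "?rp + int (tidx N (map e vs)) = int (base + ?i)" by simp
  have "tidx N (map e vs) < N ^ length vs" using tidx_less[of "map e vs" N] Look e by auto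
  also have "\<dots> \<le> N ^ d" using Look by (intro power_increasing) auto
  finally have "?i < Suc b * N ^ d" by simp
  also have "\<dots> \<le> N * N ^ d" using Look by (intro mult_le_mono1) auto
  finally have i: "?i < N ^ Suc d" by simp
  have 3: "runs unread (St (int (base + ?i)) fl y xs ?e out) (N ^ Suc d * 3 + 2) (St (int base) fl y xs ?e out)"
    by (rule runs_unread[OF i])
  have "(scans (St (int (base + ?i)) fl y xs ?e out) 0 = 2) = eval y coin e (Look b vs)"
    by (simp add: coin_def add.assoc)
  then have "runs (if scans (St (int (base + ?i)) fl y xs ?e out) 0 = 2 then Seq unread ct else Seq unread cf)
    (St (int (base + ?i)) fl y xs ?e out) (N ^ Suc d * 3 + 2 + T) \<sigma>'"
    using Look.prems(2) runs_Seq[OF 3, of ct T \<sigma>'] runs_Seq[OF 3, of cf T \<sigma>'] by (auto split: if_splits)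
  then have 4: "runs (Cond (\<lambda>f. f 0 = 2) (Seq unread ct) (Seq unread cf)) (St (int (base + ?i)) fl y xs ?e out) (N ^ Suc d * 3 + 2 + T + 2) \<sigma>'"
    by (rule runs_Cond)
  show ?case
    using runs_mono[OF runs_Seq[OF 1 runs_Seq[OF 2[unfolded rp] 4]]] by (simp add: algebra_simps)
next
  case (And \<phi> \<psi>)
  have "runs (if eval y coin e \<phi> then test d \<psi> ct cf else cf) (St (int base) fl y xs (\<lambda>v. int (e v)) out) (test_time d N \<psi> + T) \<sigma>'"
  proof (cases "eval y coin e \<phi>")
    case True
    then show ?thesis using And by auto
  next
    case False
    then show ?thesis using And by (auto intro: runs_mono)
  qed
  then show ?case using And.IH(1)[of "test d \<psi> ct cf" cf] And.prems by (simp add: add.assoc)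
next
  case (Not \<phi>)
  then have "runs (if eval y coin e \<phi> then cf else ct) (St (int base) fl y xs (\<lambda>v. int (e v)) out) T \<sigma>'"
    by (auto split: if_splits)
  then show ?case using Not by simp
qed

end

section \<open>Parities of numbers of satisfying assignments\<close>

definition flip :: com where
  "flip = Op 1 (\<lambda>f. if f 1 = 0 then 1 else 0) N_move"

text \<open>An item \<open>(vs, \<phi>)\<close> stands for the number of assignments to
  \<open>vs\<close> that satisfy \<open>\<phi>\<close>, of which only the parity is kept: the flag
  is flipped once per satisfying assignment.\<close>

definition item :: "nat \<Rightarrow> nat list \<times> fm \<Rightarrow> com" where
  "item d a = nest (fst a) (test d (snd a) flip Skip)"

fun nest_time :: "nat \<Rightarrow> nat list \<Rightarrow> nat \<Rightarrow> nat" where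
  "nest_time N [] T = T"
| "nest_time N (v # vs) T = N * (nest_time N vs T + 6) + 4"

definition item_time :: "nat \<Rightarrow> nat \<Rightarrow> nat list \<times> fm \<Rightarrow> nat" where
  "item_time d N a = nest_time N (fst a) (test_time d N (snd a) + 1)"

definition write_out :: "nat \<Rightarrow> nat \<Rightarrow> com" where
  "write_out k a = Op k (\<lambda>_. a) R_move"

definition emit_bit :: "nat \<Rightarrow> nat \<Rightarrow> (nat list \<times> fm) list \<Rightarrow> com" where
  "emit_bit d k as = Seq (seqs (map (item d) as))
     (Seq (Cond (\<lambda>f. f 1 = 0) (write_out k 1) (write_out k 2)) (Op 1 (\<lambda>_. 0) N_move))"

definition emit_bit_time :: "nat \<Rightarrow> nat \<Rightarrow> (nat list \<times> fm) list \<Rightarrow> nat" where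
  "emit_bit_time d N as = sum_list (map (item_time d N) as) + 4"

definition emit_word :: "nat \<Rightarrow> nat \<Rightarrow> nat list \<Rightarrow> (nat list \<times> fm) list \<Rightarrow> com" where
  "emit_word d k cs as = Seq (nest cs (emit_bit d k as)) (write_out k 3)"

fun count_nest :: "nat \<Rightarrow> nat list \<Rightarrow> ((nat \<Rightarrow> nat) \<Rightarrow> nat) \<Rightarrow> (nat \<Rightarrow> nat) \<Rightarrow> nat" where
  "count_nest N [] h e = h e"
| "count_nest N (v # vs) h e = (\<Sum>i<N. count_nest N vs h (e(v := i)))"

fun list_nest :: "nat \<Rightarrow> nat list \<Rightarrow> ((nat \<Rightarrow> nat) \<Rightarrow> 'a list) \<Rightarrow> (nat \<Rightarrow> nat) \<Rightarrow> 'a list" where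
  "list_nest N [] h e = h e"
| "list_nest N (v # vs) h e = concat (map (\<lambda>i. list_nest N vs h (e(v := i))) [0..<N])"

context reading
begin

definition good :: "(nat \<Rightarrow> nat) \<Rightarrow> bool" where
  "good e \<longleftrightarrow> (\<forall>v. 3 + d \<le> v \<longrightarrow> v < 2 + ny \<longrightarrow> e v < N) \<and> e 2 = 0 \<and> (\<forall>i<d. e (3 + i) = 0)"

definition item_value :: "(nat \<Rightarrow> nat) \<Rightarrow> nat list \<times> fm \<Rightarrow> nat" where
  "item_value e a = count_nest N (fst a) (\<lambda>e. of_bool (eval y coin e (snd a))) e"

definition bit_value :: "(nat list \<times> fm) list \<Rightarrow> (nat \<Rightarrow> nat) \<Rightarrow> nat" where
  "bit_value as e = (if odd (sum_list (map (item_value e) as)) then 2 else 1)"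

lemma int_upd: "(\<lambda>v. int (e v))(v := int i) = (\<lambda>w. int ((e(v := i)) w))"
  by (auto simp: fun_eq_iff)

lemma runs_flip:
  "runs flip (St rp (K mod 2) y xs e out) 1 (St rp (Suc K mod 2) y xs e out)"
proof -
  have "St rp (Suc K mod 2) y xs e out = (St rp (K mod 2) y xs e out)
    (1 := act (if scans (St rp (K mod 2) y xs e out) 1 = 0 then 1 else 0, N_move) (St rp (K mod 2) y xs e out 1))"
    by (rule ext) (auto simp: St_def act_def mod_Suc)
  then show ?thesis unfolding flip_def by (intro runs_Op) auto
qed

lemma runs_nest_flag:
  assumes body: "\<And>e K. good e \<Longrightarrow> runs c (St (int base) (K mod 2) y xs (\<lambda>v. int (e v)) out) T
      (St (int base) ((K + h e) mod 2) y xs (\<lambda>v. int (e v)) out)"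
    and "\<forall>v\<in>set vs. 3 + d \<le> v \<and> v < 2 + ny" "good e" "\<forall>v\<in>set vs. e v = 0" "distinct vs"
  shows "runs (nest vs c) (St (int base) (K mod 2) y xs (\<lambda>v. int (e v)) out) (nest_time N vs T)
    (St (int base) ((K + count_nest N vs h e) mod 2) y xs (\<lambda>v. int (e v)) out)"
  using assms(2-)
proof (induction vs arbitrary: e K)
  case Nil
  then show ?case using body by simp
next
  case (Cons v vs)
  let ?fl = "\<lambda>i. (K + (\<Sum>j<i. count_nest N vs h (e(v := j)))) mod 2"
  have "runs (For v (nest vs c)) (St (int base) (?fl 0) y xs (\<lambda>v. int (e v)) out) (N * (nest_time N vs T + 6) + 4)
    (St (int base) (?fl N) y xs (\<lambda>v. int (e v)) out)"
  proof (rule runs_For_var[where rp = "\<lambda>_. int base" and fl = ?fl and out = "\<lambda>_. out" and e = "\<lambda>_ v. int (e v)"])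
    fix i assume i: "i < N"
    have "runs (nest vs c) (St (int base) (?fl i) y xs (\<lambda>w. int ((e(v := i)) w)) out) (nest_time N vs T)
      (St (int base) ((K + (\<Sum>j<i. count_nest N vs h (e(v := j))) + count_nest N vs h (e(v := i))) mod 2) y xs (\<lambda>w. int ((e(v := i)) w)) out)"
      using Cons.prems i by (intro Cons.IH) (auto simp: good_def)
    then show "runs (nest vs c) (St (int base) (?fl i) y xs ((\<lambda>v. int (e v))(v := int i)) out) (nest_time N vs T)
      (St (int base) (?fl (Suc i)) y xs ((\<lambda>v. int (e v))(v := int i)) out)"
      by (simp only: int_upd) (simp add: add.assoc)
  qed (use Cons.prems y0 in auto)
  then show ?case by simp
qed

definition wf_item :: "nat list \<times> fm \<Rightarrow> bool" where
  "wf_item a \<longleftrightarrow> (\<forall>v\<in>set (fst a). 3 + d \<le> v \<and> v < 2 + ny) \<and> distinct (fst a) \<and> wf_fm d ny N (snd a)"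

lemma runs_item:
  assumes "wf_item a" "good e" "\<forall>v\<in>set (fst a). e v = 0"
  shows "runs (item d a) (St (int base) (K mod 2) y xs (\<lambda>v. int (e v)) out) (item_time d N a)
    (St (int base) ((K + item_value e a) mod 2) y xs (\<lambda>v. int (e v)) out)"
  unfolding item_def item_time_def item_value_def
proof (rule runs_nest_flag)
  fix e K assume g: "good e"
  let ?b = "eval y coin e (snd a)"
  have "runs (if ?b then flip else Skip) (St (int base) (K mod 2) y xs (\<lambda>v. int (e v)) out) 1
     (St (int base) ((K + of_bool ?b) mod 2) y xs (\<lambda>v. int (e v)) out)"
    using runs_flip by (auto intro: runs_Skip)
  then show "runs (test d (snd a) flip Skip) (St (int base) (K mod 2) y xs (\<lambda>v. int (e v)) out) (test_time d N (snd a) + 1)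
     (St (int base) ((K + of_bool ?b) mod 2) y xs (\<lambda>v. int (e v)) out)"
    using assms g unfolding wf_item_def good_def by (intro runs_test) auto
qed (use assms in \<open>auto simp: wf_item_def\<close>)

lemma runs_items:
  assumes "\<forall>a\<in>set as. wf_item a \<and> (\<forall>v\<in>set (fst a). e v = 0)" "good e"
  shows "runs (seqs (map (item d) as)) (St (int base) (K mod 2) y xs (\<lambda>v. int (e v)) out) (sum_list (map (item_time d N) as))
    (St (int base) ((K + sum_list (map (item_value e) as)) mod 2) y xs (\<lambda>v. int (e v)) out)"
  using assms
proof (induction as arbitrary: K)
  case Nil
  then show ?case by (simp add: runs_Skip)
next
  case (Cons a as)
  have 1: "runs (item d a) (St (int base) (K mod 2) y xs (\<lambda>v. int (e v)) out) (item_time d N a)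
    (St (int base) ((K + item_value e a) mod 2) y xs (\<lambda>v. int (e v)) out)"
    using Cons.prems by (intro runs_item) auto
  show ?case using runs_Seq[OF 1 Cons.IH[of "K + item_value e a"]] Cons.prems by (simp add: add.assoc)
qed

lemma runs_write_out:
  "runs (write_out (2 + ny + nx) a) (St rp fl y xs e out) 1 (St rp fl y xs e (out @ [a]))"
proof -
  have "St rp fl y xs e (out @ [a]) = (St rp fl y xs e out)
    (2 + ny + nx := act (a, R_move) (St rp fl y xs e out (2 + ny + nx)))"
    by (rule ext) (auto simp: St_def act_def contents_snoc)
  then show ?thesis unfolding write_out_def by (intro runs_Op) auto
qed

lemma runs_emit_bit:
  assumes "\<forall>a\<in>set as. wf_item a \<and> (\<forall>v\<in>set (fst a). e v = 0)" "good e"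
  shows "runs (emit_bit d (2 + ny + nx) as) (St (int base) 0 y xs (\<lambda>v. int (e v)) out) (emit_bit_time d N as)
    (St (int base) 0 y xs (\<lambda>v. int (e v)) (out @ [bit_value as e]))"
proof -
  let ?S = "\<lambda>fl out. St (int base) fl y xs (\<lambda>v. int (e v)) out"
  let ?K = "sum_list (map (item_value e) as)"
  have 1: "runs (seqs (map (item d) as)) (?S 0 out) (sum_list (map (item_time d N) as)) (?S (?K mod 2) out)"
    using runs_items[OF assms, of 0] by simp
  have "runs (if scans (?S (?K mod 2) out) 1 = 0 then write_out (2 + ny + nx) 1 else write_out (2 + ny + nx) 2)
     (?S (?K mod 2) out) 1 (?S (?K mod 2) (out @ [bit_value as e]))"
    using runs_write_out by (auto simp: bit_value_def odd_iff_mod_2_eq_one)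
  then have 2: "runs (Cond (\<lambda>f. f 1 = 0) (write_out (2 + ny + nx) 1) (write_out (2 + ny + nx) 2))
     (?S (?K mod 2) out) (1 + 2) (?S (?K mod 2) (out @ [bit_value as e]))"
    by (rule runs_Cond)
  have "?S 0 (out @ [bit_value as e]) = (?S (?K mod 2) (out @ [bit_value as e]))
     (1 := act (0, N_move) (?S (?K mod 2) (out @ [bit_value as e]) 1))"
    by (rule ext) (auto simp: St_def act_def)
  then have 3: "runs (Op 1 (\<lambda>_. 0) N_move) (?S (?K mod 2) (out @ [bit_value as e])) 1 (?S 0 (out @ [bit_value as e]))"
    by (intro runs_Op) auto
  show ?thesis unfolding emit_bit_def emit_bit_time_def
    by (rule runs_mono[OF runs_Seq[OF 1 runs_Seq[OF 2 3]]]) auto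
qed

lemma runs_nest_out:
  assumes body: "\<And>e out. good e \<Longrightarrow> P e \<Longrightarrow> runs c (St (int base) 0 y xs (\<lambda>v. int (e v)) out) T
      (St (int base) 0 y xs (\<lambda>v. int (e v)) (out @ h e))"
    and P: "\<And>e v i. P e \<Longrightarrow> v \<in> set vs \<Longrightarrow> P (e(v := i))"
    and "\<forall>v\<in>set vs. 3 + d \<le> v \<and> v < 2 + ny" "good e" "P e" "\<forall>v\<in>set vs. e v = 0" "distinct vs"
  shows "runs (nest vs c) (St (int base) 0 y xs (\<lambda>v. int (e v)) out) (nest_time N vs T)
    (St (int base) 0 y xs (\<lambda>v. int (e v)) (out @ list_nest N vs h e))"
  using P assms(3-)
proof (induction vs arbitrary: e out)
  case Nil
  then show ?case using body by simp
next
  case (Cons v vs)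
  let ?out = "\<lambda>i. out @ concat (map (\<lambda>i. list_nest N vs h (e(v := i))) [0..<i])"
  have "runs (For v (nest vs c)) (St (int base) 0 y xs (\<lambda>v. int (e v)) (?out 0)) (N * (nest_time N vs T + 6) + 4)
    (St (int base) 0 y xs (\<lambda>v. int (e v)) (?out N))"
  proof (rule runs_For_var[where rp = "\<lambda>_. int base" and fl = "\<lambda>_. 0" and out = ?out and e = "\<lambda>_ v. int (e v)"])
    fix i assume i: "i < N"
    have "runs (nest vs c) (St (int base) 0 y xs (\<lambda>w. int ((e(v := i)) w)) (?out i)) (nest_time N vs T)
      (St (int base) 0 y xs (\<lambda>w. int ((e(v := i)) w)) (?out i @ list_nest N vs h (e(v := i))))"
      using Cons.prems i by (intro Cons.IH) (auto simp: good_def)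
    then show "runs (nest vs c) (St (int base) 0 y xs ((\<lambda>v. int (e v))(v := int i)) (?out i)) (nest_time N vs T)
      (St (int base) 0 y xs ((\<lambda>v. int (e v))(v := int i)) (?out (Suc i)))"
      by (simp only: int_upd) simp
  qed (use Cons.prems y0 in auto)
  then show ?case by simp
qed

lemma runs_emit_word:
  assumes as: "\<forall>a\<in>set as. wf_item a \<and> set (fst a) \<inter> set cs = {}"
    and "\<forall>v\<in>set cs. 3 + d \<le> v \<and> v < 2 + ny" "distinct cs" "y \<noteq> []"
  shows "runs (emit_word d (2 + ny + nx) cs as) (St (int base) 0 y xs (\<lambda>_. 0) out) (nest_time N cs (emit_bit_time d N as) + 1)
    (St (int base) 0 y xs (\<lambda>_. 0) (out @ list_nest N cs (\<lambda>e. [bit_value as e]) (\<lambda>_. 0) @ [3]))"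
proof -
  have 1: "runs (nest cs (emit_bit d (2 + ny + nx) as)) (St (int base) 0 y xs (\<lambda>v. int ((\<lambda>_. 0) v)) out) (nest_time N cs (emit_bit_time d N as))
    (St (int base) 0 y xs (\<lambda>v. int ((\<lambda>_. 0) v)) (out @ list_nest N cs (\<lambda>e. [bit_value as e]) (\<lambda>_. 0)))"
  \<comment> \<open>The loops inside the items need their heads at 0 at the start. The invariant
    says that the outer loops move no head outside \<open>cs\<close>.\<close>
  proof (rule runs_nest_out[where P = "\<lambda>e. \<forall>v. v \<notin> set cs \<longrightarrow> e v = 0"])
    fix e :: "nat \<Rightarrow> nat" and out assume "good e" "\<forall>v. v \<notin> set cs \<longrightarrow> e v = 0"
    then show "runs (emit_bit d (2 + ny + nx) as) (St (int base) 0 y xs (\<lambda>v. int (e v)) out) (emit_bit_time d N as)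
      (St (int base) 0 y xs (\<lambda>v. int (e v)) (out @ [bit_value as e]))"
      using as by (intro runs_emit_bit) auto
  qed (use assms in \<open>auto simp: good_def\<close>)
  show ?thesis unfolding emit_word_def
    using runs_Seq[OF 1 runs_write_out] by simp
qed

end

section \<open>Computing the questions\<close>

definition write_all :: "nat list \<Rightarrow> ((nat \<Rightarrow> nat) \<Rightarrow> nat) \<Rightarrow> com" where
  "write_all ks g = seqs (map (\<lambda>k. Op k g R_move) ks)"

lemma runs_write_all:
  assumes "distinct ks" "\<And>\<tau>. (\<And>i. i \<notin> set ks \<Longrightarrow> \<tau> i = \<sigma> i) \<Longrightarrow> g (scans \<tau>) = a"
  shows "runs (write_all ks g) \<sigma> (length ks) (\<lambda>k. if k \<in> set ks then act (a, R_move) (\<sigma> k) else \<sigma> k)"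
  using assms
proof (induction ks arbitrary: \<sigma>)
  case Nil
  then show ?case by (simp add: write_all_def runs_Skip)
next
  case (Cons k ks)
  let ?\<sigma> = "\<sigma>(k := act (a, R_move) (\<sigma> k))"
  have 1: "runs (Op k g R_move) \<sigma> 1 ?\<sigma>"
    using Cons.prems(2)[of \<sigma>] by (intro runs_Op) auto
  have 2: "runs (write_all ks g) ?\<sigma> (length ks) (\<lambda>i. if i \<in> set ks then act (a, R_move) (?\<sigma> i) else ?\<sigma> i)"
  proof (rule Cons.IH)
    show "g (scans \<tau>) = a" if "\<And>i. i \<notin> set ks \<Longrightarrow> \<tau> i = ?\<sigma> i" for \<tau>
      using that by (intro Cons.prems(2)) auto
  qed (use Cons.prems in auto)
  have "(\<lambda>i. if i \<in> set ks then act (a, R_move) (?\<sigma> i) else ?\<sigma> i) =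
    (\<lambda>i. if i \<in> set (k # ks) then act (a, R_move) (\<sigma> i) else \<sigma> i)"
    using Cons.prems by (auto simp: fun_eq_iff)
  then show ?case using runs_Seq[OF 1 2] by (simp add: write_all_def)
qed

lemma wf_write_all [simp]:
  "wf_com K S (write_all ks g) \<longleftrightarrow> (\<forall>k\<in>set ks. k < K \<and> (\<forall>f. (\<forall>i. f i < S) \<longrightarrow> g f < S))"
  by (auto simp: write_all_def)

lemma runs_rewinds:
  assumes "distinct ks" "\<And>k. k \<in> set ks \<Longrightarrow> \<sigma> k = (contents w, int (length w))" "0 \<notin> set w"
  shows "runs (seqs (map rewind ks)) \<sigma> (length ks * (length w * 3 + 3)) (\<lambda>k. if k \<in> set ks then (contents w, 0) else \<sigma> k)"
  using assms(1,2)
proof (induction ks arbitrary: \<sigma>)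
  case Nil
  then show ?case by (simp add: runs_Skip)
next
  case (Cons k ks)
  let ?\<sigma> = "\<sigma>(k := (contents w, 0))"
  have 1: "runs (rewind k) \<sigma> (length w * 3 + 3) ?\<sigma>"
    using Cons.prems assms(3) by (intro runs_rewind) auto
  have 2: "runs (seqs (map rewind ks)) ?\<sigma> (length ks * (length w * 3 + 3)) (\<lambda>k. if k \<in> set ks then (contents w, 0) else ?\<sigma> k)"
    using Cons.prems by (intro Cons.IH) auto
  have "(\<lambda>i. if i \<in> set ks then (contents w, 0) else ?\<sigma> i) = (\<lambda>i. if i \<in> set (k # ks) then (contents w, 0) else \<sigma> i)"
    using Cons.prems by (auto simp: fun_eq_iff)
  then show ?case using runs_Seq[OF 1 2] by simp
qed

text \<open>Horner's scheme as nested loops: \<open>c\<close> is executed as often as the polynomial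
  with coefficients \<open>as\<close> says at the input length. Each level needs a copy of the input
  string of its own as counter.\<close>

fun emit :: "nat \<Rightarrow> nat list \<Rightarrow> com \<Rightarrow> com" where
  "emit X [] c = Skip"
| "emit X (a # as) c = Seq (seqs (replicate a c)) (For X (emit (Suc X) as c))"

fun horner :: "nat list \<Rightarrow> nat \<Rightarrow> nat" where
  "horner [] n = 0"
| "horner (a # as) n = a + n * horner as n"

fun emit_time :: "nat \<Rightarrow> nat list \<Rightarrow> nat \<Rightarrow> nat" where
  "emit_time n [] T = 0"
| "emit_time n (a # as) T = a * T + (n * (emit_time n as T + 6) + 4)"

lemma wf_emit: "wf_com K S c \<Longrightarrow> X + length as \<le> K \<Longrightarrow> wf_com K S (emit X as c)"
  by (induction as arbitrary: X) auto

text \<open>The length of this word is the bound N of all loops. The blocks of 4 and 5 write two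
  polynomials of the input length in unary; in the tableau they mark the witness columns and the
  padding that makes room for time and space.\<close>

definition word_y :: "nat list \<Rightarrow> nat list \<Rightarrow> nat list \<Rightarrow> nat list" where
  "word_y as bs w = w @ [3] @ replicate (horner as (length w)) 4 @ replicate (horner bs (length w)) 5 @ [6]"

definition phase1 :: "nat \<Rightarrow> nat \<Rightarrow> nat list \<Rightarrow> nat list \<Rightarrow> com" where
  "phase1 ny nx as bs =
     (let app = (\<lambda>a. write_all [2..<2 + ny] (\<lambda>_. a)) in
     Seq (While (\<lambda>f. f 0 \<noteq> 3) (Seq (write_all [2..<2 + ny + nx] (\<lambda>f. f 0)) (right 0)))
     (Seq (right 0)
     (Seq (seqs (map rewind [2 + ny..<2 + ny + nx]))
     (Seq (app 3)
     (Seq (emit (2 + ny) as (app 4))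
     (Seq (emit (2 + ny) bs (app 5))
     (Seq (app 6)
     (seqs (map rewind [2..<2 + ny])))))))))"

definition phase1_time :: "nat \<Rightarrow> nat \<Rightarrow> nat list \<Rightarrow> nat list \<Rightarrow> nat \<Rightarrow> nat \<Rightarrow> nat" where
  "phase1_time ny nx as bs n N =
     (n * (ny + nx + 3) + 1) + (1 + (nx * (n * 3 + 3) + (ny + (emit_time n as ny + (emit_time n bs ny + (ny + ny * (N * 3 + 3)))))))"

context layout
begin

definition Ey :: "nat \<Rightarrow> (nat \<Rightarrow> int) \<Rightarrow> nat \<Rightarrow> int" where
  "Ey l q k = (if k < 2 + ny then int l else q k)"

lemma runs_app:
  "runs (write_all [2..<2 + ny] (\<lambda>_. a)) (St rp fl ys xs (Ey (length ys) q) out) ny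
     (St rp fl (ys @ [a]) xs (Ey (length (ys @ [a])) q) out)"
proof -
  have "(\<lambda>k. if k \<in> set [2..<2 + ny] then act (a, R_move) (St rp fl ys xs (Ey (length ys) q) out k) else St rp fl ys xs (Ey (length ys) q) out k)
    = St rp fl (ys @ [a]) xs (Ey (length (ys @ [a])) q) out"
    by (rule ext) (auto simp: St_def Ey_def act_def contents_snoc)
  then show ?thesis
    using runs_write_all[of "[2..<2 + ny]" "St rp fl ys xs (Ey (length ys) q) out" "\<lambda>_. a" a] by (simp del: upt_Suc)
qed

lemma runs_emit:
  assumes body: "\<And>ys q. runs c (St rp fl ys xs (Ey (length ys) q) out) T (St rp fl (ys @ [a]) xs (Ey (length (ys @ [a])) q) out)"
    and xs: "0 \<notin> set xs"
    and "2 + ny \<le> X" "X + length as \<le> 2 + ny + nx" "\<And>k. X \<le> k \<Longrightarrow> q k = 0"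
  shows "runs (emit X as c) (St rp fl ys xs (Ey (length ys) q) out) (emit_time (length xs) as T)
     (St rp fl (ys @ replicate (horner as (length xs)) a) xs (Ey (length (ys @ replicate (horner as (length xs)) a)) q) out)"
  using assms(3-)
proof (induction as arbitrary: X q ys)
  case Nil
  then show ?case by (simp add: runs_Skip)
next
  case (Cons b as)
  let ?n = "length xs"
  let ?S = "\<lambda>ys. St rp fl ys xs (Ey (length ys) q) out"
  have 1: "runs (seqs (replicate b c)) (?S ys) (b * T) (?S (ys @ replicate b a))" for ys
  proof (induction b arbitrary: ys)
    case 0
    then show ?case by (simp add: runs_Skip)
  next
    case (Suc b)
    show ?case using runs_Seq[OF body[of ys q] Suc[of "ys @ [a]"]] by simp
  qed
  let ?ys = "\<lambda>i. ys @ replicate b a @ replicate (i * horner as ?n) a"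
  define g where "g i = ?S (?ys i)" for i
  have upd: "(g i)(X := (contents xs, p)) = St rp fl (?ys i) xs (Ey (length (?ys i)) (q(X := p))) out" for i p
    using Cons.prems unfolding g_def by (auto simp: fun_eq_iff St_def Ey_def)
  have "runs (For X (emit (Suc X) as c)) (g 0) (?n * (emit_time ?n as T + 6) + 4) (g ?n)"
  proof (rule runs_For[where w = xs])
    show "g 0 X = (contents xs, 0)" "g ?n X = (contents xs, 0)"
      using Cons.prems by (auto simp: g_def St_def Ey_def)
    fix i
    have "runs (emit (Suc X) as c) (St rp fl (?ys i) xs (Ey (length (?ys i)) (q(X := int i))) out) (emit_time ?n as T)
      (St rp fl (?ys i @ replicate (horner as ?n) a) xs (Ey (length (?ys i @ replicate (horner as ?n) a)) (q(X := int i))) out)"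
      using Cons.prems by (intro Cons.IH) auto
    moreover have "?ys i @ replicate (horner as ?n) a = ?ys (Suc i)"
      by (simp add: replicate_add[symmetric] add.commute)
    ultimately show "runs (emit (Suc X) as c) ((g i)(X := (contents xs, int i))) (emit_time ?n as T) ((g (Suc i))(X := (contents xs, int i)))"
      unfolding upd by (simp only:)
  qed (use xs in auto)
  then have 2: "runs (For X (emit (Suc X) as c)) (?S (ys @ replicate b a)) (?n * (emit_time ?n as T + 6) + 4)
    (?S (ys @ replicate (horner (b # as) ?n) a))"
    unfolding g_def by (simp add: replicate_add)
  show ?case using runs_Seq[OF 1 2] by simp
qed

lemma runs_phase1:
  assumes w: "set w \<subseteq> {1, 2}" "\<And>i. i < length w \<Longrightarrow> contents inp (int i) = w ! i" "contents inp (int (length w)) = 3"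
    and "length as \<le> nx" "length bs \<le> nx"
  shows "runs (phase1 ny nx as bs) (init_state inp) (phase1_time ny nx as bs (length w) (length (word_y as bs w)))
    (St (int (length w) + 1) 0 (word_y as bs w) w (\<lambda>_. 0) [])"
proof -
  let ?n = "length w"
  define f where "f i = St (int i) 0 (take i w) (take i w) (\<lambda>_. int i) []" for i
  have f0: "f 0 = init_state inp" by (auto simp: f_def St_def init_state_def fun_eq_iff contents_def)
  have 1: "runs (While (\<lambda>f. f 0 \<noteq> 3) (Seq (write_all [2..<2 + ny + nx] (\<lambda>f. f 0)) (right 0))) (f 0)
    (?n * ((ny + nx + 1) + 2) + 1) (f ?n)"
  proof (rule runs_While)
    fix i assume i: "i < ?n"
    have s: "scans (f i) 0 = w ! i" using w i by (simp add: f_def)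
    have "w ! i \<in> set w" using i by simp
    then show "scans (f i) 0 \<noteq> 3" unfolding s using w by auto
    let ?\<sigma> = "St (int i) 0 (take (Suc i) w) (take (Suc i) w) (\<lambda>_. int (Suc i)) []"
    have c: "(contents (take i w))(int i := w ! i) = contents (take (Suc i) w)"
      using contents_snoc[of "take i w" "w ! i"] i by (simp add: take_Suc_conv_app_nth)
    have "(\<lambda>k. if k \<in> set [2..<2 + ny + nx] then act (w ! i, R_move) (f i k) else f i k) = ?\<sigma>"
      by (rule ext) (auto simp: f_def St_def act_def c)
    moreover have "scans \<tau> 0 = w ! i" if "\<And>j. j \<notin> set [2..<2 + ny + nx] \<Longrightarrow> \<tau> j = f i j" for \<tau>
      proof -
      have "0 \<notin> set [2..<2 + ny + nx]" by auto
      then show ?thesis using s that[of 0] by (simp add: scans_def)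
    qed
    ultimately have a: "runs (write_all [2..<2 + ny + nx] (\<lambda>f. f 0)) (f i) (ny + nx) ?\<sigma>"
      using runs_write_all[of "[2..<2 + ny + nx]" "f i" "\<lambda>f. f 0" "w ! i"] by (simp del: upt_Suc)
    have b: "runs (right 0) ?\<sigma> 1 (f (Suc i))" unfolding f_def by (intro runs_right_inp) auto
    show "runs (Seq (write_all [2..<2 + ny + nx] (\<lambda>f. f 0)) (right 0)) (f i) (ny + nx + 1) (f (Suc i))"
      by (rule runs_Seq[OF a b])
  qed (use w in \<open>auto simp: f_def\<close>)
  have w0: "0 \<notin> set w" using w by auto
  have fn: "f ?n = St (int ?n) 0 w w (\<lambda>_. int ?n) []" by (simp add: f_def)
  have 2: "runs (right 0) (f ?n) 1 (St (int ?n + 1) 0 w w (\<lambda>_. int ?n) [])"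
    unfolding fn by (intro runs_right_inp) auto
  let ?S = "\<lambda>ys. St (int ?n + 1) 0 ys w (Ey (length ys) (\<lambda>_. 0)) []"
  have "(\<lambda>k. if k \<in> set [2 + ny..<2 + ny + nx] then (contents w, 0) else St (int ?n + 1) 0 w w (\<lambda>_. int ?n) [] k) = ?S w"
    unfolding set_upt by (rule ext) (simp add: St_def Ey_def)
  note * = this
  have 3: "runs (seqs (map rewind [2 + ny..<2 + ny + nx])) (St (int ?n + 1) 0 w w (\<lambda>_. int ?n) []) (nx * (?n * 3 + 3)) (?S w)"
  proof -
    have "St (int ?n + 1) 0 w w (\<lambda>_. int ?n) [] k = (contents w, int ?n)" if "k \<in> set [2 + ny..<2 + ny + nx]" for k
      using that unfolding set_upt atLeastLessThan_iff by (auto simp: St_def)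
    from runs_rewinds[of "[2 + ny..<2 + ny + nx]" "St (int ?n + 1) 0 w w (\<lambda>_. int ?n) []", OF distinct_upt this w0] * show ?thesis
      by (simp del: upt_Suc)
  qed
  have app: "runs (write_all [2..<2 + ny] (\<lambda>_. a)) (?S ys) ny (?S (ys @ [a]))" for a ys by (rule runs_app)
  have em: "runs (emit (2 + ny) cs (write_all [2..<2 + ny] (\<lambda>_. a))) (?S ys) (emit_time ?n cs ny) (?S (ys @ replicate (horner cs ?n) a))"
    if "length cs \<le> nx" for cs a ys
    using that w0 by (intro runs_emit runs_app) auto
  let ?y1 = "w @ [3]" let ?y2 = "?y1 @ replicate (horner as ?n) 4" let ?y3 = "?y2 @ replicate (horner bs ?n) 5"
  let ?y = "word_y as bs w"
  have y: "?y3 @ [6] = ?y" by (simp add: word_y_def)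
  have "(\<lambda>k. if k \<in> set [2..<2 + ny] then (contents ?y, 0) else ?S ?y k) = St (int ?n + 1) 0 ?y w (\<lambda>_. 0) []"
    unfolding set_upt by (rule ext) (simp add: St_def Ey_def)
  note * = this
  have y0: "0 \<notin> set ?y" using w0 by (auto simp: word_y_def)
  have 8: "runs (seqs (map rewind [2..<2 + ny])) (?S ?y) (ny * (length ?y * 3 + 3)) (St (int ?n + 1) 0 ?y w (\<lambda>_. 0) [])"
  proof -
    have "?S ?y k = (contents ?y, int (length ?y))" if "k \<in> set [2..<2 + ny]" for k
      using that unfolding set_upt atLeastLessThan_iff by (auto simp: St_def Ey_def)
    from runs_rewinds[of "[2..<2 + ny]" "?S ?y", OF distinct_upt this y0] * show ?thesis by (simp del: upt_Suc)
  qed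
  note R = runs_Seq[OF 1[unfolded f0] runs_Seq[OF 2 runs_Seq[OF 3 runs_Seq[OF app[where ys = w and a = 3]
    runs_Seq[OF em[OF assms(4), where ys = ?y1 and a = 4] runs_Seq[OF em[OF assms(5), where ys = ?y2 and a = 5] runs_Seq[OF app[where ys = ?y3 and a = 6, unfolded y] 8]]]]]]]
  show ?thesis unfolding phase1_def Let_def phase1_time_def by (rule runs_mono[OF R]) (simp add: algebra_simps)
qed

end

section \<open>Polynomial running time of the machine that computes the questions\<close>

lemma poly_nat_mono: "x \<le> y \<Longrightarrow> poly p x \<le> poly p (y :: nat)" for p :: "nat poly"
  by (induction p) (auto intro: add_mono mult_mono)

definition poly_bounded :: "(nat \<Rightarrow> nat) \<Rightarrow> bool" where
  "poly_bounded f \<longleftrightarrow> (\<exists>p :: nat poly. \<forall>n. f n \<le> poly p n)"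

named_theorems pb

lemma poly_bounded_const [pb]: "poly_bounded (\<lambda>_. c)"
  unfolding poly_bounded_def by (intro exI[of _ "[:c:]"]) auto

lemma poly_bounded_id [pb]: "poly_bounded (\<lambda>n. n)"
  unfolding poly_bounded_def by (intro exI[of _ "[:0, 1:]"]) auto

lemma poly_bounded_add [pb]: "poly_bounded f \<Longrightarrow> poly_bounded g \<Longrightarrow> poly_bounded (\<lambda>n. f n + g n)"
  unfolding poly_bounded_def by (metis poly_add add_mono)

lemma poly_bounded_mult [pb]: "poly_bounded f \<Longrightarrow> poly_bounded g \<Longrightarrow> poly_bounded (\<lambda>n. f n * g n)"
  unfolding poly_bounded_def by (metis poly_mult mult_mono zero_le)

lemma poly_bounded_Suc [pb]: "poly_bounded f \<Longrightarrow> poly_bounded (\<lambda>n. Suc (f n))"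
  using poly_bounded_add[OF poly_bounded_const[of 1], of f] by simp

lemma poly_bounded_power [pb]: "poly_bounded f \<Longrightarrow> poly_bounded (\<lambda>n. f n ^ k)"
  by (induction k) (auto intro!: pb)

lemma poly_bounded_sum_list [pb]: "(\<And>a. a \<in> set as \<Longrightarrow> poly_bounded (f a)) \<Longrightarrow> poly_bounded (\<lambda>n. sum_list (map (\<lambda>a. f a n) as))"
  by (induction as) (auto intro!: pb)

lemma poly_bounded_adv_time [pb]: "poly_bounded (\<lambda>N. adv_time N e)"
  by (induction e) (auto intro!: pb)

lemma poly_bounded_adv_vars_time [pb]: "poly_bounded (\<lambda>N. adv_vars_time N vs)"
  by (induction vs) (auto intro!: pb simp: adv_var_time_def)

lemma poly_bounded_test_time [pb]: "poly_bounded (\<lambda>N. test_time d N \<phi>)"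
  by (induction \<phi>) (auto intro!: pb simp del: power_Suc)

lemma poly_bounded_nest_time [pb]: "poly_bounded T \<Longrightarrow> poly_bounded (\<lambda>N. nest_time N vs (T N))"
  by (induction vs) (auto intro!: pb)

lemma poly_bounded_emit_time [pb]: "poly_bounded (\<lambda>n. emit_time n as T)"
  by (induction as) (auto intro!: pb)

lemma poly_bounded_emit_bit_time [pb]: "poly_bounded (\<lambda>N. emit_bit_time d N as)"
  unfolding emit_bit_time_def item_time_def by (auto intro!: pb)

lemma emit_time_mono: "n \<le> n' \<Longrightarrow> emit_time n as T \<le> emit_time n' as T"
  by (induction as) (auto intro!: add_mono mult_mono)

lemma phase1_time_mono: "n \<le> n' \<Longrightarrow> phase1_time ny nx as bs n N \<le> phase1_time ny nx as bs n' N"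
  unfolding phase1_time_def by (intro add_mono mult_mono emit_time_mono) auto

lemma wf_adv: "d + 1 \<le> ny \<Longrightarrow> 2 + ny \<le> K \<Longrightarrow> e \<le> d \<Longrightarrow> wf_com K S (adv e)"
  by (induction e) auto

lemma wf_adv_vars:
  "d + 1 \<le> ny \<Longrightarrow> 2 + ny \<le> K \<Longrightarrow> length vs \<le> d \<Longrightarrow> \<forall>v\<in>set vs. v < 2 + ny \<Longrightarrow> wf_com K S (adv_vars vs)"
  by (induction vs) (auto simp: adv_var_def restore_def intro!: wf_adv[of d ny])

lemma wf_equals: "wf_com K S ct \<Longrightarrow> wf_com K S cf \<Longrightarrow> v < K \<Longrightarrow> w < K \<Longrightarrow> 2 < K \<Longrightarrow> wf_com K S (equals v w ct cf)"
  by (auto simp: equals_def restore_def)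

lemma wf_equals_const: "wf_com K S ct \<Longrightarrow> wf_com K S cf \<Longrightarrow> v < K \<Longrightarrow> wf_com K S (equals_const v n ct cf)"
  by (induction n arbitrary: ct cf) auto

lemma wf_test:
  assumes "d + 1 \<le> ny" "2 + ny \<le> K"
  shows "wf_fm d ny N \<phi> \<Longrightarrow> wf_com K S ct \<Longrightarrow> wf_com K S cf \<Longrightarrow> wf_com K S (test d \<phi> ct cf)"
proof (induction \<phi> arbitrary: ct cf)
  case (Look b vs)
  then show ?case using assms wf_adv_vars[of d ny K vs S] wf_adv[of d ny K d S] by (auto simp: unread_def)
qed (use assms in \<open>auto intro!: wf_equals wf_equals_const\<close>)

definition bit_sym :: "bool \<Rightarrow> nat" where "bit_sym b = (if b then 2 else 1)"

lemma enc_Nil [simp]: "enc [] = []" by (simp add: enc_def)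
lemma enc_Cons [simp]: "enc (w # ws) = map bit_sym w @ 3 # enc ws"
  by (simp add: enc_def bit_sym_def)

definition item_val :: "nat list \<Rightarrow> (nat \<Rightarrow> nat list \<Rightarrow> bool) \<Rightarrow> (nat \<Rightarrow> nat) \<Rightarrow> nat list \<times> fm \<Rightarrow> nat" where
  "item_val y R e a = count_nest (length y) (fst a) (\<lambda>e. of_bool (eval y R e (snd a))) e"

definition out_word :: "nat list \<Rightarrow> (nat \<Rightarrow> nat list \<Rightarrow> bool) \<Rightarrow> nat list \<Rightarrow> (nat list \<times> fm) list \<Rightarrow> bool list" where
  "out_word y R cs as = list_nest (length y) cs (\<lambda>e. [odd (sum_list (map (item_val y R e) as))]) (\<lambda>_. 0)"

definition coin_of :: "nat \<Rightarrow> nat \<Rightarrow> bool list \<Rightarrow> nat \<Rightarrow> nat list \<Rightarrow> bool" where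
  "coin_of N d r b vs \<longleftrightarrow> b * N ^ d + tidx N vs < length r \<and> r ! (b * N ^ d + tidx N vs)"

definition queries :: "nat \<Rightarrow> nat list \<Rightarrow> nat list \<Rightarrow> nat list \<Rightarrow> (nat list \<times> fm) list \<Rightarrow> (nat list \<times> fm) list \<Rightarrow>
    bool list list \<Rightarrow> bool list list" where
  "queries d as bs cs A1 A2 ws =
     (let y = word_y as bs (map bit_sym (ws ! 0)); R = coin_of (length y) d (ws ! 1)
      in [out_word y R cs A1, out_word y R cs A2])"

lemma map_list_nest: "map f (list_nest N vs h e) = list_nest N vs (\<lambda>e. map f (h e)) e"
  by (induction vs arbitrary: e) (auto simp: map_concat o_def)

lemma contents_append_right: "contents (us @ vs) (int (length us + i)) = contents vs (int i)"
proof -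
  have "nat (int (length us + i)) = length us + i" by simp
  then show ?thesis unfolding contents_def by (simp add: nth_append)
qed

lemma contents_bits: "contents (map bit_sym r @ [3]) (int i) = 2 \<longleftrightarrow> i < length r \<and> r ! i"
  by (auto simp: contents_def nth_append bit_sym_def)

lemma contents_enc:
  "contents (map bit_sym x @ 3 # map bit_sym r @ [3]) (int (length x + 1 + i)) = 2 \<longleftrightarrow> i < length r \<and> r ! i"
  using contents_append_right[of "map bit_sym x @ [3]" "map bit_sym r @ [3]" i] contents_bits[of r i] by simp

definition query_com :: "nat \<Rightarrow> nat \<Rightarrow> nat \<Rightarrow> nat list \<Rightarrow> nat list \<Rightarrow> nat list \<Rightarrow> (nat list \<times> fm) list \<Rightarrow> (nat list \<times> fm) list \<Rightarrow> com" where
  "query_com d ny nx as bs cs A1 A2 = Seq (phase1 ny nx as bs)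
     (Seq (emit_word d (2 + ny + nx) cs A1) (emit_word d (2 + ny + nx) cs A2))"

lemma polytime_queries:
  assumes ny: "d + 1 \<le> ny" and cs: "\<forall>v\<in>set cs. 3 + d \<le> v \<and> v < 2 + ny" "distinct cs"
    and A: "\<And>x a. a \<in> set A1 \<union> set A2 \<Longrightarrow> (\<forall>v\<in>set (fst a). 3 + d \<le> v \<and> v < 2 + ny) \<and> distinct (fst a) \<and>
      set (fst a) \<inter> set cs = {} \<and> wf_fm d ny (length (word_y as bs (map bit_sym x))) (snd a)"
    and p: "\<And>x. poly p (length x) = length (word_y as bs (map bit_sym x)) ^ Suc d"
  shows "polytime_on {[x, r] | x r. length r = poly p (length x)} (queries d as bs cs A1 A2)"
proof -
  define nx where "nx = max (length as) (length bs)"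
  define K where "K = 3 + ny + nx"
  define T where "T N = phase1_time ny nx as bs N N + ((nest_time N cs (emit_bit_time d N A1) + 1) + (nest_time N cs (emit_bit_time d N A2) + 1))" for N
  have "poly_bounded T" unfolding T_def phase1_time_def by (auto intro!: pb)
  then obtain q where q: "\<And>n. T n \<le> poly q n" unfolding poly_bounded_def by blast
  have wf_word: "wf_com K 7 (emit_word d (2 + ny + nx) cs A)" if "set A \<subseteq> set A1 \<union> set A2" for A
  proof -
    have "wf_com K 7 (item d a)" if "a \<in> set A" for a
    proof -
      have a: "\<forall>v\<in>set (fst a). 3 + d \<le> v \<and> v < 2 + ny" "wf_fm d ny (length (word_y as bs (map bit_sym []))) (snd a)"
        using A[of a "[]"] \<open>set A \<subseteq> _\<close> that by blast+
      have "wf_com K 7 (test d (snd a) flip Skip)"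
        by (rule wf_test[OF ny _ a(2)]) (auto simp: K_def flip_def)
      then show ?thesis using a(1) unfolding item_def by (auto simp: K_def)
    qed
    then show ?thesis using cs by (auto simp: emit_word_def emit_bit_def write_out_def K_def)
  qed
  have wf1: "wf_com K 7 (phase1 ny nx as bs)"
    unfolding phase1_def Let_def by (auto simp: K_def nx_def intro!: wf_emit simp del: upt_Suc)
  show ?thesis
  \<comment> \<open>Seven symbols: the blank, the three of the input encoding, and the letters 4, 5
    and 6 of the loop word.\<close>
  proof (rule polytime_onI[where K = K and S = 7 and c = "query_com d ny nx as bs cs A1 A2" and p = q])
    show "wf_com K 7 (query_com d ny nx as bs cs A1 A2)"
      using wf1 wf_word by (auto simp: query_com_def)
    show "clen (query_com d ny nx as bs cs A1 A2) \<ge> 1"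
      by (simp add: query_com_def phase1_def Let_def)
    fix ws assume "ws \<in> {[x, r] | (x :: bool list) r. length r = poly p (length x)}"
    then obtain x r where ws: "ws = [x, r]" "length r = poly p (length x)" by auto
    define w where "w = map bit_sym x"
    define y where "y = word_y as bs w"
    define inp where "inp = enc ws"
    define R where "R = coin_of (length y) d r"
    have inp: "inp = w @ 3 # map bit_sym r @ [3]" by (simp add: inp_def ws w_def)
    have r: "length r = length y ^ Suc d" using ws p by (simp add: y_def w_def)
    interpret layout inp ny nx .
    interpret reading inp ny nx y w "length w + 1" d
    proof
      show "0 \<notin> set y" by (auto simp: y_def word_y_def w_def bit_sym_def)
      show "contents inp (int (length w + 1) - 1) = 3" by (simp add: contents_def inp)
      show "contents inp (int (length w + 1 + i)) \<in> {1, 2}" if "i < length y ^ Suc d" for i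
      proof -
        have "contents inp (int (length w + 1 + i)) = contents (map bit_sym r @ [3]) (int i)"
          using contents_append_right[of "w @ [3]" "map bit_sym r @ [3]" i] by (simp add: inp)
        also have "\<dots> = map bit_sym r ! i" using that r by (simp add: contents_def nth_append)
        finally show ?thesis using that r by (simp add: bit_sym_def)
      qed
    qed (use ny in auto)
    have coin: "coin = R"
    proof (intro ext)
      show "coin b vs = R b vs" for b vs
        using contents_enc[of x r "b * length y ^ d + tidx (length y) vs"]
        unfolding R_def coin_def coin_of_def by (simp add: inp w_def add.assoc)
    qed
    have iv: "item_value = item_val y R"
      unfolding fun_eq_iff item_value_def item_val_def coin by simp
    have bv: "list_nest (length y) cs (\<lambda>e. [bit_value A e]) (\<lambda>_. 0) = map bit_sym (out_word y R cs A)" for A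
      unfolding out_word_def map_list_nest bit_value_def iv by (simp add: bit_sym_def)
    have ph: "runs (phase1 ny nx as bs) (init_state inp) (phase1_time ny nx as bs (length w) (length y))
      (St (int (length w) + 1) 0 y w (\<lambda>_. 0) [])" unfolding y_def
    proof (rule runs_phase1)
      show "contents inp (int i) = w ! i" if "i < length w" for i using that by (simp add: contents_def inp nth_append)
      show "contents inp (int (length w)) = 3"
        using contents_append_right[of w "3 # map bit_sym r @ [3]" 0] by (simp add: inp contents_def)
    qed (auto simp: w_def bit_sym_def nx_def)
    have wfi: "\<forall>a\<in>set A. wf_item a \<and> set (fst a) \<inter> set cs = {}" if "set A \<subseteq> set A1 \<union> set A2" for A
      using A[of _ x, folded w_def, folded y_def] that unfolding wf_item_def by blast
    have "y \<noteq> []" by (simp add: y_def word_y_def)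
    then have em: "runs (emit_word d (2 + ny + nx) cs A) (St (int (length w + 1)) 0 y w (\<lambda>_. 0) out)
        (nest_time (length y) cs (emit_bit_time d (length y) A) + 1)
        (St (int (length w + 1)) 0 y w (\<lambda>_. 0) (out @ map bit_sym (out_word y R cs A) @ [3]))"
      if "set A \<subseteq> set A1 \<union> set A2" for A out
      using runs_emit_word[OF wfi[OF that] cs, of out] unfolding bv by simp
    have e: "int (length w) + 1 = int (length w + 1)" by simp
    define \<sigma>' where "\<sigma>' = St (int (length w + 1)) 0 y w (\<lambda>_. 0) (([] @ map bit_sym (out_word y R cs A1) @ [3]) @ map bit_sym (out_word y R cs A2) @ [3])"
    have "runs (query_com d ny nx as bs cs A1 A2) (init_state inp)
       (phase1_time ny nx as bs (length w) (length y) +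
        ((nest_time (length y) cs (emit_bit_time d (length y) A1) + 1) + (nest_time (length y) cs (emit_bit_time d (length y) A2) + 1))) \<sigma>'"
      unfolding query_com_def \<sigma>'_def
      by (rule runs_Seq[OF ph[unfolded e] runs_Seq[OF em em]]) auto
    then obtain t where t: "big (query_com d ny nx as bs cs A1 A2) (init_state inp) t \<sigma>'"
      "t \<le> phase1_time ny nx as bs (length w) (length y) +
        ((nest_time (length y) cs (emit_bit_time d (length y) A1) + 1) + (nest_time (length y) cs (emit_bit_time d (length y) A2) + 1))"
      unfolding runs_def by blast
    have "length w \<le> length y" by (simp add: y_def word_y_def)
    then have "t \<le> T (length y)" using t(2) phase1_time_mono[of "length w" "length y" ny nx as bs "length y"]
      unfolding T_def by linarith
    also have "\<dots> \<le> poly q (length y)" by (rule q)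
    \<comment> \<open>A time bound polynomial in the loop length is enough: the coins are part of
      the input, and there are at least as many of them as letters in \<open>y\<close>.\<close>
    also have "\<dots> \<le> poly q (length inp)"
    proof (rule poly_nat_mono)
      have "length y ^ 1 \<le> length y ^ Suc d" using \<open>y \<noteq> []\<close> by (intro power_increasing) (auto simp: Suc_le_eq)
      then have "length y \<le> length r" using r by (simp only: power_one_right)
      then show "length y \<le> length inp" by (simp add: inp)
    qed
    finally have "t \<le> poly q (length inp)" .
    moreover have "fst (\<sigma>' (K - 1)) = contents (enc (queries d as bs cs A1 A2 ws))"
      by (simp add: \<sigma>'_def St_def K_def queries_def ws Let_def y_def[symmetric] w_def[symmetric] R_def[symmetric])
    ultimately show "\<exists>t \<sigma>'. big (query_com d ny nx as bs cs A1 A2) (init_state (enc ws)) t \<sigma>' \<and>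
        t \<le> poly q (length (enc ws)) \<and> fst (\<sigma>' (K - 1)) = contents (enc (queries d as bs cs A1 A2 ws))"
      using t unfolding inp_def[symmetric] by blast
  qed (auto simp: K_def)
qed

section \<open>The machine for the final decision\<close>

definition skip3 :: com where
  "skip3 = Seq (While (\<lambda>f. f 0 \<noteq> 3) (right 0)) (right 0)"

text \<open>The first coin and the first answer are copied to tapes 1 and 2, so that a single step
  at the second answer sees all three bits.\<close>

definition verdict_com :: com where
  "verdict_com = Seq skip3 (Seq (Op 1 (\<lambda>f. f 0) N_move) (Seq skip3 (Seq (Op 2 (\<lambda>f. f 0) N_move) (Seq (right 0)
     (Seq (Op 3 (\<lambda>f. if ((f 2 = 2) \<noteq> (f 0 = 2)) = (f 1 = 2) then 2 else 1) R_move) (Op 3 (\<lambda>_. 3) N_move))))))"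

definition verdict :: "bool list list \<Rightarrow> bool" where
  "verdict ws \<longleftrightarrow> ((ws ! 2 ! 0) \<noteq> (ws ! 2 ! 1)) = (ws ! 1 ! 0)"

lemma runs_skip3:
  assumes "\<sigma> 0 = (c, p)" "\<And>i. i < n \<Longrightarrow> c (p + int i) \<noteq> 3" "c (p + int n) = 3"
  shows "runs skip3 \<sigma> (n * 3 + 2) (\<sigma>(0 := (c, p + int n + 1)))"
proof -
  define f where "f i = \<sigma>(0 := (c, p + int i))" for i
  have 1: "runs (While (\<lambda>f. f 0 \<noteq> 3) (right 0)) (f 0) (n * (1 + 2) + 1) (f n)"
  proof (rule runs_While)
    show "runs (right 0) (f i) 1 (f (Suc i))" for i using runs_right[of 0 "f i"] by (simp add: f_def algebra_simps)
  qed (use assms in \<open>auto simp: f_def scans_def scan_def\<close>)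
  have 2: "runs (right 0) (f n) 1 (\<sigma>(0 := (c, p + int n + 1)))" using runs_right[of 0 "f n"] by (simp add: f_def)
  have "f 0 = \<sigma>" using assms(1) by (auto simp: f_def)
  then show ?thesis unfolding skip3_def using runs_mono[OF runs_Seq[OF 1 2], of "n * 3 + 2"] by simp
qed

lemma polytime_verdict:
  fixes p :: "nat poly"
  assumes p: "\<And>n. poly p n \<ge> 1"
  shows "polytime_decides_on {[x, r, a] | x r a. length r = poly p (length x) \<and> length a = 2} verdict"
  unfolding polytime_decides_on_def
proof (rule polytime_onI[where K = 4 and S = 4 and c = verdict_com and p = "[:9, 3:]"])
  show "wf_com 4 4 verdict_com" by (auto simp: verdict_com_def skip3_def)
  show "clen verdict_com \<ge> 1" by (simp add: verdict_com_def)
  fix ws assume "ws \<in> {[x, r, a] | (x :: bool list) r a. length r = poly p (length x) \<and> length a = 2}"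
  then obtain x r a where ws: "ws = [x, r, a]" and r: "length r \<ge> 1" and "length a = 2" using p by force
  then obtain a0 a1 where a: "a = [a0, a1]" by (cases a; cases "tl a") auto
  define c where "c = contents (enc ws)"
  let ?X = "map bit_sym x" let ?R = "map bit_sym r" let ?A = "[bit_sym a0, bit_sym a1, 3]"
  have e: "enc ws = ?X @ 3 # ?R @ 3 # ?A" by (simp add: ws a)
  have c1: "c (int i) = ?X ! i" if "i < length x" for i
    using that by (simp add: c_def contents_def e nth_append)
  have c2: "c (int (length x + 0)) = 3"
    using contents_append_right[of ?X "3 # ?R @ 3 # ?A" 0] unfolding c_def e by (simp add: contents_def)
  have c3: "c (int (length x + 1 + i)) = ?R ! i" if "i < length r" for i
    using that contents_append_right[of "?X @ [3]" "?R @ 3 # ?A" i] unfolding c_def e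
      by (simp add: contents_def nth_append)
  have c4: "c (int (length x + 1 + length r)) = 3"
    using contents_append_right[of "?X @ [3]" "?R @ 3 # ?A" "length r"] unfolding c_def e
      by (simp add: contents_def nth_append)
  have c5: "c (int (length x + length r + 2 + i)) = ?A ! i" if "i < 2" for i
    using that contents_append_right[of "?X @ 3 # ?R @ [3]" ?A i] unfolding c_def e
      by (simp add: contents_def add.assoc)
  define s where "s q b d o' = (\<lambda>k :: nat. if k = 0 then (c, q) else if k = 1 then (b, 0) else if k = 2 then (d, 0)
     else if k = 3 then (o' :: tape) else (contents [], 0 :: int))" for q b d o'
  let ?z = "contents []"
  have z: "?z = (\<lambda>_. 0)" by (simp add: contents_def fun_eq_iff)
  have i: "init_state (enc ws) = s 0 ?z ?z (?z, 0)" by (auto simp: s_def init_state_def c_def fun_eq_iff)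
  have su: "(s q b d o')(0 := (c, q')) = s q' b d o'" for q b d o' q' by (auto simp: s_def fun_eq_iff)
  have s0: "s q b d o' 0 = (c, q)" for q b d o' by (simp add: s_def)
  define q1 where "q1 = int (length x) + 1"
  define q2 where "q2 = int (length x + length r + 2)"
  have 1: "runs skip3 (s 0 ?z ?z (?z, 0)) (length x * 3 + 2) (s q1 ?z ?z (?z, 0))"
    using runs_skip3[of "s 0 ?z ?z (?z, 0)" c 0 "length x", OF s0] c1 c2 by (simp add: su q1_def bit_sym_def)
  let ?b = "?z(0 := bit_sym (r ! 0))"
  have cq1: "c q1 = bit_sym (r ! 0)" using c3[of 0] r by (cases r) (simp_all add: q1_def add.commute)
  have 2: "runs (Op 1 (\<lambda>f. f 0) N_move) (s q1 ?z ?z (?z, 0)) 1 (s q1 ?b ?z (?z, 0))"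
    using cq1 by (intro runs_Op) (auto simp: s_def act_def scans_def scan_def fun_eq_iff)
  have 3: "runs skip3 (s q1 ?b ?z (?z, 0)) (length r * 3 + 2) (s q2 ?b ?z (?z, 0))"
  proof -
    have "c (q1 + int i) \<noteq> 3" if "i < length r" for i using c3[OF that] that
      by (simp add: q1_def add.commute bit_sym_def add.left_commute)
    moreover have "c (q1 + int (length r)) = 3" using c4 by (simp add: q1_def add.commute add.left_commute)
    ultimately show ?thesis
      using runs_skip3[of "s q1 ?b ?z (?z, 0)" c q1 "length r", OF s0]
        by (simp add: su q1_def q2_def add.commute add.left_commute)
  qed
  let ?d = "?z(0 := bit_sym a0)"
  have cq2: "c q2 = bit_sym a0" "c (q2 + 1) = bit_sym a1"
    using c5[of 0] c5[of 1] by (simp_all add: q2_def add.commute add.left_commute)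
  have 4: "runs (Op 2 (\<lambda>f. f 0) N_move) (s q2 ?b ?z (?z, 0)) 1 (s q2 ?b ?d (?z, 0))"
    using cq2 by (intro runs_Op) (auto simp: s_def act_def scans_def scan_def fun_eq_iff)
  have 5: "runs (right 0) (s q2 ?b ?d (?z, 0)) 1 (s (q2 + 1) ?b ?d (?z, 0))"
    using runs_right[of 0 "s q2 ?b ?d (?z, 0)"] by (simp add: s0 su)
  let ?v = "bit_sym (verdict ws)"
  have 6: "runs (Op 3 (\<lambda>f. if ((f 2 = 2) \<noteq> (f 0 = 2)) = (f 1 = 2) then 2 else 1) R_move) (s (q2 + 1) ?b ?d (?z, 0)) 1 (s (q2 + 1) ?b ?d (?z(0 := ?v), 1))"
    using cq2 by (intro runs_Op) (auto simp: s_def act_def scans_def scan_def fun_eq_iff bit_sym_def verdict_def ws a)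
  have 7: "runs (Op 3 (\<lambda>_. 3) N_move) (s (q2 + 1) ?b ?d (?z(0 := ?v), 1)) 1 (s (q2 + 1) ?b ?d (?z(0 := ?v, 1 := 3), 1))"
    by (intro runs_Op) (auto simp: s_def act_def scans_def scan_def fun_eq_iff)
  have "runs verdict_com (init_state (enc ws))
    ((length x * 3 + 2) + (1 + ((length r * 3 + 2) + (1 + (1 + (1 + 1)))))) (s (q2 + 1) ?b ?d (?z(0 := ?v, 1 := 3), 1))"
    unfolding verdict_com_def i
    by (rule runs_Seq[OF 1 runs_Seq[OF 2 runs_Seq[OF 3 runs_Seq[OF 4 runs_Seq[OF 5 runs_Seq[OF 6 7]]]]]])
  then obtain t where t: "big verdict_com (init_state (enc ws)) t (s (q2 + 1) ?b ?d (?z(0 := ?v, 1 := 3), 1))"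
    "t \<le> (length x * 3 + 2) + (1 + ((length r * 3 + 2) + (1 + (1 + (1 + 1)))))" unfolding runs_def by blast
  have "t \<le> poly [:9, 3:] (length (enc ws))" using t(2) by (simp add: e)
  moreover have "fst (s (q2 + 1) ?b ?d (?z(0 := ?v, 1 := 3), 1) (4 - 1)) = contents (enc [[verdict ws]])"
    by (auto simp: s_def contents_def fun_eq_iff nth_Cons' nat_eq_iff)
  ultimately show "\<exists>t \<sigma>'. big verdict_com (init_state (enc ws)) t \<sigma>' \<and>
        t \<le> poly [:9, 3:] (length (enc ws)) \<and> fst (\<sigma>' (4 - 1)) = contents (enc [[verdict ws]])"
    using t(1) by blast
qed auto

section \<open>XOR games with a shifted question\<close>

definition sg :: "bool \<Rightarrow> real" where "sg b = (if b then -1 else 1)"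

lemma sg_simps [simp]: "sg True = -1" "sg False = 1" "sg (\<not> b) = - sg b" "sg b * sg b = 1" "\<bar>sg b\<bar> = 1"
  by (auto simp: sg_def)

lemma sg_xor: "sg (a \<noteq> b) = sg a * sg b" "sg (a = (\<not> b)) = sg a * sg b"
  by (auto simp: sg_def)

definition BL :: "nat \<Rightarrow> bool list set" where "BL n = {r. length r = n}"

definition avg :: "nat \<Rightarrow> (bool list \<Rightarrow> real) \<Rightarrow> real" where
  "avg n f = (\<Sum>r\<in>BL n. f r) / 2 ^ n"

lemma finite_BL [simp]: "finite (BL n)"
  using finite_lists_length_eq[of "UNIV :: bool set" n] by (simp add: BL_def)

lemma card_BL: "card (BL n) = 2 ^ n"
  using card_lists_length_eq[of "UNIV :: bool set" n] by (simp add: BL_def)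

lemma avg_cong: "(\<And>r. r \<in> BL n \<Longrightarrow> f r = g r) \<Longrightarrow> avg n f = avg n g"
  by (simp add: avg_def)

lemma avg_const [simp]: "avg n (\<lambda>_. c) = c"
  by (simp add: avg_def card_BL)

lemma avg_mono: "(\<And>r. r \<in> BL n \<Longrightarrow> f r \<le> g r) \<Longrightarrow> avg n f \<le> avg n g"
  by (auto simp: avg_def intro!: divide_right_mono sum_mono)

lemma avg_add: "avg n (\<lambda>r. f r + g r) = avg n f + avg n g"
  by (simp add: avg_def sum.distrib add_divide_distrib)

lemma avg_diff: "avg n (\<lambda>r. f r - g r) = avg n f - avg n g"
  by (simp add: avg_def sum_subtractf diff_divide_distrib)

lemma avg_cmult: "avg n (\<lambda>r. c * f r) = c * avg n f"
  by (simp add: avg_def sum_distrib_left)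

lemma avg_mult_const: "avg n (\<lambda>r. f r * c) = avg n f * c"
  by (simp add: avg_def sum_distrib_right)

lemma avg_swap: "avg n (\<lambda>u. avg k (\<lambda>v. f u v)) = avg k (\<lambda>v. avg n (\<lambda>u. f u v))"
  by (simp add: avg_def sum_divide_distrib divide_divide_eq_left mult.commute) (rule sum.swap)

lemma bij_append_BL: "bij_betw (\<lambda>(u, v). u @ v) (BL a \<times> BL b) (BL (a + b))"
proof (rule bij_betwI[where g = "\<lambda>r. (take a r, drop a r)"])
qed (auto simp: BL_def)

lemma avg_split: "avg (a + b) f = avg a (\<lambda>u. avg b (\<lambda>v. f (u @ v)))"
proof -
  have "(\<Sum>r\<in>BL (a + b). f r) = (\<Sum>u\<in>BL a. \<Sum>v\<in>BL b. f (u @ v))"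
    using sum.reindex_bij_betw[OF bij_append_BL, of f a b] by (simp add: sum.cartesian_product case_prod_unfold)
  then show ?thesis unfolding avg_def
    by (simp add: sum_divide_distrib power_add divide_divide_eq_left mult.commute)
qed

text \<open>Disjoint blocks of coins are independent and each of the \<open>t\<close> factors has
  the same expectation.\<close>

lemma avg_blocks:
  "avg (o' + t * G + e) (\<lambda>r. \<Prod>\<tau><t. f (take G (drop (o' + \<tau> * G) r))) = avg G f ^ t"
proof -
  have *: "avg (t * G + e) (\<lambda>r. \<Prod>\<tau><t. f (take G (drop (\<tau> * G) r))) = avg G f ^ t"
  proof (induction t)
    case (Suc t)
    have "avg (Suc t * G + e) (\<lambda>r. \<Prod>\<tau><Suc t. f (take G (drop (\<tau> * G) r)))
      = avg (G + (t * G + e)) (\<lambda>r. \<Prod>\<tau><Suc t. f (take G (drop (\<tau> * G) r)))" by (simp add: add.assoc)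
    also have "\<dots> = avg G (\<lambda>u. avg (t * G + e) (\<lambda>v. f u * (\<Prod>\<tau><t. f (take G (drop (\<tau> * G) v)))))"
      unfolding avg_split[of G] prod.lessThan_Suc_shift
      by (intro avg_cong) (auto simp: BL_def o_def)
    also have "\<dots> = avg G f * avg G f ^ t" unfolding avg_cmult Suc avg_mult_const ..
    finally show ?case by simp
  qed simp
  have "avg (o' + t * G + e) (\<lambda>r. \<Prod>\<tau><t. f (take G (drop (o' + \<tau> * G) r))) =
     avg o' (\<lambda>u. avg (t * G + e) (\<lambda>v. \<Prod>\<tau><t. f (take G (drop (\<tau> * G) v))))"
    unfolding add.assoc[of o'] avg_split[of o'] by (intro avg_cong) (auto simp: BL_def)
  then show ?thesis using * by simp
qed

lemma avg_flip:
  assumes "i < n" "\<And>r. r \<in> BL n \<Longrightarrow> f (r[i := \<not> r ! i]) = - f r"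
  shows "avg n f = 0"
proof -
  let ?h = "\<lambda>r. r[i := \<not> r ! i]"
  have "bij_betw ?h (BL n) (BL n)"
    by (rule bij_betwI[where g = ?h]) (use assms(1) in \<open>auto simp: BL_def\<close>)
  then have "(\<Sum>r\<in>BL n. f r) = (\<Sum>r\<in>BL n. f (?h r))" by (rule sum.reindex_bij_betw[symmetric])
  also have "\<dots> = - (\<Sum>r\<in>BL n. f r)" using assms(2) by (simp add: sum_negf)
  finally show ?thesis by (simp add: avg_def)
qed

text \<open>If some \<open>s k\<close> is -1, flipping its coin negates the product; injectivity of
  \<open>pos\<close> leaves all other factors alone.\<close>

lemma avg_char:
  assumes "finite S" "inj_on pos S" "\<And>i. i \<in> S \<Longrightarrow> pos i < n" "\<And>i. i \<in> S \<Longrightarrow> s i = 1 \<or> s i = -1"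
  shows "avg n (\<lambda>r. \<Prod>i\<in>S. if r ! pos i then s i else 1) = of_bool (\<forall>i\<in>S. s i = 1)"
proof (cases "\<forall>i\<in>S. s i = 1")
  case True
  then have "avg n (\<lambda>r. \<Prod>i\<in>S. if r ! pos i then s i else 1) = avg n (\<lambda>_. 1)"
    by (intro avg_cong prod.neutral) auto
  then show ?thesis using True by simp
next
  case False
  then obtain k where k: "k \<in> S" "s k = -1" using assms(4) by auto
  have "avg n (\<lambda>r. \<Prod>i\<in>S. if r ! pos i then s i else 1) = 0"
  proof (rule avg_flip)
    show "pos k < n" using k assms by auto
    fix r assume "r \<in> BL n"
    then have "(r[pos k := \<not> r ! pos k]) ! pos i = r ! pos i" if "i \<in> S - {k}" for i
      using that k assms(2) by (subst nth_list_update_neq) (auto simp: inj_on_def)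
    then have "(\<Prod>i\<in>S - {k}. if r[pos k := \<not> r ! pos k] ! pos i then s i else 1) =
        (\<Prod>i\<in>S - {k}. if r ! pos i then s i else 1)" by (intro prod.cong) auto
    then show "(\<Prod>i\<in>S. if r[pos k := \<not> r ! pos k] ! pos i then s i else 1) = - (\<Prod>i\<in>S. if r ! pos i then s i else 1)"
      using k assms(1,3) \<open>r \<in> BL n\<close> by (simp add: prod.remove[of S k] BL_def)
  qed
  then show ?thesis using False by simp
qed

section \<open>Characters and the Fourier bound for XOR games\<close>

definition xorl :: "bool list \<Rightarrow> bool list \<Rightarrow> bool list" where
  "xorl q z = map2 (\<noteq>) q z"

definition chi :: "bool list \<Rightarrow> bool list \<Rightarrow> real" where
  "chi w q = (\<Prod>i<length q. if w ! i then sg (q ! i) else 1)"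

lemma chi_xorl: "length q = length z \<Longrightarrow> chi w (xorl q z) = chi w q * chi w z"
  unfolding chi_def xorl_def by (auto simp: prod.distrib[symmetric] sg_xor intro!: prod.cong)

lemma chi_orthogonal:
  assumes "q \<in> BL D" "q' \<in> BL D"
  shows "(\<Sum>w\<in>BL D. chi w q * chi w q') = 2 ^ D * of_bool (q = q')"
proof -
  have "avg D (\<lambda>w. chi w q * chi w q') = avg D (\<lambda>w. \<Prod>i<D. if w ! i then sg (q ! i \<noteq> q' ! i) else 1)"
    using assms unfolding chi_def BL_def by (intro avg_cong) (auto simp: prod.distrib[symmetric] sg_xor intro!: prod.cong)
  also have "\<dots> = of_bool (\<forall>i\<in>{..<D}. sg (q ! i \<noteq> q' ! i) = 1)"
    by (rule avg_char) (auto simp: sg_def)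
  also have "(\<forall>i\<in>{..<D}. sg (q ! i \<noteq> q' ! i) = 1) \<longleftrightarrow> q = q'"
    using assms by (auto simp: sg_def BL_def list_eq_iff_nth_eq)
  finally show ?thesis by (simp add: avg_def field_simps)
qed

text \<open>The coefficients are not normalised: one factor \<open>2 ^ D\<close> comes from
  orthogonality, the other from the number of strings \<open>q\<close>, each contributing 1.\<close>

lemma parseval:
  assumes "\<And>q. q \<in> BL D \<Longrightarrow> F q * F q = 1"
  shows "(\<Sum>w\<in>BL D. (\<Sum>q\<in>BL D. F q * chi w q)\<^sup>2) = 4 ^ D"
proof -
  have "(\<Sum>w\<in>BL D. (\<Sum>q\<in>BL D. F q * chi w q)\<^sup>2) = (\<Sum>w\<in>BL D. \<Sum>q\<in>BL D. \<Sum>q'\<in>BL D. F q * F q' * (chi w q * chi w q'))"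
    by (simp add: power2_eq_square sum_product algebra_simps)
  also have "\<dots> = (\<Sum>q\<in>BL D. \<Sum>q'\<in>BL D. F q * F q' * (\<Sum>w\<in>BL D. chi w q * chi w q'))"
    by (simp only: sum_distrib_left, subst sum.swap, intro sum.cong refl sum.swap)
  also have "\<dots> = (\<Sum>q\<in>BL D. \<Sum>q'\<in>BL D. if q' = q then 2 ^ D * (F q * F q) else 0)"
    by (intro sum.cong refl) (auto simp: chi_orthogonal)
  also have "\<dots> = (\<Sum>q\<in>BL D. 2 ^ D * (F q * F q))"
    by (intro sum.cong refl) (auto simp: sum.delta)
  also have "\<dots> = (\<Sum>q\<in>BL D. 2 ^ D)" using assms by (intro sum.cong) auto
  also have "\<dots> = 4 ^ D" by (simp add: card_BL power_mult_distrib[symmetric])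
  finally show ?thesis .
qed

text \<open>
  A strategy pair is expanded in characters; the verifier's shift acts diagonally on characters, so
  its bias is bounded by the largest eigenvalue.
\<close>

lemma xor_game_bias:
  assumes F: "\<And>q. q \<in> BL D \<Longrightarrow> F q * F q = 1" and G: "\<And>q. q \<in> BL D \<Longrightarrow> G q * G q = 1"
    and z: "\<And>r. r \<in> BL M \<Longrightarrow> z r \<in> BL D"
    and ev: "\<And>w. w \<in> BL D \<Longrightarrow> \<bar>avg M (\<lambda>r. \<sigma> r * chi w (z r))\<bar> \<le> \<Lambda>"
  shows "\<bar>avg D (\<lambda>q. avg M (\<lambda>r. \<sigma> r * F q * G (xorl q (z r))))\<bar> \<le> \<Lambda>"
proof -
  define a where "a w = (\<Sum>q\<in>BL D. F q * chi w q)" for w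
  define b where "b w = (\<Sum>q\<in>BL D. G q * chi w q)" for w
  define l where "l w = avg M (\<lambda>r. \<sigma> r * chi w (z r))" for w
  have x: "xorl q (z r) \<in> BL D" if "q \<in> BL D" "r \<in> BL M" for q r using that z[of r] by (auto simp: BL_def xorl_def)
  \<comment> \<open>Convolution theorem: correlating the strategies at shift \<open>z r\<close> is a
    multiplication of their Fourier coefficients.\<close>
  have inner: "(\<Sum>w\<in>BL D. chi w (z r) * (a w * b w)) = 2 ^ D * (\<Sum>q\<in>BL D. F q * G (xorl q (z r)))" if r: "r \<in> BL M" for r
  proof -
    have "(\<Sum>w\<in>BL D. chi w (z r) * (a w * b w)) =
      (\<Sum>w\<in>BL D. \<Sum>q\<in>BL D. \<Sum>q'\<in>BL D. F q * G q' * (chi w (xorl q (z r)) * chi w q'))"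
    proof (intro sum.cong refl)
      fix w assume "w \<in> BL D"
      have "chi w (z r) * (a w * b w) = (\<Sum>q\<in>BL D. \<Sum>q'\<in>BL D. chi w (z r) * (F q * chi w q * (G q' * chi w q')))"
        by (simp only: a_def b_def sum_product) (simp only: sum_distrib_left)
      also have "\<dots> = (\<Sum>q\<in>BL D. \<Sum>q'\<in>BL D. F q * G q' * (chi w (xorl q (z r)) * chi w q'))"
        using z[OF r] by (intro sum.cong refl) (auto simp: chi_xorl BL_def)
      finally show "chi w (z r) * (a w * b w) = (\<Sum>q\<in>BL D. \<Sum>q'\<in>BL D. F q * G q' * (chi w (xorl q (z r)) * chi w q'))" .
    qed
    also have "\<dots> = (\<Sum>q\<in>BL D. \<Sum>q'\<in>BL D. F q * G q' * (\<Sum>w\<in>BL D. chi w (xorl q (z r)) * chi w q'))"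
      by (simp only: sum_distrib_left, subst sum.swap, intro sum.cong refl sum.swap)
    also have "\<dots> = (\<Sum>q\<in>BL D. \<Sum>q'\<in>BL D. if q' = xorl q (z r) then 2 ^ D * (F q * G (xorl q (z r))) else 0)"
      using x r by (intro sum.cong refl) (auto simp: chi_orthogonal)
    also have "\<dots> = (\<Sum>q\<in>BL D. 2 ^ D * (F q * G (xorl q (z r))))"
      using x r by (intro sum.cong refl) (auto simp: sum.delta)
    finally show ?thesis by (simp add: sum_distrib_left)
  qed
  have "(\<Sum>w\<in>BL D. l w * (a w * b w)) = (\<Sum>w\<in>BL D. \<Sum>r\<in>BL M. \<sigma> r / 2 ^ M * (chi w (z r) * (a w * b w)))"
    unfolding l_def avg_def by (simp add: sum_divide_distrib sum_distrib_right mult.assoc)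
  also have "\<dots> = (\<Sum>r\<in>BL M. \<sigma> r / 2 ^ M * (\<Sum>w\<in>BL D. chi w (z r) * (a w * b w)))"
    by (subst sum.swap) (simp add: sum_distrib_left)
  also have "\<dots> = (\<Sum>r\<in>BL M. \<sigma> r / 2 ^ M * (2 ^ D * (\<Sum>q\<in>BL D. F q * G (xorl q (z r)))))"
    using inner by (intro sum.cong) auto
  also have "\<dots> = 2 ^ D * (\<Sum>q\<in>BL D. avg M (\<lambda>r. \<sigma> r * F q * G (xorl q (z r))))"
    unfolding avg_def by (subst sum_divide_distrib, subst sum.swap) (simp add: sum_distrib_left algebra_simps)
  also have "\<dots> = 4 ^ D * avg D (\<lambda>q. avg M (\<lambda>r. \<sigma> r * F q * G (xorl q (z r))))"
    unfolding avg_def[of D] by (simp add: power_mult_distrib[symmetric] field_simps)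
  finally have main: "4 ^ D * avg D (\<lambda>q. avg M (\<lambda>r. \<sigma> r * F q * G (xorl q (z r)))) = (\<Sum>w\<in>BL D. l w * (a w * b w))" ..
  have L: "0 \<le> \<Lambda>" using ev[of "replicate D False"] by (auto simp: BL_def)
  have "\<bar>\<Sum>w\<in>BL D. l w * (a w * b w)\<bar> \<le> (\<Sum>w\<in>BL D. \<bar>l w * (a w * b w)\<bar>)" by (rule sum_abs)
  also have "\<dots> \<le> (\<Sum>w\<in>BL D. \<Lambda> * (((a w)\<^sup>2 + (b w)\<^sup>2) / 2))"
  proof (rule sum_mono)
    fix w assume w: "w \<in> BL D"
    \<comment> \<open>The arithmetic-geometric inequality does the work of Cauchy-Schwarz, since
      Parseval gives both sums of squares the same value.\<close>
    have "\<bar>a w * b w\<bar> \<le> ((a w)\<^sup>2 + (b w)\<^sup>2) / 2"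
      using sum_squares_bound[of "\<bar>a w\<bar>" "\<bar>b w\<bar>"] by (simp add: abs_mult)
    then show "\<bar>l w * (a w * b w)\<bar> \<le> \<Lambda> * (((a w)\<^sup>2 + (b w)\<^sup>2) / 2)"
      unfolding abs_mult[of "l w"] using ev[OF w] L by (intro mult_mono) (auto simp: l_def)
  qed
  also have "\<dots> = \<Lambda> * (((\<Sum>w\<in>BL D. (a w)\<^sup>2) + (\<Sum>w\<in>BL D. (b w)\<^sup>2)) / 2)"
    by (simp add: sum_distrib_left[symmetric] sum.distrib sum_divide_distrib[symmetric])
  also have "\<dots> = \<Lambda> * 4 ^ D"
    using parseval[of D F] parseval[of D G] F G unfolding a_def b_def by simp
  finally have "\<bar>4 ^ D * avg D (\<lambda>q. avg M (\<lambda>r. \<sigma> r * F q * G (xorl q (z r))))\<bar> \<le> \<Lambda> * 4 ^ D"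
    unfolding main .
  then show ?thesis by (simp add: abs_mult mult.commute)
qed

section \<open>Tensor powers of bilinear forms\<close>

definition Tup :: "nat \<Rightarrow> nat \<Rightarrow> nat list set" where
  "Tup N d = {c. length c = d \<and> (\<forall>v\<in>set c. v < N)}"

lemma finite_Tup [simp]: "finite (Tup N d)"
proof -
  have "Tup N d = {c. set c \<subseteq> {..<N} \<and> length c = d}" by (auto simp: Tup_def)
  then show ?thesis using finite_lists_length_eq[of "{..<N}" d] by simp
qed

lemma Tup_0 [simp]: "Tup N 0 = {[]}" by (auto simp: Tup_def)

lemma append_Tup [simp]: "length a = k \<Longrightarrow> a @ b \<in> Tup N (k + l) \<longleftrightarrow> a \<in> Tup N k \<and> b \<in> Tup N l"
  by (auto simp: Tup_def)

lemma prod_Tup_append: "(\<Prod>c\<in>Tup N (k + l). f c) = (\<Prod>a\<in>Tup N k. \<Prod>b\<in>Tup N l. f (a @ b))"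
proof -
  have b: "bij_betw (\<lambda>(u, v). u @ v) (Tup N k \<times> Tup N l) (Tup N (k + l))"
    by (rule bij_betwI[where g = "\<lambda>r. (take k r, drop k r)"]) (auto simp: Tup_def dest: in_set_takeD in_set_dropD)
  have "(\<Prod>c\<in>Tup N (k + l). f c) = (\<Prod>x\<in>Tup N k \<times> Tup N l. f (case x of (u, v) \<Rightarrow> u @ v))"
    by (rule prod.reindex_bij_betw[OF b, symmetric])
  then show ?thesis by (simp add: prod.cartesian_product case_prod_unfold)
qed

lemma tidx_inj: "a \<in> Tup N d \<Longrightarrow> b \<in> Tup N d \<Longrightarrow> tidx N a = tidx N b \<Longrightarrow> a = b"
proof (induction d arbitrary: a b)
  case (Suc d)
  then obtain v a' w b' where ab: "a = v # a'" "b = w # b'" by (cases a; cases b) (auto simp: Tup_def)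
  have l: "length a' = d" "length b' = d" "a' \<in> Tup N d" "b' \<in> Tup N d" using Suc.prems ab by (auto simp: Tup_def)
  have lt: "tidx N a' < N ^ d" "tidx N b' < N ^ d" using l tidx_less[of a' N] tidx_less[of b' N] by (auto simp: Tup_def)
  have e: "v * N ^ d + tidx N a' = w * N ^ d + tidx N b'" using Suc.prems ab l by simp
  then have "(v * N ^ d + tidx N a') div N ^ d = (w * N ^ d + tidx N b') div N ^ d" by simp
  moreover have "N ^ d \<noteq> 0" using lt(1) by (metis less_nat_zero_code)
  ultimately have "v = w" using lt by simp
  then show ?case using e Suc.IH[OF l(3,4)] ab by simp
qed (auto simp: Tup_def)

lemma tidx_Tup: "c \<in> Tup N d \<Longrightarrow> tidx N c < N ^ d"
  using tidx_less[of c N] by (auto simp: Tup_def)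

lemma zeros_Tup: "0 < N \<Longrightarrow> replicate d 0 \<in> Tup N d"
  by (auto simp: Tup_def)

lemma prod_sg: "(\<Prod>x\<in>S. sg (P x)) = 1 \<or> (\<Prod>x\<in>S. sg (P x)) = -1"
  by (induction S rule: infinite_finite_induct) (auto simp: sg_def)

lemma prod_pm: "(\<And>x. x \<in> S \<Longrightarrow> f x = 1 \<or> f x = (-1::real)) \<Longrightarrow> prod f S = 1 \<or> prod f S = -1"
proof (induction S rule: infinite_finite_induct)
  case (insert x F)
  then have "f x = 1 \<or> f x = -1" "prod f F = 1 \<or> prod f F = -1" by simp_all
  then show ?case using insert.hyps by auto
qed auto

text \<open>A tableau variable has an index in \<open>Tup N 3\<close>, so random vectors have length
  \<open>N ^ 3\<close>; each is read off a coin block of length \<open>L\<close>. The list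
  \<open>\<E> \<kappa>\<close> contains the matrix entries whose sum equation
  \<open>\<kappa>\<close> sets to 0.\<close>

locale tensor =
  fixes N L :: nat and \<E> :: "nat list \<Rightarrow> nat list list"
  assumes N: "0 < N" and L: "N ^ 3 \<le> L"
begin

abbreviation "I3 \<equiv> Tup N 3"

definition selects :: "bool list \<Rightarrow> nat list \<Rightarrow> bool" where
  "selects u i = u ! tidx N i"

lemma tidx_L: "i \<in> I3 \<Longrightarrow> tidx N i < L"
  using tidx_Tup[of i N 3] L by simp

lemma avg_selects:
  assumes "\<And>i. i \<in> I3 \<Longrightarrow> s i = 1 \<or> s i = -1"
  shows "avg L (\<lambda>u. \<Prod>i\<in>I3. if selects u i then s i else 1) = of_bool (\<forall>i\<in>I3. s i = 1)"
  unfolding selects_def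
  by (rule avg_char) (use assms tidx_L in \<open>auto intro!: inj_onI tidx_inj\<close>)

text \<open>This is the sign of the value at \<open>(u, v)\<close> of the bilinear form with matrix
  \<open>X\<close> over the field of two elements; sums of bits turn into products of signs
  throughout.\<close>

definition form :: "(nat list \<Rightarrow> bool) \<Rightarrow> bool list \<Rightarrow> bool list \<Rightarrow> real" where
  "form X u v = (\<Prod>i\<in>I3. \<Prod>i'\<in>I3. sg (X (i @ i') \<and> selects u i \<and> selects v i'))"

lemma form_row: "form X u v = (\<Prod>i\<in>I3. if selects u i then (\<Prod>i'\<in>I3. sg (X (i @ i') \<and> selects v i')) else 1)"
  unfolding form_def by (intro prod.cong) (auto simp: sg_def)

lemma form_col: "form X u v = (\<Prod>i'\<in>I3. if selects v i' then (\<Prod>i\<in>I3. sg (X (i @ i') \<and> selects u i)) else 1)"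
  unfolding form_def by (subst prod.swap, intro prod.cong) (auto simp: sg_def)

lemma form_pm: "form X u v = 1 \<or> form X u v = -1"
  unfolding form_row by (intro prod_pm) (auto intro!: prod_pm simp: sg_def)

text \<open>
  A bilinear form which does not have rank at most one is nonzero on at least three eighths of all
  pairs of vectors: two different nonzero columns are independent.
\<close>

lemma form_avg_le:
  assumes X0: "X (replicate 3 0 @ replicate 3 0)"
    and nr: "\<not> (\<exists>x y. \<forall>i\<in>I3. \<forall>i'\<in>I3. X (i @ i') \<longleftrightarrow> x i \<and> y i')"
  shows "avg L (\<lambda>u. avg L (\<lambda>v. form X u v)) \<le> 1 / 4"
proof -
  let ?z = "replicate 3 (0::nat)"
  have z: "?z \<in> I3" using N by (rule zeros_Tup)
  define col where "col u i' = (\<Prod>i\<in>I3. sg (X (i @ i') \<and> selects u i))" for u i'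
  have col_alt: "col u i' = (\<Prod>i\<in>I3. if selects u i then sg (X (i @ i')) else 1)" for u i'
    unfolding col_def by (intro prod.cong) (auto simp: sg_def)
  have pm: "col u i' = 1 \<or> col u i' = -1" for u i' unfolding col_def by (rule prod_sg)
  \<comment> \<open>If every nonzero column equalled column 0, then \<open>X\<close> would be the
    product of this column and the indicator of the nonzero columns, hence of rank one.\<close>
  obtain j where j: "j \<in> I3" "\<exists>i\<in>I3. X (i @ j)" "\<exists>i\<in>I3. X (i @ j) \<noteq> X (i @ ?z)"
  proof -
    have "\<not> (\<forall>i\<in>I3. \<forall>i'\<in>I3. X (i @ i') \<longleftrightarrow> X (i @ ?z) \<and> (\<exists>k\<in>I3. X (k @ i')))"
      by (rule notI, rule notE[OF nr], rule exI[of _ "\<lambda>i. X (i @ ?z)"], rule exI[of _ "\<lambda>i'. \<exists>k\<in>I3. X (k @ i')"])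
    then obtain i i' where i: "i \<in> I3" "i' \<in> I3" "X (i @ i') \<noteq> (X (i @ ?z) \<and> (\<exists>k\<in>I3. X (k @ i')))" by blast
    then have "\<exists>k\<in>I3. X (k @ i')" "X (i @ i') \<noteq> X (i @ ?z)" by blast+
    with i(1,2) that[of i'] show ?thesis by blast
  qed
  have v: "avg L (\<lambda>v. form X u v) = of_bool (\<forall>i'\<in>I3. col u i' = 1)" for u
    unfolding form_col col_def[symmetric] by (rule avg_selects) (rule pm)
  \<comment> \<open>The average over \<open>v\<close> indicates that all columns are orthogonal to
    \<open>u\<close>. The polynomial on the right indicates the same for columns 0 and
    \<open>j\<close> alone, two independent conditions of probability 1/2 each.\<close>
  have "avg L (\<lambda>u. avg L (\<lambda>v. form X u v)) \<le> avg L (\<lambda>u. (1 + col u ?z) * (1 + col u j) / 4)"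
  proof (rule avg_mono)
    fix u
    show "avg L (\<lambda>v. form X u v) \<le> (1 + col u ?z) * (1 + col u j) / 4"
      unfolding v using pm[of u ?z] pm[of u j] z j(1) by (auto simp: of_bool_def)
  qed
  also have "\<dots> = avg L (\<lambda>u. (1 / 4) * (1 + col u ?z + col u j + col u ?z * col u j))"
    by (intro avg_cong) (simp add: algebra_simps)
  also have "\<dots> = (1 / 4) * (1 + avg L (\<lambda>u. col u ?z) + avg L (\<lambda>u. col u j) + avg L (\<lambda>u. col u ?z * col u j))"
    by (simp only: avg_cmult avg_add avg_const)
  also have "avg L (\<lambda>u. col u ?z) = 0"
    unfolding col_alt using z X0 by (subst avg_selects) (auto simp: sg_def)
  also have "avg L (\<lambda>u. col u j) = 0"
    unfolding col_alt using j(2) by (subst avg_selects) (auto simp: sg_def)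
  also have "avg L (\<lambda>u. col u ?z * col u j) = avg L (\<lambda>u. \<Prod>i\<in>I3. if selects u i then sg (X (i @ ?z) \<noteq> X (i @ j)) else 1)"
    unfolding col_alt prod.distrib[symmetric] by (intro avg_cong prod.cong) (auto simp: sg_xor)
  also have "\<dots> = 0"
    using j(3) by (subst avg_selects) (auto simp: sg_def)
  finally show ?thesis by simp
qed

text \<open>\<open>U\<close> holds \<open>2 * m\<close> vectors in blocks of length
  \<open>L\<close>. This is the coordinate at \<open>c\<close> of their tensor product, with
  \<open>c\<close> cut into triples.\<close>

definition soft :: "nat \<Rightarrow> bool list \<Rightarrow> nat list \<Rightarrow> bool" where
  "soft m U c \<longleftrightarrow> (\<forall>j<2 * m. U ! (j * L + tidx N (take 3 (drop (3 * j) c))))"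

definition W :: "nat \<Rightarrow> (nat list \<Rightarrow> bool) \<Rightarrow> bool list \<Rightarrow> real" where
  "W m Z U = (\<Prod>c\<in>Tup N (6 * m). sg (Z c \<and> soft m U c))"

definition A :: "nat \<Rightarrow> (nat list \<Rightarrow> bool) \<Rightarrow> real" where
  "A m Z = avg (2 * m * L) (W m Z)"

text \<open>The first tensor factor of \<open>Z\<close> is evaluated at \<open>u\<close> and
  \<open>v\<close>, which leaves a tensor with one factor less; the sign -1 encodes the bit
  1.\<close>

definition contract :: "(nat list \<Rightarrow> bool) \<Rightarrow> bool list \<Rightarrow> bool list \<Rightarrow> nat list \<Rightarrow> bool" where
  "contract Z u v c \<longleftrightarrow> form (\<lambda>p. Z (p @ c)) u v = -1"

lemma sg_contract: "sg (contract Z u v c) = form (\<lambda>p. Z (p @ c)) u v"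
  using form_pm[of "\<lambda>p. Z (p @ c)" u v] by (auto simp: contract_def sg_def)

lemma soft_Suc:
  assumes "length u = L" "length v = L" "i \<in> I3" "i' \<in> I3"
  shows "soft (Suc m) (u @ v @ U) (i @ i' @ c) \<longleftrightarrow> selects u i \<and> selects v i' \<and> soft m U c"
proof -
  have li: "length i = 3" "length i' = 3" "tidx N i < L" "tidx N i' < L" using assms tidx_L by (auto simp: Tup_def)
  define P where "P j \<longleftrightarrow> (u @ v @ U) ! (j * L + tidx N (take 3 (drop (3 * j) (i @ i' @ c))))" for j
  have "soft (Suc m) (u @ v @ U) (i @ i' @ c) \<longleftrightarrow> (\<forall>j<Suc (Suc (2 * m)). P j)"
    unfolding soft_def P_def by simp
  also have "\<dots> \<longleftrightarrow> P 0 \<and> P (Suc 0) \<and> (\<forall>j<2 * m. P (Suc (Suc j)))"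
    by (auto simp: less_Suc_eq_0_disj)
  also have "P 0 \<longleftrightarrow> selects u i" using li assms by (simp add: P_def selects_def nth_append)
  also have "P (Suc 0) \<longleftrightarrow> selects v i'" using li assms by (simp add: P_def selects_def nth_append)
  also have "(\<forall>j<2 * m. P (Suc (Suc j))) \<longleftrightarrow> soft m U c"
  proof -
    have "P (Suc (Suc j)) \<longleftrightarrow> U ! (j * L + tidx N (take 3 (drop (3 * j) c)))" for j
    proof -
      have "drop (3 * Suc (Suc j)) (i @ i' @ c) = drop (3 * j) c" using li by simp
      moreover have "(u @ v @ U) ! (Suc (Suc j) * L + x) = U ! (j * L + x)" for x
        using assms by (simp add: nth_append)
      ultimately show ?thesis unfolding P_def by simp
    qed
    then show ?thesis by (simp add: soft_def)
  qed
  finally show ?thesis .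
qed

lemma prod_Tup_Suc: "(\<Prod>c\<in>Tup N (6 * Suc m). f c) = (\<Prod>i\<in>I3. \<Prod>i'\<in>I3. \<Prod>c\<in>Tup N (6 * m). f (i @ i' @ c))"
proof -
  have "6 * Suc m = 3 + (3 + 6 * m)" by simp
  then show ?thesis by (simp only: prod_Tup_append)
qed

lemma W_Suc:
  assumes "length u = L" "length v = L"
  shows "W (Suc m) Z (u @ v @ U) = W m (contract Z u v) U"
proof -
  have "W (Suc m) Z (u @ v @ U) = (\<Prod>i\<in>I3. \<Prod>i'\<in>I3. \<Prod>c\<in>Tup N (6 * m). sg ((Z (i @ i' @ c) \<and> selects u i \<and> selects v i') \<and> soft m U c))"
    unfolding W_def prod_Tup_Suc using assms by (intro prod.cong) (auto simp: soft_Suc)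
  also have "\<dots> = (\<Prod>i\<in>I3. \<Prod>c\<in>Tup N (6 * m). \<Prod>i'\<in>I3. sg ((Z (i @ i' @ c) \<and> selects u i \<and> selects v i') \<and> soft m U c))"
    by (intro prod.cong refl prod.swap)
  also have "\<dots> = (\<Prod>c\<in>Tup N (6 * m). \<Prod>i\<in>I3. \<Prod>i'\<in>I3. sg ((Z (i @ i' @ c) \<and> selects u i \<and> selects v i') \<and> soft m U c))"
    by (rule prod.swap)
  also have "\<dots> = (\<Prod>c\<in>Tup N (6 * m). if soft m U c then form (\<lambda>p. Z (p @ c)) u v else 1)"
    by (intro prod.cong) (auto simp: form_def)
  also have "\<dots> = W m (contract Z u v) U"
    unfolding W_def by (intro prod.cong) (auto simp: sg_contract[symmetric] sg_def)
  finally show ?thesis .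
qed

lemma A_Suc: "A (Suc m) Z = avg L (\<lambda>u. avg L (\<lambda>v. A m (contract Z u v)))"
proof -
  have "2 * Suc m * L = L + (L + 2 * m * L)" by simp
  then have "A (Suc m) Z = avg L (\<lambda>u. avg L (\<lambda>v. avg (2 * m * L) (\<lambda>U. W (Suc m) Z (u @ v @ U))))"
    unfolding A_def by (simp only: avg_split)
  also have "\<dots> = avg L (\<lambda>u. avg L (\<lambda>v. avg (2 * m * L) (W m (contract Z u v))))"
    by (intro avg_cong) (auto simp: BL_def W_Suc)
  finally show ?thesis by (simp add: A_def)
qed

lemma W_pm: "W m Z U = 1 \<or> W m Z U = -1"
  unfolding W_def by (rule prod_sg)

lemma A_le_1: "A m Z \<le> 1"
proof -
  have "A m Z \<le> avg (2 * m * L) (\<lambda>_. 1)" unfolding A_def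
  proof (intro avg_mono)
    show "W m Z U \<le> 1" for U using W_pm[of m Z U] by auto
  qed
  then show ?thesis by simp
qed

text \<open>With the other vectors fixed, the sign is a character of the first vector, so averaging
  over that vector gives 0 or 1. Nonnegativity is what allows the upper bound on \<open>A\<close> to
  be raised to the power \<open>t\<close>.\<close>

lemma A_nonneg: "0 \<le> A (Suc m) Z"
proof -
  have "2 * Suc m * L = L + (L + 2 * m * L)" by simp
  then have "A (Suc m) Z = avg L (\<lambda>u. avg L (\<lambda>v. avg (2 * m * L) (\<lambda>U. W (Suc m) Z (u @ v @ U))))"
    unfolding A_def by (simp only: avg_split)
  also have "\<dots> = avg L (\<lambda>v. avg (2 * m * L) (\<lambda>U. avg L (\<lambda>u. W (Suc m) Z (u @ v @ U))))"
    by (subst avg_swap, subst avg_swap[of L "2 * m * L"]) simp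
  also have "\<dots> \<ge> avg L (\<lambda>v. avg (2 * m * L) (\<lambda>U. 0))"
  proof (intro avg_mono)
    fix v U assume v: "v \<in> BL L"
    define s where "s i = (\<Prod>i'\<in>I3. \<Prod>c\<in>Tup N (6 * m). sg (Z (i @ i' @ c) \<and> selects v i' \<and> soft m U c))" for i
    have "avg L (\<lambda>u. W (Suc m) Z (u @ v @ U)) = avg L (\<lambda>u. \<Prod>i\<in>I3. if selects u i then s i else 1)"
      unfolding W_def prod_Tup_Suc s_def using v
      by (intro avg_cong prod.cong refl) (auto simp: soft_Suc BL_def sg_def intro!: prod.cong)
    also have "\<dots> = of_bool (\<forall>i\<in>I3. s i = 1)"
      by (rule avg_selects) (auto simp: s_def intro!: prod_pm prod_sg)
    finally show "0 \<le> avg L (\<lambda>u. W (Suc m) Z (u @ v @ U))" by simp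
  qed
  finally show ?thesis by simp
qed

text \<open>Each equation is imposed on each factor \<open>j\<close> for all values
  \<open>a\<close>, \<open>b\<close> of the coordinates before and after it, so that sums of slices
  inherit it.\<close>

definition feasible :: "nat \<Rightarrow> nat list set \<Rightarrow> (nat list \<Rightarrow> bool) \<Rightarrow> bool" where
  "feasible m K Z \<longleftrightarrow> (\<forall>\<kappa>\<in>K. \<forall>j<m. \<forall>a\<in>Tup N (6 * j). \<forall>b\<in>Tup N (6 * (m - 1 - j)).
     prod_list (map (\<lambda>p. sg (Z (a @ p @ b))) (\<E> \<kappa>)) = 1)"

text \<open>The contraction is the sum of the slices of \<open>Z\<close> selected by
  \<open>u\<close> and \<open>v\<close>. Each slice satisfies the equation, which sits in factor
  \<open>Suc j\<close> of \<open>Z\<close>, and signs of sums multiply.\<close>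

lemma feasible_contract:
  assumes "feasible (Suc m) K Z"
  shows "feasible m K (contract Z u v)"
  unfolding feasible_def
proof (intro ballI allI impI)
  fix \<kappa> j a b assume h: "\<kappa> \<in> K" "j < m" "a \<in> Tup N (6 * j)" "b \<in> Tup N (6 * (m - 1 - j))"
  have "prod_list (map (\<lambda>p. sg (contract Z u v (a @ p @ b))) ps) =
    (\<Prod>i\<in>I3. \<Prod>i'\<in>I3. if selects u i \<and> selects v i' then prod_list (map (\<lambda>p. sg (Z (i @ i' @ a @ p @ b))) ps) else 1)" for ps
  proof (induction ps)
    case (Cons p ps)
    have "sg (contract Z u v (a @ p @ b)) = (\<Prod>i\<in>I3. \<Prod>i'\<in>I3. if selects u i \<and> selects v i' then sg (Z (i @ i' @ a @ p @ b)) else 1)"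
      unfolding sg_contract form_def by (intro prod.cong) (auto simp: sg_def)
    then show ?case using Cons by (auto simp: prod.distrib[symmetric] intro!: prod.cong)
  next
    case Nil
    have "(\<Prod>i\<in>I3. \<Prod>i'\<in>I3. if selects u i \<and> selects v i' then prod_list (map (\<lambda>p. sg (Z (i @ i' @ a @ p @ b))) []) else 1) = 1"
      by (intro prod.neutral ballI) simp
    then show ?case by simp
  qed
  also have "(\<Prod>i\<in>I3. \<Prod>i'\<in>I3. if selects u i \<and> selects v i' then prod_list (map (\<lambda>p. sg (Z (i @ i' @ a @ p @ b))) (\<E> \<kappa>)) else 1) = 1"
  proof (intro prod.neutral ballI)
    fix i i' assume i: "i \<in> I3" "i' \<in> I3"
    have "i @ i' @ a \<in> Tup N (6 * Suc j)" using i h by (auto simp: Tup_def)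
    moreover have "b \<in> Tup N (6 * (Suc m - 1 - Suc j))" using h by simp
    ultimately have "prod_list (map (\<lambda>p. sg (Z ((i @ i' @ a) @ p @ b))) (\<E> \<kappa>)) = 1"
      using assms h unfolding feasible_def by (meson Suc_mono)
    then show "(if selects u i \<and> selects v i' then prod_list (map (\<lambda>p. sg (Z (i @ i' @ a @ p @ b))) (\<E> \<kappa>)) else 1) = 1"
      by simp
  qed
  finally show "prod_list (map (\<lambda>p. sg (contract Z u v (a @ p @ b))) (\<E> \<kappa>)) = 1" .
qed

text \<open>Index 0 stands for the constant 1; requiring the entry there to be 1 excludes the zero
  matrix and makes both vectors of a rank-one \<open>X\<close> equal 1 at 0.\<close>

definition no_rank_one :: "nat list set \<Rightarrow> bool" where
  "no_rank_one K \<longleftrightarrow> (\<forall>X x y. X (replicate 3 0 @ replicate 3 0) \<longrightarrow>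
     (\<forall>\<kappa>\<in>K. prod_list (map (\<lambda>p. sg (X p)) (\<E> \<kappa>)) = 1) \<longrightarrow>
     \<not> (\<forall>i\<in>I3. \<forall>i'\<in>I3. X (i @ i') \<longleftrightarrow> x i \<and> y i'))"

text \<open>The slice of \<open>Z\<close> with all later coordinates 0 satisfies the equations, so
  it is not of rank one. With probability at least 3/8 the contraction therefore has a 1 at
  coordinate 0, and the induction hypothesis applies to it; in the other case \<open>A\<close> is at
  most 1.\<close>

lemma A_le:
  assumes "no_rank_one K" "feasible m K Z" "Z (replicate (6 * m) 0)"
  shows "A m Z \<le> 1 - 2 * (3 / 8) ^ m"
  using assms(2,3)
proof (induction m arbitrary: Z)
  case 0
  then show ?case by (simp add: A_def W_def soft_def avg_def BL_def sg_def)
next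
  case (Suc m)
  let ?o = "replicate (6 * m) (0::nat)"
  define X where "X p = Z (p @ ?o)" for p
  have X0: "X (replicate 3 0 @ replicate 3 0)"
    using Suc.prems(2) by (simp add: X_def replicate_add[symmetric] append.assoc[symmetric] del: append_assoc)
  have o: "?o \<in> Tup N (6 * m)" using N by (rule zeros_Tup)
  have "prod_list (map (\<lambda>p. sg (X p)) (\<E> \<kappa>)) = 1" if "\<kappa> \<in> K" for \<kappa>
    using Suc.prems(1) that o unfolding feasible_def X_def by (auto dest!: bspec[of K _ \<kappa>] spec[of _ 0])
  then have "\<not> (\<exists>x y. \<forall>i\<in>I3. \<forall>i'\<in>I3. X (i @ i') \<longleftrightarrow> x i \<and> y i')"
    using assms(1) X0 unfolding no_rank_one_def by blast
  from form_avg_le[OF X0 this] have f: "avg L (\<lambda>u. avg L (\<lambda>v. form X u v)) \<le> 1 / 4" .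
  \<comment> \<open>The difference \<open>1 - form X u v\<close> is 2 when the contraction has a 1
    at coordinate 0 and is 0 otherwise, so one expression covers both bounds.\<close>
  have "A (Suc m) Z \<le> avg L (\<lambda>u. avg L (\<lambda>v. 1 - (3 / 8) ^ m * (1 - form X u v)))"
    unfolding A_Suc
  proof (intro avg_mono)
    fix u v
    have "form X u v = sg (contract Z u v ?o)" unfolding sg_contract X_def ..
    moreover have "A m (contract Z u v) \<le> 1 - 2 * (3 / 8) ^ m" if "contract Z u v ?o"
      using that Suc.prems by (intro Suc.IH feasible_contract)
    ultimately show "A m (contract Z u v) \<le> 1 - (3 / 8) ^ m * (1 - form X u v)"
      using A_le_1[of m "contract Z u v"] by (auto simp: sg_def)
  qed
  also have "\<dots> = 1 - (3 / 8) ^ m * (1 - avg L (\<lambda>u. avg L (\<lambda>v. form X u v)))"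
    by (simp only: avg_diff avg_cmult avg_const)
  also have "\<dots> \<le> 1 - (3 / 8) ^ m * (3 / 4)"
    using f by (intro diff_left_mono mult_left_mono) auto
  finally show ?case by simp
qed

definition honest :: "(nat list \<Rightarrow> bool) \<Rightarrow> nat \<Rightarrow> nat list \<Rightarrow> bool" where
  "honest x m c \<longleftrightarrow> (\<forall>j<2 * m. x (take 3 (drop (3 * j) c)))"

lemma honest_Suc:
  assumes "i \<in> I3" "i' \<in> I3"
  shows "honest x (Suc m) (i @ i' @ c) \<longleftrightarrow> x i \<and> x i' \<and> honest x m c"
proof -
  have li: "length i = 3" "length i' = 3" using assms by (auto simp: Tup_def)
  define P where "P j \<longleftrightarrow> x (take 3 (drop (3 * j) (i @ i' @ c)))" for j
  have "honest x (Suc m) (i @ i' @ c) \<longleftrightarrow> (\<forall>j<Suc (Suc (2 * m)). P j)"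
    unfolding honest_def P_def by simp
  also have "\<dots> \<longleftrightarrow> P 0 \<and> P (Suc 0) \<and> (\<forall>j<2 * m. P (Suc (Suc j)))"
    by (auto simp: less_Suc_eq_0_disj)
  finally show ?thesis using li by (simp add: P_def honest_def)
qed

lemma A_False: "(\<And>c. c \<in> Tup N (6 * m) \<Longrightarrow> \<not> Z c) \<Longrightarrow> A m Z = 1"
  unfolding A_def W_def by (subst avg_cong[where g = "\<lambda>_. 1"]) (auto intro!: prod.neutral simp: sg_def)

lemma A_cong: "(\<And>c. c \<in> Tup N (6 * m) \<Longrightarrow> Z c = Z' c) \<Longrightarrow> A m Z = A m Z'"
  unfolding A_def W_def by (intro avg_cong prod.cong) auto

text \<open>Contracting a power of \<open>x\<close> gives the next lower power if \<open>u\<close>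
  and \<open>v\<close> both have inner product 1 with \<open>x\<close>, and zero otherwise. The
  former has probability 1/4 because \<open>x\<close> is not zero.\<close>

lemma A_honest:
  assumes x0: "x (replicate 3 0)"
  shows "A m (honest x m) = 1 - 2 * (1 / 4) ^ m"
proof (induction m)
  case 0
  then show ?case by (simp add: A_def W_def soft_def honest_def avg_def BL_def sg_def)
next
  case (Suc m)
  define h where "h u = (\<Prod>i\<in>I3. if selects u i then sg (x i) else 1)" for u
  have h_pm: "h u = 1 \<or> h u = -1" for u unfolding h_def by (intro prod_pm) (auto simp: sg_def)
  have h0: "avg L h = 0"
    unfolding h_def using x0 zeros_Tup[OF N, of 3] by (subst avg_selects) (auto simp: sg_def)
  have form: "form (\<lambda>p. honest x (Suc m) (p @ c)) u v = (if honest x m c \<and> h u = -1 \<and> h v = -1 then -1 else 1)" for u v c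
  proof (cases "honest x m c")
    case False
    then show ?thesis unfolding form_def by (simp add: prod.neutral honest_Suc)
  next
    case True
    have col: "(\<Prod>i\<in>I3. sg (honest x (Suc m) ((i @ i') @ c) \<and> selects u i)) = (if x i' then h u else 1)"
      if "i' \<in> I3" for i'
      using True that unfolding h_def by (auto simp: honest_Suc sg_def intro!: prod.cong prod.neutral)
    have "form (\<lambda>p. honest x (Suc m) (p @ c)) u v = (\<Prod>i'\<in>I3. if selects v i' then (if x i' then h u else 1) else 1)"
      unfolding form_col using col by (intro prod.cong) auto
    also have "\<dots> = (if h u = -1 then h v else 1)"
      using h_pm[of u] unfolding h_def[of v] by (auto simp: sg_def intro!: prod.cong prod.neutral)
    also have "\<dots> = (if honest x m c \<and> h u = -1 \<and> h v = -1 then -1 else 1)"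
      using True h_pm[of v] by auto
    finally show ?thesis .
  qed
  have "A m (contract (honest x (Suc m)) u v) = 1 - (1 - h u) * (1 - h v) / 2 * (1 / 4) ^ m" for u v
  proof (cases "h u = -1 \<and> h v = -1")
    case True
    then have "A m (contract (honest x (Suc m)) u v) = A m (honest x m)"
      by (intro A_cong) (auto simp: contract_def form)
    then show ?thesis using True Suc by simp
  next
    case False
    then have "A m (contract (honest x (Suc m)) u v) = 1"
      by (intro A_False) (auto simp: contract_def form)
    then show ?thesis using False h_pm[of u] h_pm[of v] by auto
  qed
  then have "A (Suc m) (honest x (Suc m)) = avg L (\<lambda>u. avg L (\<lambda>v. 1 - ((1 - h u) * ((1 / 4) ^ m / 2)) * (1 - h v)))"
    unfolding A_Suc by (intro avg_cong) (simp add: field_simps)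
  also have "\<dots> = 1 - (1 / 4) ^ m / 2"
    by (simp only: avg_diff avg_cmult avg_mult_const avg_const h0) simp
  finally show ?case by simp
qed

text \<open>In a power of \<open>x\<close> the factors other than \<open>j\<close> contribute one
  common bit: either it annihilates all terms, or the equation for the product of \<open>x\<close>
  with itself remains.\<close>

lemma feasible_honest:
  assumes x: "\<And>\<kappa>. \<kappa> \<in> K \<Longrightarrow> prod_list (map (\<lambda>p. sg (x (take 3 p) \<and> x (drop 3 p))) (\<E> \<kappa>)) = 1"
    and E: "\<And>\<kappa> p. \<kappa> \<in> K \<Longrightarrow> p \<in> set (\<E> \<kappa>) \<Longrightarrow> p \<in> Tup N 6"
  shows "feasible m K (honest x m)"
proof -
  have split: "honest x (j + Suc k) (a @ p @ b) \<longleftrightarrow> honest x j a \<and> (x (take 3 p) \<and> x (drop 3 p)) \<and> honest x k b"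
    if "a \<in> Tup N (6 * j)" "p \<in> Tup N 6" for j k a p b
    using that(1)
  proof (induction j arbitrary: a)
    case 0
    have "take 3 p \<in> I3" "drop 3 p \<in> I3" using that(2) by (auto simp: Tup_def dest: in_set_takeD in_set_dropD)
    from honest_Suc[OF this, of x k b] 0 show ?case by (simp add: honest_def append.assoc[symmetric] del: append_assoc)
  next
    case (Suc j)
    define i i' a' where "i = take 3 a" and "i' = take 3 (drop 3 a)" and "a' = drop 6 a"
    have a: "a = i @ i' @ a'"
    proof -
      have "drop 6 a = drop 3 (drop 3 a)" by simp
      then show ?thesis unfolding i_def i'_def a'_def by (simp only: append_take_drop_id)
    qed
    have i: "i \<in> I3" "i' \<in> I3" "a' \<in> Tup N (6 * j)" using Suc.prems
      unfolding i_def i'_def a'_def by (auto simp: Tup_def dest!: in_set_takeD in_set_dropD)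
    have "honest x (Suc j + Suc k) (a @ p @ b) = honest x (Suc (j + Suc k)) (i @ i' @ (a' @ p @ b))" by (simp add: a)
    then show ?case unfolding a using honest_Suc[OF i(1,2)] Suc.IH[OF i(3)] by simp
  qed
  show ?thesis unfolding feasible_def
  proof (intro ballI allI impI)
    fix \<kappa> j a b assume h: "\<kappa> \<in> K" "j < m" "a \<in> Tup N (6 * j)" "b \<in> Tup N (6 * (m - 1 - j))"
    define k where "k = m - 1 - j"
    have m: "m = j + Suc k" using h by (simp add: k_def)
    have "prod_list (map (\<lambda>p. sg (honest x m (a @ p @ b))) ps) =
      (if honest x j a \<and> honest x k b then prod_list (map (\<lambda>p. sg (x (take 3 p) \<and> x (drop 3 p))) ps) else 1)"
      if "set ps \<subseteq> Tup N 6" for ps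
      using that
    proof (induction ps)
      case (Cons p ps)
      have "honest x m (a @ p @ b) \<longleftrightarrow> honest x j a \<and> (x (take 3 p) \<and> x (drop 3 p)) \<and> honest x k b"
        using split[OF h(3), of p k b] Cons.prems by (simp add: m)
      then show ?case using Cons by (auto simp: sg_def)
    qed simp
    then show "prod_list (map (\<lambda>p. sg (honest x m (a @ p @ b))) (\<E> \<kappa>)) = 1"
      using x[OF h(1)] E[OF h(1)] by (auto simp: subset_iff)
  qed
qed

end

section \<open>The shift of the verifier and its eigenvalues\<close>

lemma char_flip:
  assumes "finite S" "inj_on pos S" "k \<in> S" "s k = (-1::real)" "pos k < length r"
  shows "(\<Prod>i\<in>S. if r[pos k := \<not> r ! pos k] ! pos i then s i else 1) = - (\<Prod>i\<in>S. if r ! pos i then s i else 1)"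
proof -
  have "(r[pos k := \<not> r ! pos k]) ! pos i = r ! pos i" if "i \<in> S - {k}" for i
    using that assms(2,3) by (subst nth_list_update_neq) (auto simp: inj_on_def)
  then have "(\<Prod>i\<in>S - {k}. if r[pos k := \<not> r ! pos k] ! pos i then s i else 1) =
      (\<Prod>i\<in>S - {k}. if r ! pos i then s i else 1)" by (intro prod.cong) auto
  then show ?thesis using assms by (simp add: prod.remove[of S k])
qed

text \<open>The order is that of nested loops, hence of the emitted bits, and it agrees with
  \<open>tidx\<close>. This is what identifies question strings with functions on tuples.\<close>

fun tups :: "nat \<Rightarrow> nat \<Rightarrow> nat list list" where
  "tups N 0 = [[]]"
| "tups N (Suc d) = concat (map (\<lambda>v. map ((#) v) (tups N d)) [0..<N])"

lemma set_tups: "set (tups N d) = Tup N d"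
proof (induction d)
  case (Suc d)
  then show ?case by (auto simp: Tup_def length_Suc_conv image_iff)
qed simp

lemma concat_map_upt_blocks: "concat (map (\<lambda>v. [v * M..<v * M + M]) [0..<N]) = [0..<N * M]"
proof (induction N)
  case (Suc N)
  then show ?case using upt_add_eq_append[of 0 "N * M" M] by (simp add: add.commute)
qed simp

lemma map_tidx_tups: "map (tidx N) (tups N d) = [0..<N ^ d]"
proof (induction d)
  case (Suc d)
  have *: "map (tidx N) (map ((#) v) (tups N d)) = [v * N ^ d..<v * N ^ d + N ^ d]" for v
  proof -
    have "map (tidx N) (map ((#) v) (tups N d)) = map (\<lambda>c. v * N ^ d + tidx N c) (tups N d)"
      using set_tups[of N d] by (auto simp: Tup_def)
    also have "\<dots> = map (\<lambda>i. v * N ^ d + i) (map (tidx N) (tups N d))" by simp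
    also have "\<dots> = [v * N ^ d..<v * N ^ d + N ^ d]" unfolding Suc
      using map_add_upt[of "v * N ^ d" "N ^ d"] by (simp add: add.commute)
    finally show ?thesis .
  qed
  have "map (tidx N) (tups N (Suc d)) = concat (map (\<lambda>v. map (tidx N) (map ((#) v) (tups N d))) [0..<N])"
    by (simp add: map_concat o_def)
  then show ?case unfolding * by (simp add: concat_map_upt_blocks)
qed simp

lemma length_tups: "length (tups N d) = N ^ d"
  using map_tidx_tups[of N d] by (metis length_map length_upt minus_nat.diff_0)

lemma tidx_nth_tups: "i < N ^ d \<Longrightarrow> tidx N (tups N d ! i) = i"
  using map_tidx_tups[of N d] length_tups[of N d] by (metis add_0 nth_map nth_upt)

lemma nth_tups: "c \<in> Tup N d \<Longrightarrow> tups N d ! tidx N c = c"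
  using tidx_Tup[of c N d] tidx_nth_tups[of "tidx N c" N d] length_tups[of N d] set_tups[of N d]
  by (intro tidx_inj[of _ N d]) (metis nth_mem, auto)

lemma bij_tidx: "bij_betw (tidx N) (Tup N d) {..<N ^ d}"
proof (rule bij_betwI[where g = "\<lambda>i. tups N d ! i"])
  show "(\<lambda>i. tups N d ! i) \<in> {..<N ^ d} \<rightarrow> Tup N d"
    using length_tups[of N d] set_tups[of N d] nth_mem by fastforce
qed (auto simp: tidx_Tup tidx_nth_tups nth_tups)

text \<open>The bound \<open>Nt\<close> counts coin blocks: two for \<open>b\<close> and the first
  question, \<open>m\<close> for the coefficients of equations, and \<open>2 * m\<close> for each of
  the \<open>t\<close> random products. The blocks share one length because the machine reads coins
  from tables of equal size.\<close>

locale game = tensor N "N ^ (6 * m)" \<E> for N m \<E> +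
  fixes t :: nat
  assumes m: "1 \<le> m" and Nt: "2 + m + t * (2 * m) \<le> N"
    and \<E>: "\<And>\<kappa> p. \<kappa> \<in> I3 \<Longrightarrow> p \<in> set (\<E> \<kappa>) \<Longrightarrow> p \<in> Tup N 6"
begin

abbreviation "L \<equiv> N ^ (6 * m)"
abbreviation "C \<equiv> Tup N (6 * m)"

abbreviation R :: "bool list \<Rightarrow> nat \<Rightarrow> nat list \<Rightarrow> bool" where
  "R \<equiv> coin_of N (6 * m)"

text \<open>
  The coins are read as \<open>N\<close> blocks of length \<open>L\<close>. Block 0 holds the bit \<open>b\<close>, block 1 the first
  question, block \<open>2 + j\<close> the coefficients of the equations in tensor factor \<open>j\<close> (indexed by an
  equation and the coordinates of the other factors), and the remaining ones the vectors whose
  products are added. Products of signs stand for parities.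
\<close>

definition shift :: "bool list \<Rightarrow> nat list \<Rightarrow> real" where
  "shift r c = sg (R r 0 [] \<and> c = replicate (6 * m) 0) *
     (\<Prod>\<tau><t. sg (\<forall>j<2 * m. R r (2 + m + \<tau> * (2 * m) + j) (take 3 (drop (3 * j) c)))) *
     (\<Prod>j<m. \<Prod>\<kappa>\<in>I3. prod_list (map (\<lambda>p. sg (R r (2 + j) (\<kappa> @ take (6 * j) c @ drop (6 * j + 6) c) \<and>
        take 6 (drop (6 * j) c) = p)) (\<E> \<kappa>)))"

text \<open>The factor in front of the character comes from the acceptance test, which compares the
  difference of the answers with \<open>b\<close>.\<close>

definition eigen :: "(nat list \<Rightarrow> bool) \<Rightarrow> real" where
  "eigen Z = avg (N * L) (\<lambda>r. sg (R r 0 []) * (\<Prod>c\<in>C. if Z c then shift r c else 1))"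

lemma L_pos: "0 < L" using N by simp

lemma coin:
  assumes "r \<in> BL (N * L)" "b < N" "vs \<in> Tup N k" "k \<le> 6 * m"
  shows "R r b vs \<longleftrightarrow> r ! (b * L + tidx N vs)"
proof -
  have "tidx N vs < N ^ k" using assms by (intro tidx_Tup)
  also have "\<dots> \<le> L" using assms N by (intro power_increasing) auto
  finally have "b * L + tidx N vs < Suc b * L" by simp
  also have "\<dots> \<le> N * L" using assms by (intro mult_le_mono1) auto
  finally show ?thesis using assms by (simp add: coin_of_def BL_def)
qed

text \<open>The tuple \<open>e\<close> is an equation number of length 3 followed by the coordinates
  outside factor \<open>j\<close>. This is precisely the address, in block \<open>2 + j\<close>, of
  the coefficient of that equation.\<close>

definition viol :: "(nat list \<Rightarrow> bool) \<Rightarrow> nat \<times> nat list \<Rightarrow> real" where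
  "viol Z x = (case x of (j, e) \<Rightarrow> prod_list (map (\<lambda>p. sg (Z (take (6 * j) (drop 3 e) @ p @ drop (6 * j + 3) e))) (\<E> (take 3 e))))"

definition spos :: "nat \<times> nat list \<Rightarrow> nat" where
  "spos x = (case x of (j, e) \<Rightarrow> (2 + j) * L + tidx N e)"

definition S :: "(nat \<times> nat list) set" where
  "S = {..<m} \<times> Tup N (6 * m - 3)"

lemma tidx_S: "e \<in> Tup N (6 * m - 3) \<Longrightarrow> tidx N e < L"
proof -
  assume "e \<in> Tup N (6 * m - 3)"
  then have "tidx N e < N ^ (6 * m - 3)" by (rule tidx_Tup)
  also have "\<dots> \<le> L" using N by (intro power_increasing) auto
  finally show ?thesis .
qed

lemma inj_spos: "inj_on spos S"
proof (rule inj_onI)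
  fix x y assume xy: "x \<in> S" "y \<in> S" "spos x = spos y"
  obtain j e k f where x: "x = (j, e)" "y = (k, f)" by (metis surj_pair)
  have lt: "tidx N e < L" "tidx N f < L" using xy x tidx_S by (auto simp: S_def)
  have eq: "(2 + j) * L + tidx N e = (2 + k) * L + tidx N f" using xy x by (simp add: spos_def)
  then have "((2 + j) * L + tidx N e) div L = ((2 + k) * L + tidx N f) div L" by (rule arg_cong)
  then have jk: "j = k" using lt L_pos by (simp only: div_mult_self3[of L] div_less)
  then have "tidx N e = tidx N f" using eq by simp
  then show "x = y" using xy x jk tidx_inj[of e N "6 * m - 3" f] by (auto simp: S_def)
qed

lemma spos_bounds: "x \<in> S \<Longrightarrow> L \<le> spos x \<and> spos x < (2 + m) * L"
proof -
  assume "x \<in> S"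
  then obtain j e where x: "x = (j, e)" "j < m" "e \<in> Tup N (6 * m - 3)" by (auto simp: S_def)
  have "(2 + j) * L + tidx N e < Suc (2 + j) * L" using tidx_S[OF x(3)] by simp
  also have "\<dots> \<le> (2 + m) * L" using x by (intro mult_le_mono1) auto
  finally show ?thesis by (simp add: x spos_def)
qed

lemma viol_pm: "viol Z x = 1 \<or> viol Z x = -1"
proof -
  have "prod_list (map (\<lambda>p. sg (P p)) ps) = 1 \<or> prod_list (map (\<lambda>p. sg (P p)) ps) = -1" for P :: "nat list \<Rightarrow> bool" and ps
    by (induction ps) (auto simp: sg_def)
  then show ?thesis by (simp add: viol_def split: prod.splits)
qed

lemma viol_append:
  assumes "\<kappa> \<in> I3" "a \<in> Tup N (6 * j)"
  shows "viol Z (j, \<kappa> @ a @ b) = prod_list (map (\<lambda>p. sg (Z (a @ p @ b))) (\<E> \<kappa>))"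
proof -
  have "length \<kappa> = 3" "length a = 6 * j" using assms by (auto simp: Tup_def)
  then show ?thesis by (simp add: viol_def)
qed

lemma feasible_viol: "feasible m I3 Z \<longleftrightarrow> (\<forall>x\<in>S. viol Z x = 1)"
proof
  assume f: "feasible m I3 Z"
  show "\<forall>x\<in>S. viol Z x = 1"
  proof
    fix x assume "x \<in> S"
    then obtain j e where x: "x = (j, e)" "j < m" "e \<in> Tup N (6 * m - 3)" by (auto simp: S_def)
    have "take 3 e \<in> I3" "take (6 * j) (drop 3 e) \<in> Tup N (6 * j)" "drop (6 * j + 3) e \<in> Tup N (6 * (m - 1 - j))"
      using x by (auto simp: Tup_def dest!: in_set_takeD in_set_dropD)
    then show "viol Z x = 1" using f x unfolding feasible_def viol_def by auto
  qed
next
  assume s: "\<forall>x\<in>S. viol Z x = 1"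
  show "feasible m I3 Z" unfolding feasible_def
  proof (intro ballI allI impI)
    fix \<kappa> j a b assume h: "\<kappa> \<in> I3" "j < m" "a \<in> Tup N (6 * j)" "b \<in> Tup N (6 * (m - 1 - j))"
    then have "(j, \<kappa> @ a @ b) \<in> S" by (auto simp: S_def Tup_def)
    then have "viol Z (j, \<kappa> @ a @ b) = 1" using s by blast
    then show "prod_list (map (\<lambda>p. sg (Z (a @ p @ b))) (\<E> \<kappa>)) = 1"
      using h by (simp add: viol_append)
  qed
qed

lemma if_prod_list: "(if Q then prod_list (map (\<lambda>p. sg (P p)) ps) else 1) = prod_list (map (\<lambda>p. sg (Q \<and> P p)) ps)"
  by (induction ps) auto

text \<open>An exchange of sums: signs are collected by coefficient coin instead of by coordinate.
  The coin for \<open>\<kappa>\<close>, \<open>a\<close>, \<open>b\<close> adds one equation vector,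
  whose inner product with \<open>Z\<close> has the sign \<open>viol\<close>.\<close>

lemma prod_slot:
  assumes r: "r \<in> BL (N * L)" and j: "j < m" and k: "\<kappa> \<in> I3"
  shows "(\<Prod>c\<in>C. if Z c then prod_list (map (\<lambda>p. sg (R r (2 + j) (\<kappa> @ take (6 * j) c @ drop (6 * j + 6) c) \<and>
        take 6 (drop (6 * j) c) = p)) (\<E> \<kappa>)) else 1) =
    (\<Prod>a\<in>Tup N (6 * j). \<Prod>b\<in>Tup N (6 * (m - 1 - j)). if r ! spos (j, \<kappa> @ a @ b) then viol Z (j, \<kappa> @ a @ b) else 1)"
proof -
  have "6 * m = 6 * j + (6 + 6 * (m - 1 - j))" using j by presburger
  then have C: "C = Tup N (6 * j + (6 + 6 * (m - 1 - j)))" by (simp only:)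
  have "(\<Prod>c\<in>C. if Z c then prod_list (map (\<lambda>p. sg (R r (2 + j) (\<kappa> @ take (6 * j) c @ drop (6 * j + 6) c) \<and>
        take 6 (drop (6 * j) c) = p)) (\<E> \<kappa>)) else 1)
    = (\<Prod>a\<in>Tup N (6 * j). \<Prod>q\<in>Tup N 6. \<Prod>b\<in>Tup N (6 * (m - 1 - j)).
       prod_list (map (\<lambda>p. sg (Z (a @ q @ b) \<and> R r (2 + j) (\<kappa> @ a @ b) \<and> q = p)) (\<E> \<kappa>)))"
    unfolding C prod_Tup_append if_prod_list
    by (intro prod.cong refl) (auto simp: Tup_def)
  also have "\<dots> = (\<Prod>a\<in>Tup N (6 * j). \<Prod>b\<in>Tup N (6 * (m - 1 - j)). \<Prod>q\<in>Tup N 6.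
       prod_list (map (\<lambda>p. sg (Z (a @ q @ b) \<and> R r (2 + j) (\<kappa> @ a @ b) \<and> q = p)) (\<E> \<kappa>)))"
    by (intro prod.cong refl prod.swap)
  also have "\<dots> = (\<Prod>a\<in>Tup N (6 * j). \<Prod>b\<in>Tup N (6 * (m - 1 - j)). if r ! spos (j, \<kappa> @ a @ b) then viol Z (j, \<kappa> @ a @ b) else 1)"
  proof (intro prod.cong refl)
    fix a b assume ab: "a \<in> Tup N (6 * j)" "b \<in> Tup N (6 * (m - 1 - j))"
    have e: "\<kappa> @ a @ b \<in> Tup N (6 * m - 3)" using ab k j by (auto simp: Tup_def)
    have R: "R r (2 + j) (\<kappa> @ a @ b) \<longleftrightarrow> r ! spos (j, \<kappa> @ a @ b)"
      using coin[OF r _ e] j Nt by (simp add: spos_def)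
    have "(\<Prod>q\<in>Tup N 6. prod_list (map (\<lambda>p. sg (Z (a @ q @ b) \<and> Q \<and> q = p)) ps)) =
       (if Q then prod_list (map (\<lambda>p. sg (Z (a @ p @ b))) ps) else 1)" if "set ps \<subseteq> Tup N 6" for Q ps
      using that
    proof (induction ps)
      case (Cons p ps)
      have "(\<Prod>q\<in>Tup N 6. sg (Z (a @ q @ b) \<and> Q \<and> q = p)) = (\<Prod>q\<in>Tup N 6. if q = p then sg (Z (a @ p @ b) \<and> Q) else 1)"
        by (intro prod.cong) (auto simp: sg_def)
      also have "\<dots> = sg (Z (a @ p @ b) \<and> Q)" using Cons.prems by (simp add: prod.delta)
      finally show ?case using Cons by (simp add: prod.distrib)
    qed simp
    then have "(\<Prod>q\<in>Tup N 6. prod_list (map (\<lambda>p. sg (Z (a @ q @ b) \<and> R r (2 + j) (\<kappa> @ a @ b) \<and> q = p)) (\<E> \<kappa>))) =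
      (if R r (2 + j) (\<kappa> @ a @ b) then prod_list (map (\<lambda>p. sg (Z (a @ p @ b))) (\<E> \<kappa>)) else 1)"
      using \<E>[OF k] by (auto simp: subset_iff)
    then show "(\<Prod>q\<in>Tup N 6. prod_list (map (\<lambda>p. sg (Z (a @ q @ b) \<and> R r (2 + j) (\<kappa> @ a @ b) \<and> q = p)) (\<E> \<kappa>))) =
      (if r ! spos (j, \<kappa> @ a @ b) then viol Z (j, \<kappa> @ a @ b) else 1)"
      unfolding R viol_append[OF k ab(1)] by simp
  qed
  finally show ?thesis .
qed

lemma prod_S: "(\<Prod>x\<in>S. f x) = (\<Prod>j<m. \<Prod>\<kappa>\<in>I3. \<Prod>a\<in>Tup N (6 * j). \<Prod>b\<in>Tup N (6 * (m - 1 - j)). f (j, \<kappa> @ a @ b))"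
proof -
  have "(\<Prod>x\<in>S. f x) = (\<Prod>j<m. \<Prod>e\<in>Tup N (6 * m - 3). f (j, e))"
    unfolding S_def by (simp add: prod.cartesian_product)
  also have "\<dots> = (\<Prod>j<m. \<Prod>\<kappa>\<in>I3. \<Prod>a\<in>Tup N (6 * j). \<Prod>b\<in>Tup N (6 * (m - 1 - j)). f (j, \<kappa> @ a @ b))"
  proof (rule prod.cong[OF refl])
    fix j assume "j \<in> {..<m}"
    then have "6 * m - 3 = 3 + (6 * j + 6 * (m - 1 - j))" by auto
    then show "(\<Prod>e\<in>Tup N (6 * m - 3). f (j, e)) = (\<Prod>\<kappa>\<in>I3. \<Prod>a\<in>Tup N (6 * j). \<Prod>b\<in>Tup N (6 * (m - 1 - j)). f (j, \<kappa> @ a @ b))"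
      by (simp only: prod_Tup_append)
  qed
  finally show ?thesis .
qed

lemma prod_soft:
  assumes r: "r \<in> BL (N * L)" and \<tau>: "\<tau> < t"
  shows "(\<Prod>c\<in>C. if Z c then sg (\<forall>j<2 * m. R r (2 + m + \<tau> * (2 * m) + j) (take 3 (drop (3 * j) c))) else 1) =
    W m Z (take (2 * m * L) (drop ((2 + m) * L + \<tau> * (2 * m * L)) r))"
  unfolding W_def
proof (intro prod.cong refl)
  fix c assume c: "c \<in> C"
  let ?U = "take (2 * m * L) (drop ((2 + m) * L + \<tau> * (2 * m * L)) r)"
  have "R r (2 + m + \<tau> * (2 * m) + j) (take 3 (drop (3 * j) c)) \<longleftrightarrow> ?U ! (j * L + tidx N (take 3 (drop (3 * j) c)))"
    if j: "j < 2 * m" for j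
  proof -
    have i: "take 3 (drop (3 * j) c) \<in> Tup N 3" using c j by (auto simp: Tup_def dest!: in_set_takeD in_set_dropD)
    have lt: "tidx N (take 3 (drop (3 * j) c)) < L" using tidx_L[OF i] .
    have b: "2 + m + \<tau> * (2 * m) + j < N"
    proof -
      have "Suc \<tau> * (2 * m) \<le> t * (2 * m)" using \<tau> by (intro mult_le_mono1) auto
      then show ?thesis using Nt j by simp
    qed
    have "R r (2 + m + \<tau> * (2 * m) + j) (take 3 (drop (3 * j) c)) \<longleftrightarrow>
       r ! ((2 + m + \<tau> * (2 * m) + j) * L + tidx N (take 3 (drop (3 * j) c)))"
      using coin[OF r b i] m by simp
    also have "(2 + m + \<tau> * (2 * m) + j) * L + tidx N (take 3 (drop (3 * j) c)) =
      ((2 + m) * L + \<tau> * (2 * m * L)) + (j * L + tidx N (take 3 (drop (3 * j) c)))" by (simp add: algebra_simps)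
    finally have 1: "R r (2 + m + \<tau> * (2 * m) + j) (take 3 (drop (3 * j) c)) \<longleftrightarrow>
       r ! (((2 + m) * L + \<tau> * (2 * m * L)) + (j * L + tidx N (take 3 (drop (3 * j) c))))" .
    have "j * L + tidx N (take 3 (drop (3 * j) c)) < Suc j * L" using lt by simp
    also have "\<dots> \<le> 2 * m * L" using j by (intro mult_le_mono1) auto
    finally have 2: "j * L + tidx N (take 3 (drop (3 * j) c)) < 2 * m * L" .
    have "(2 + m) * L + \<tau> * (2 * m * L) \<le> length r"
    proof -
      have "(2 + m) * L + \<tau> * (2 * m * L) = (2 + m + \<tau> * (2 * m)) * L" by (simp add: algebra_simps)
      also have "\<dots> \<le> N * L" using b by (intro mult_le_mono1) auto
      finally show ?thesis using r by (simp add: BL_def)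
    qed
    then show ?thesis unfolding 1 using 2 by (simp add: nth_drop)
  qed
  then show "(if Z c then sg (\<forall>j<2 * m. R r (2 + m + \<tau> * (2 * m) + j) (take 3 (drop (3 * j) c))) else 1) = sg (Z c \<and> soft m ?U c)"
    unfolding soft_def by (auto simp: sg_def)
qed

lemma prod_shift:
  assumes r: "r \<in> BL (N * L)"
  shows "(\<Prod>c\<in>C. if Z c then shift r c else 1) = (if Z (replicate (6 * m) 0) then sg (r ! 0) else 1) *
    (\<Prod>\<tau><t. W m Z (take (2 * m * L) (drop ((2 + m) * L + \<tau> * (2 * m * L)) r))) *
    (\<Prod>x\<in>S. if r ! spos x then viol Z x else 1)"
proof -
  let ?a = "\<lambda>c. sg (R r 0 [] \<and> c = replicate (6 * m) 0)"
  let ?b = "\<lambda>c \<tau>. sg (\<forall>j<2 * m. R r (2 + m + \<tau> * (2 * m) + j) (take 3 (drop (3 * j) c)))"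
  let ?c = "\<lambda>c j \<kappa>. prod_list (map (\<lambda>p. sg (R r (2 + j) (\<kappa> @ take (6 * j) c @ drop (6 * j + 6) c) \<and> take 6 (drop (6 * j) c) = p)) (\<E> \<kappa>))"
  have "(\<Prod>c\<in>C. if Z c then shift r c else 1) = (\<Prod>c\<in>C. if Z c then ?a c else 1) *
    (\<Prod>c\<in>C. \<Prod>\<tau><t. if Z c then ?b c \<tau> else 1) * (\<Prod>c\<in>C. \<Prod>j<m. \<Prod>\<kappa>\<in>I3. if Z c then ?c c j \<kappa> else 1)"
    unfolding shift_def prod.distrib[symmetric] by (intro prod.cong) auto
  also have "(\<Prod>c\<in>C. if Z c then ?a c else 1) = (\<Prod>c\<in>C. if c = replicate (6 * m) 0 then (if Z c then sg (R r 0 []) else 1) else 1)"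
    by (intro prod.cong) (auto simp: sg_def)
  also have "\<dots> = (if Z (replicate (6 * m) 0) then sg (R r 0 []) else 1)"
    using zeros_Tup[OF N, of "6 * m"] by (simp add: prod.delta)
  also have "R r 0 [] \<longleftrightarrow> r ! 0" using coin[OF r N, of "[]" 0] by simp
  also have "(\<Prod>c\<in>C. \<Prod>\<tau><t. if Z c then ?b c \<tau> else 1) = (\<Prod>\<tau><t. \<Prod>c\<in>C. if Z c then ?b c \<tau> else 1)" by (rule prod.swap)
  also have "\<dots> = (\<Prod>\<tau><t. W m Z (take (2 * m * L) (drop ((2 + m) * L + \<tau> * (2 * m * L)) r)))"
    using prod_soft[OF r] by (intro prod.cong) auto
  also have "(\<Prod>c\<in>C. \<Prod>j<m. \<Prod>\<kappa>\<in>I3. if Z c then ?c c j \<kappa> else 1) = (\<Prod>j<m. \<Prod>c\<in>C. \<Prod>\<kappa>\<in>I3. if Z c then ?c c j \<kappa> else 1)"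
    by (rule prod.swap)
  also have "\<dots> = (\<Prod>j<m. \<Prod>\<kappa>\<in>I3. \<Prod>c\<in>C. if Z c then ?c c j \<kappa> else 1)" by (intro prod.cong refl prod.swap)
  also have "\<dots> = (\<Prod>x\<in>S. if r ! spos x then viol Z x else 1)"
    unfolding prod_S by (rule prod.cong[OF refl], rule prod.cong[OF refl], rule prod_slot[OF r]) auto
  finally show ?thesis .
qed

lemma R0: "r \<in> BL (N * L) \<Longrightarrow> R r 0 [] \<longleftrightarrow> r ! 0"
  using coin[OF _ N, of r "[]" 0] by simp

text \<open>If \<open>Z\<close> is 0 at coordinate 0, flipping \<open>b\<close> negates the summand,
  and if an equation is violated, flipping its coefficient does. Otherwise \<open>b\<close> cancels,
  the equations contribute 1, and the \<open>t\<close> random products use disjoint coins.\<close>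

lemma eigen_eq: "eigen Z = (if Z (replicate (6 * m) 0) \<and> feasible m I3 Z then A m Z ^ t else 0)"
proof -
  let ?M = "2 * m * L" let ?o = "(2 + m) * L"
  let ?W = "\<lambda>r. \<Prod>\<tau><t. W m Z (take ?M (drop (?o + \<tau> * ?M) r))"
  let ?V = "\<lambda>r. \<Prod>x\<in>S. if r ! spos x then viol Z x else 1"
  let ?z = "Z (replicate (6 * m) 0)"
  have e: "eigen Z = avg (N * L) (\<lambda>r. sg (r ! 0) * ((if ?z then sg (r ! 0) else 1) * ?W r * ?V r))"
    unfolding eigen_def by (intro avg_cong) (simp add: prod_shift R0)
  have bound: "?o + t * ?M \<le> N * L"
  proof -
    have "?o + t * ?M = (2 + m + t * (2 * m)) * L" by (simp add: algebra_simps)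
    also have "\<dots> \<le> N * L" using Nt by (intro mult_le_mono1)
    finally show ?thesis .
  qed
  have W_upd: "?W (r[i := v]) = ?W r" if "i < ?o" for r i v
    using that by (intro prod.cong refl) (simp add: drop_update_cancel)
  have finS: "finite S" by (simp add: S_def)
  consider "\<not> ?z" | "?z" "\<not> feasible m I3 Z" | "?z" "feasible m I3 Z" by blast
  then show ?thesis
  proof cases
    case 1
    have "eigen Z = 0" unfolding e
    proof (rule avg_flip)
      show "0 < N * L" using N by simp
      fix r assume r: "r \<in> BL (N * L)"
      have "?V (r[0 := \<not> r ! 0]) = ?V r"
      proof (intro prod.cong refl)
        fix x assume "x \<in> S"
        then have "0 < spos x" using spos_bounds[of x] L_pos by (metis less_le_trans)
        then show "(if r[0 := \<not> r ! 0] ! spos x then viol Z x else 1) = (if r ! spos x then viol Z x else 1)" by simp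
      qed
      moreover have "?W (r[0 := \<not> r ! 0]) = ?W r" using L_pos by (intro W_upd) simp
      moreover have "r \<noteq> []" using r N by (auto simp: BL_def)
      ultimately show "sg (r[0 := \<not> r ! 0] ! 0) * ((if ?z then sg (r[0 := \<not> r ! 0] ! 0) else 1) * ?W (r[0 := \<not> r ! 0]) * ?V (r[0 := \<not> r ! 0])) =
        - (sg (r ! 0) * ((if ?z then sg (r ! 0) else 1) * ?W r * ?V r))" using 1 by simp
    qed
    then show ?thesis using 1 by simp
  next
    case 2
    then obtain k where k: "k \<in> S" "viol Z k = -1" using feasible_viol viol_pm by blast
    have "eigen Z = 0" unfolding e
    proof (rule avg_flip)
      have "spos k < ?o" using spos_bounds[OF k(1)] by simp
      also have "?o \<le> N * L" using bound by simp
      finally show lt: "spos k < N * L" .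
      fix r assume r: "r \<in> BL (N * L)"
      have "?V (r[spos k := \<not> r ! spos k]) = - ?V r"
        using k lt r by (intro char_flip finS inj_spos) (auto simp: BL_def)
      moreover have "?W (r[spos k := \<not> r ! spos k]) = ?W r" using spos_bounds[OF k(1)] by (intro W_upd) simp
      moreover have "r[spos k := \<not> r ! spos k] ! 0 = r ! 0"
      using spos_bounds[OF k(1)] L_pos by (metis less_le_trans nth_list_update_neq not_less0)
      ultimately show "sg (r[spos k := \<not> r ! spos k] ! 0) * ((if ?z then sg (r[spos k := \<not> r ! spos k] ! 0) else 1) * ?W (r[spos k := \<not> r ! spos k]) * ?V (r[spos k := \<not> r ! spos k])) =
        - (sg (r ! 0) * ((if ?z then sg (r ! 0) else 1) * ?W r * ?V r))" by simp
    qed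
    then show ?thesis using 2 by simp
  next
    case 3
    have "?V r = 1" for r using 3 feasible_viol by (intro prod.neutral) auto
    then have "eigen Z = avg (N * L) ?W" unfolding e using 3 by (simp add: mult.assoc[symmetric])
    also have "N * L = ?o + t * ?M + (N * L - (?o + t * ?M))" using bound by simp
    also have "avg \<dots> ?W = A m Z ^ t" unfolding A_def by (rule avg_blocks)
    finally show ?thesis using 3 by simp
  qed
qed

lemma shift_pm: "shift r c = 1 \<or> shift r c = -1"
proof -
  have pl: "prod_list (map (\<lambda>p. sg (P p)) ps) = 1 \<or> prod_list (map (\<lambda>p. sg (P p)) ps) = -1" for P :: "nat list \<Rightarrow> bool" and ps
    by (induction ps) (auto simp: sg_def)
  have "(\<Prod>\<tau><t. sg (\<forall>j<2 * m. R r (2 + m + \<tau> * (2 * m) + j) (take 3 (drop (3 * j) c)))) = 1 \<or>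
    (\<Prod>\<tau><t. sg (\<forall>j<2 * m. R r (2 + m + \<tau> * (2 * m) + j) (take 3 (drop (3 * j) c)))) = -1" by (rule prod_sg)
  moreover have "(\<Prod>j<m. \<Prod>\<kappa>\<in>I3. prod_list (map (\<lambda>p. sg (R r (2 + j) (\<kappa> @ take (6 * j) c @ drop (6 * j + 6) c) \<and>
        take 6 (drop (6 * j) c) = p)) (\<E> \<kappa>))) = 1 \<or> (\<Prod>j<m. \<Prod>\<kappa>\<in>I3. prod_list (map (\<lambda>p. sg (R r (2 + j) (\<kappa> @ take (6 * j) c @ drop (6 * j + 6) c) \<and>
        take 6 (drop (6 * j) c) = p)) (\<E> \<kappa>))) = -1"
    by (intro prod_pm pl)
  moreover have "sg (R r 0 [] \<and> c = replicate (6 * m) 0) = 1 \<or> sg (R r 0 [] \<and> c = replicate (6 * m) 0) = -1"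
    by (auto simp: sg_def)
  ultimately show ?thesis unfolding shift_def by (elim disjE) (simp_all only:, simp_all)
qed

definition zvec :: "bool list \<Rightarrow> bool list" where
  "zvec r = map (\<lambda>c. shift r c = -1) (tups N (6 * m))"

lemma zvec_BL: "zvec r \<in> BL L"
  by (simp add: zvec_def BL_def length_tups)

lemma chi_zvec: "chi w (zvec r) = (\<Prod>c\<in>C. if w ! tidx N c then shift r c else 1)"
proof -
  have "chi w (zvec r) = (\<Prod>i<L. if w ! i then sg (zvec r ! i) else 1)"
    unfolding chi_def using zvec_BL[of r] by (simp add: BL_def)
  also have "\<dots> = (\<Prod>c\<in>C. if w ! tidx N c then sg (zvec r ! tidx N c) else 1)"
    by (rule prod.reindex_bij_betw[OF bij_tidx, symmetric])
  also have "\<dots> = (\<Prod>c\<in>C. if w ! tidx N c then shift r c else 1)"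
  proof (intro prod.cong refl)
    fix c assume c: "c \<in> C"
    have "zvec r ! tidx N c = (shift r c = -1)"
      unfolding zvec_def using c tidx_Tup[OF c] by (simp add: nth_tups length_tups)
    then have "sg (zvec r ! tidx N c) = shift r c" using shift_pm[of r c] by (auto simp: sg_def)
    then show "(if w ! tidx N c then sg (zvec r ! tidx N c) else 1) = (if w ! tidx N c then shift r c else 1)" by simp
  qed
  finally show ?thesis .
qed

lemma eigen_chi: "eigen (\<lambda>c. w ! tidx N c) = avg (N * L) (\<lambda>r. sg (r ! 0) * chi w (zvec r))"
  unfolding eigen_def chi_zvec by (intro avg_cong) (simp add: R0)

end

text \<open>With \<open>t\<close> the integer part of \<open>\<epsilon> * 4 ^ m\<close>, Bernoulli's
  inequality gives the lower bound for every positive \<open>m\<close>. The other power is at most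
  the exponential of \<open>- 2 * t * (3 / 8) ^ m\<close>, which tends to 0 since (3/2)^m
  grows.\<close>

lemma exists_parameters:
  fixes \<epsilon> :: real
  assumes "\<epsilon> > 0"
  shows "\<exists>m t. 1 \<le> m \<and> (1 - 2 * (3 / 8) ^ m) ^ t \<le> 2 * \<epsilon> \<and> 1 - 2 * \<epsilon> \<le> (1 - 2 * (1 / 4) ^ m) ^ t"
proof -
  have "((\<lambda>m::nat. exp (2 - 2 * \<epsilon> * (3 / 2) ^ m)) \<longlongrightarrow> 0) at_top"
    using assms by real_asymp
  then have "\<forall>\<^sub>F m in at_top. exp (2 - 2 * \<epsilon> * (3 / 2) ^ m) < 2 * \<epsilon>"
    using assms by (intro order_tendstoD) auto
  then obtain m0 where m0: "\<And>m. m \<ge> m0 \<Longrightarrow> exp (2 - 2 * \<epsilon> * (3 / 2) ^ m) < 2 * \<epsilon>"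
    by (auto simp: eventually_at_top_linorder)
  define m where "m = Suc m0"
  define t where "t = nat \<lfloor>\<epsilon> * 4 ^ m\<rfloor>"
  have t: "real t \<le> \<epsilon> * 4 ^ m" "\<epsilon> * 4 ^ m - 1 \<le> real t"
    using assms unfolding t_def by (simp_all add: of_nat_nat)
  have p1: "(1 / 4 :: real) ^ m \<le> 1 / 4" "(3 / 8 :: real) ^ m \<le> 3 / 8"
    unfolding m_def by (simp_all add: power_le_one)
  have y: "0 \<le> 2 * (3 / 8 :: real) ^ m" "2 * (3 / 8 :: real) ^ m \<le> 1" using p1 by auto
  have "1 + real t * (- (2 * (1 / 4) ^ m)) \<le> (1 + (- (2 * (1 / 4) ^ m))) ^ t"
    using p1 by (intro Bernoulli_inequality) linarith
  moreover have "real t * (2 * (1 / 4) ^ m) \<le> (\<epsilon> * 4 ^ m) * (2 * (1 / 4) ^ m)"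
    using t by (intro mult_right_mono) auto
  moreover have "(\<epsilon> * 4 ^ m) * (2 * (1 / 4) ^ m) = 2 * \<epsilon>" by (simp add: power_divide)
  ultimately have lo: "1 - 2 * \<epsilon> \<le> (1 - 2 * (1 / 4) ^ m) ^ t" by simp
  have "(1 - 2 * (3 / 8 :: real) ^ m) ^ t \<le> exp (- (2 * (3 / 8) ^ m)) ^ t"
    using y exp_ge_add_one_self[of "- (2 * (3 / 8) ^ m)"] by (intro power_mono) auto
  also have "\<dots> = exp (- (real t * (2 * (3 / 8) ^ m)))" by (simp add: exp_of_nat_mult[symmetric])
  \<comment> \<open>Rounding \<open>t\<close> down costs at most \<open>2 * (3 / 8) ^ m\<close> in
    the exponent, which the constant 2 covers.\<close>
  also have "\<dots> \<le> exp (2 - 2 * \<epsilon> * (3 / 2) ^ m)"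
  proof -
    have "(\<epsilon> * 4 ^ m - 1) * (2 * (3 / 8) ^ m) \<le> real t * (2 * (3 / 8) ^ m)"
      using t by (intro mult_right_mono) auto
    moreover have "(\<epsilon> * 4 ^ m - 1) * (2 * (3 / 8) ^ m) = 2 * \<epsilon> * (4 ^ m * (3 / 8) ^ m) - 2 * (3 / 8) ^ m"
      by (simp add: algebra_simps)
    moreover have "(4 :: real) ^ m * (3 / 8) ^ m = (3 / 2) ^ m" unfolding power_mult_distrib[symmetric] by simp
    ultimately have "2 * \<epsilon> * (3 / 2) ^ m - 2 * (3 / 8) ^ m \<le> real t * (2 * (3 / 8) ^ m)" by simp
    then show ?thesis using y by simp
  qed
  also have "\<dots> \<le> 2 * \<epsilon>" using m0[of m] by (simp add: m_def)
  finally show ?thesis using lo by (intro exI[of _ m] exI[of _ t]) (simp add: m_def)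
qed

lemma prob_uniform_BL:
  "measure_pmf.prob (pmf_of_set {r. length r = n}) {r. P r} = avg n (\<lambda>r. of_bool (P r))"
proof -
  have "BL n \<noteq> {}" using card_BL[of n] by (metis card.empty power_not_zero zero_neq_numeral)
  then have "measure_pmf.prob (pmf_of_set (BL n)) {r. P r} = card (BL n \<inter> {r. P r}) / card (BL n)"
    by (intro measure_pmf_of_set) auto
  also have "real (card (BL n \<inter> {r. P r})) = (\<Sum>r\<in>BL n. of_bool (P r))"
    by (simp add: of_bool_def sum.If_cases)
  finally show ?thesis unfolding card_BL by (simp add: avg_def BL_def)
qed

section \<open>The bias of arbitrary and of honest strategies\<close>

context game
begin

lemma N2: "2 \<le> N" using Nt by simp

text \<open>Block 1 is the first question. That the shift does not read it is the independence of
  question and shift required by the Fourier bound.\<close>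

lemma shift_cong:
  assumes r: "r \<in> BL (N * L)" "r' \<in> BL (N * L)"
    and eq: "\<And>i. i < L \<or> 2 * L \<le> i \<Longrightarrow> r ! i = r' ! i" and c: "c \<in> C"
  shows "shift r c = shift r' c"
proof -
  have "r ! 0 = r' ! 0" using L_pos by (intro eq disjI1)
  then have 0: "R r 0 [] = R r' 0 []" using R0 r by simp
  have ge: "2 * L \<le> (2 + k) * L + i" for k i by (simp add: algebra_simps)
  have 1: "R r (2 + m + \<tau> * (2 * m) + j) (take 3 (drop (3 * j) c)) = R r' (2 + m + \<tau> * (2 * m) + j) (take 3 (drop (3 * j) c))"
    if "\<tau> < t" "j < 2 * m" for \<tau> j
  proof -
    have i: "take 3 (drop (3 * j) c) \<in> Tup N 3" using c that by (auto simp: Tup_def dest!: in_set_takeD in_set_dropD)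
    have "Suc \<tau> * (2 * m) \<le> t * (2 * m)" using that by (intro mult_le_mono1) auto
    then have b: "2 + m + \<tau> * (2 * m) + j < N" using Nt that by simp
    show ?thesis using coin[OF r(1) b i] coin[OF r(2) b i] m eq[OF disjI2[OF ge[of "m + \<tau> * (2 * m) + j"]]]
      by (simp add: add.assoc)
  qed
  have 2: "R r (2 + j) (\<kappa> @ take (6 * j) c @ drop (6 * j + 6) c) = R r' (2 + j) (\<kappa> @ take (6 * j) c @ drop (6 * j + 6) c)"
    if "j < m" "\<kappa> \<in> I3" for j \<kappa>
  proof -
    have e: "\<kappa> @ take (6 * j) c @ drop (6 * j + 6) c \<in> Tup N (6 * m - 3)"
      using c that by (auto simp: Tup_def dest!: in_set_takeD in_set_dropD)
    have b: "2 + j < N" using that Nt by simp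
    show ?thesis using coin[OF r(1) b e] coin[OF r(2) b e] eq[OF disjI2[OF ge[of j]]] by simp
  qed
  show ?thesis unfolding shift_def 0
    by (intro arg_cong2[where f = "(*)"] prod.cong refl arg_cong[where f = prod_list] map_cong arg_cong[where f = sg])
      (use 1 2 in auto)
qed

definition insert_block :: "bool list \<Rightarrow> bool list \<Rightarrow> bool list" where
  "insert_block q w = take L w @ q @ drop L w"

lemma NL: "N * L = L + (L + (N - 2) * L)"
  using N2 by (metis add.assoc distrib_right le_add_diff_inverse mult_2)

lemma insert_block_BL: "q \<in> BL L \<Longrightarrow> w \<in> BL (L + (N - 2) * L) \<Longrightarrow> insert_block q w \<in> BL (N * L)"
  by (simp add: insert_block_def BL_def NL)

lemma avg_insert_block:
  "avg (N * L) f = avg L (\<lambda>q. avg (L + (N - 2) * L) (\<lambda>w. f (insert_block q w)))"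
proof -
  have "avg (N * L) f = avg L (\<lambda>u. avg L (\<lambda>q. avg ((N - 2) * L) (\<lambda>v. f (u @ q @ v))))"
    unfolding NL by (simp only: avg_split)
  also have "\<dots> = avg L (\<lambda>q. avg L (\<lambda>u. avg ((N - 2) * L) (\<lambda>v. f (u @ q @ v))))" by (rule avg_swap)
  also have "\<dots> = avg L (\<lambda>q. avg (L + (N - 2) * L) (\<lambda>w. f (insert_block q w)))"
    unfolding avg_split[of L "(N - 2) * L"] by (intro avg_cong) (simp add: insert_block_def BL_def)
  finally show ?thesis .
qed

lemma insert_block_nth:
  assumes "q \<in> BL L" "q' \<in> BL L" "w \<in> BL (L + (N - 2) * L)" "i < L \<or> 2 * L \<le> i"
  shows "insert_block q w ! i = insert_block q' w ! i"
  using assms by (auto simp: insert_block_def BL_def nth_append)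

lemma zvec_insert_block:
  assumes "q \<in> BL L" "q' \<in> BL L" "w \<in> BL (L + (N - 2) * L)"
  shows "zvec (insert_block q w) = zvec (insert_block q' w)"
  unfolding zvec_def
proof (rule map_cong[OF refl])
  fix c assume "c \<in> set (tups N (6 * m))"
  then show "(shift (insert_block q w) c = -1) = (shift (insert_block q' w) c = -1)"
    using shift_cong[OF insert_block_BL[OF assms(1,3)] insert_block_BL[OF assms(2,3)] insert_block_nth[OF assms]]
    by (simp add: set_tups)
qed

definition bias :: "(bool list \<Rightarrow> real) \<Rightarrow> (bool list \<Rightarrow> real) \<Rightarrow> real" where
  "bias F G = avg (N * L) (\<lambda>r. sg (r ! 0) * F (take L (drop L r)) * G (xorl (take L (drop L r)) (zvec r)))"

lemma bias_le:
  assumes nr: "no_rank_one I3"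
    and F: "\<And>q. F q * F q = 1" and G: "\<And>q. G q * G q = 1"
  shows "bias F G \<le> (1 - 2 * (3 / 8) ^ m) ^ t"
proof -
  \<comment> \<open>A dummy question in block 1 turns the shift into a function of the remaining
    coins; the average over all coins defining the eigenvalue is unchanged by this.\<close>
  let ?q0 = "replicate L False" and ?M = "L + (N - 2) * L"
  have q0: "?q0 \<in> BL L" by (simp add: BL_def)
  have "bias F G = avg L (\<lambda>q. avg ?M (\<lambda>w. sg (insert_block ?q0 w ! 0) * F q * G (xorl q (zvec (insert_block ?q0 w)))))"
    unfolding bias_def avg_insert_block
  proof (intro avg_cong)
    fix q w assume qw: "q \<in> BL L" "w \<in> BL ?M"
    have "take L (drop L (insert_block q w)) = q" using qw by (simp add: insert_block_def BL_def)
    moreover have "insert_block q w ! 0 = insert_block ?q0 w ! 0" using qw q0 L_pos by (intro insert_block_nth) auto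
    ultimately show "sg (insert_block q w ! 0) * F (take L (drop L (insert_block q w))) * G (xorl (take L (drop L (insert_block q w))) (zvec (insert_block q w)))
      = sg (insert_block ?q0 w ! 0) * F q * G (xorl q (zvec (insert_block ?q0 w)))"
      using zvec_insert_block[OF qw(1) q0 qw(2)] by simp
  qed
  also have "\<bar>\<dots>\<bar> \<le> (1 - 2 * (3 / 8) ^ m) ^ t"
  proof (rule xor_game_bias)
    fix w assume "w \<in> BL L"
    let ?Z = "\<lambda>c. w ! tidx N c"
    have "avg ?M (\<lambda>r. sg (insert_block ?q0 r ! 0) * chi w (zvec (insert_block ?q0 r))) = 
      avg L (\<lambda>q. avg ?M (\<lambda>r. sg (insert_block q r ! 0) * chi w (zvec (insert_block q r))))"
    proof -
      have "avg ?M (\<lambda>r. sg (insert_block q r ! 0) * chi w (zvec (insert_block q r))) =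
        avg ?M (\<lambda>r. sg (insert_block ?q0 r ! 0) * chi w (zvec (insert_block ?q0 r)))" if q: "q \<in> BL L" for q
      proof (intro avg_cong)
        fix r assume r: "r \<in> BL ?M"
        have "insert_block q r ! 0 = insert_block ?q0 r ! 0" using q r q0 L_pos by (intro insert_block_nth) auto
        then show "sg (insert_block q r ! 0) * chi w (zvec (insert_block q r)) = sg (insert_block ?q0 r ! 0) * chi w (zvec (insert_block ?q0 r))"
          using zvec_insert_block[OF q q0 r] by simp
      qed
      then have "avg L (\<lambda>q. avg ?M (\<lambda>r. sg (insert_block q r ! 0) * chi w (zvec (insert_block q r)))) =
        avg L (\<lambda>q. avg ?M (\<lambda>r. sg (insert_block ?q0 r ! 0) * chi w (zvec (insert_block ?q0 r))))"
        by (rule avg_cong)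
      then show ?thesis by simp
    qed
    also have "\<dots> = eigen ?Z" unfolding eigen_chi avg_insert_block ..
    finally have e: "avg ?M (\<lambda>r. sg (insert_block ?q0 r ! 0) * chi w (zvec (insert_block ?q0 r))) = eigen ?Z" .
    have b: "0 \<le> (1 - 2 * (3 / 8 :: real) ^ m)"
    proof -
      have "(3 / 8 :: real) ^ m \<le> (3 / 8) ^ 1" using m by (intro power_decreasing) auto
      then show ?thesis by simp
    qed
    have a: "0 \<le> A m ?Z" using A_nonneg[of "m - 1" ?Z] m by simp
    have "\<bar>eigen ?Z\<bar> \<le> (1 - 2 * (3 / 8) ^ m) ^ t"
      unfolding eigen_eq using A_le[OF nr, of m ?Z] a b by (auto intro: power_mono)
    then show "\<bar>avg ?M (\<lambda>r. sg (insert_block ?q0 r ! 0) * chi w (zvec (insert_block ?q0 r)))\<bar> \<le> (1 - 2 * (3 / 8) ^ m) ^ t"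
      unfolding e .
  qed (use F G zvec_BL in auto)
  finally show ?thesis by simp
qed

lemma bias_honest:
  assumes x: "\<And>\<kappa>. \<kappa> \<in> I3 \<Longrightarrow> prod_list (map (\<lambda>p. sg (x (take 3 p) \<and> x (drop 3 p))) (\<E> \<kappa>)) = 1"
    and x0: "x (replicate 3 0)"
  defines "w \<equiv> map (honest x m) (tups N (6 * m))"
  shows "bias (chi w) (chi w) = (1 - 2 * (1 / 4) ^ m) ^ t"
proof -
  have "bias (chi w) (chi w) = avg (N * L) (\<lambda>r. sg (r ! 0) * chi w (zvec r))"
    unfolding bias_def
  proof (rule avg_cong)
    fix r assume r: "r \<in> BL (N * L)"
    have "length (take L (drop L r)) = length (zvec r)" using r zvec_BL[of r] by (simp add: BL_def NL)
    moreover have "chi w q * chi w q = 1" for q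
    proof -
      have "(if w ! i then sg (q ! i) else 1) = 1 \<or> (if w ! i then sg (q ! i) else 1) = -1" for i by (auto simp: sg_def)
      then have "chi w q = 1 \<or> chi w q = -1" unfolding chi_def by (intro prod_pm)
      then show ?thesis by auto
    qed
    ultimately show "sg (r ! 0) * chi w (take L (drop L r)) * chi w (xorl (take L (drop L r)) (zvec r)) = sg (r ! 0) * chi w (zvec r)"
      by (simp add: chi_xorl mult.assoc[symmetric])
  qed
  also have "\<dots> = avg (N * L) (\<lambda>r. sg (R r 0 []) * (\<Prod>c\<in>C. if honest x m c then shift r c else 1))"
    unfolding chi_zvec
  proof (intro avg_cong)
    fix r assume r: "r \<in> BL (N * L)"
    have "w ! tidx N c = honest x m c" if "c \<in> C" for c
      using that tidx_Tup[OF that] by (simp add: w_def length_tups nth_tups)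
    then have "(\<Prod>c\<in>C. if w ! tidx N c then shift r c else 1) = (\<Prod>c\<in>C. if honest x m c then shift r c else 1)"
      by (intro prod.cong) auto
    then show "sg (r ! 0) * (\<Prod>c\<in>C. if w ! tidx N c then shift r c else 1) = sg (R r 0 []) * (\<Prod>c\<in>C. if honest x m c then shift r c else 1)"
      using R0[OF r] by simp
  qed
  also have "\<dots> = eigen (honest x m)" by (simp add: eigen_def)
  also have "\<dots> = (1 - 2 * (1 / 4) ^ m) ^ t"
  proof -
    have "take 3 (drop (3 * j) (replicate (6 * m) (0::nat))) = replicate 3 0" if "j < 2 * m" for j
      using that by (simp add: min_def)
    then have "honest x m (replicate (6 * m) 0)" using x0 by (simp add: honest_def)
    moreover have "feasible m I3 (honest x m)" using x \<E> by (intro feasible_honest) auto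
    ultimately show ?thesis unfolding eigen_eq using A_honest[of x m, OF x0] by simp
  qed
  finally show ?thesis .
qed

end

section \<open>Quadratic equations for computations\<close>

text \<open>
  The tableau is written relative to the heads: at time \<open>\<tau>\<close> the variables of type \<open>TC True k a\<close>
  and \<open>TC False k a\<close> in column \<open>j\<close> say that tape \<open>k\<close> carries \<open>a\<close> at distance \<open>j\<close> to the right
  and \<open>j + 1\<close> to the left of its head, and \<open>TP q ss\<close> in column 0 says that the
  state is \<open>q\<close> and the scanned symbols are \<open>ss\<close>. All equations are thus local, although the heads
  move independently.
\<close>

datatype ty = TP nat "nat list" | TC bool nat nat

instance ty :: countable
  by countable_datatype

text \<open>Codes start at 1, which keeps the index \<open>[0, 0, 0]\<close> free for the constant
  1.\<close>

definition code :: "ty \<Rightarrow> nat" where "code \<theta> = Suc (to_nat \<theta>)"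

lemma code_eq [simp]: "code \<theta> = code \<theta>' \<longleftrightarrow> \<theta> = \<theta>'"
  by (simp add: code_def)

lemma code_nz [simp]: "code \<theta> \<noteq> 0"
  by (simp add: code_def)

datatype col = C0 | Same | Next | Prev
text \<open>\<open>One\<close> homogenises the equations: a linear term is a product with
  \<open>One\<close>. The Boolean in \<open>V\<close> selects the next time step instead of the
  current one.\<close>

datatype vt = One | V bool col ty
datatype cnd = TSym "nat \<Rightarrow> bool" | T0 | JSym "nat \<Rightarrow> bool" | J0 | J1 | J2

text \<open>
  A schema \<open>(cs, ms)\<close> is the equation that the products in \<open>ms\<close> sum to 0, imposed at all positions
  \<open>(\<tau>, j)\<close> satisfying \<open>cs\<close>. Products containing a variable outside the tableau count as 0. The
  conditions look at the letters at \<open>\<tau>\<close> and \<open>j\<close> of the word \<open>x 3 4\<^sup>h 5\<^sup>g 6\<close>: columns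
  with letter 4 hold the witness and its end marker, and letter 6 marks the last row and column.
\<close>

type_synonym schema = "cnd list \<times> (vt \<times> vt) list"

fun column :: "col \<Rightarrow> nat \<Rightarrow> nat option" where
  "column C0 j = Some 0"
| "column Same j = Some j"
| "column Next j = Some (Suc j)"
| "column Prev j = (if j = 0 then None else Some (j - 1))"

fun index :: "nat \<Rightarrow> nat \<Rightarrow> nat \<Rightarrow> vt \<Rightarrow> nat list option" where
  "index N \<tau> j One = Some [0, 0, 0]"
| "index N \<tau> j (V b c \<theta>) = (case column c j of None \<Rightarrow> None | Some j' \<Rightarrow>
     (if \<tau> + of_bool b < N \<and> j' < N \<and> code \<theta> < N then Some [\<tau> + of_bool b, j', code \<theta>] else None))"

fun holds :: "nat list \<Rightarrow> nat \<Rightarrow> nat \<Rightarrow> cnd \<Rightarrow> bool" where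
  "holds y \<tau> j (TSym A) \<longleftrightarrow> A (y ! \<tau>)"
| "holds y \<tau> j T0 \<longleftrightarrow> \<tau> = 0"
| "holds y \<tau> j (JSym A) \<longleftrightarrow> A (y ! j)"
| "holds y \<tau> j J0 \<longleftrightarrow> j = 0"
| "holds y \<tau> j J1 \<longleftrightarrow> j = 1"
| "holds y \<tau> j J2 \<longleftrightarrow> j \<noteq> 0 \<and> j \<noteq> 1"

definition mval :: "(nat list \<Rightarrow> bool) \<Rightarrow> nat \<Rightarrow> nat \<Rightarrow> nat \<Rightarrow> vt \<Rightarrow> bool" where
  "mval X N \<tau> j v \<longleftrightarrow> (case index N \<tau> j v of None \<Rightarrow> False | Some i \<Rightarrow> X i)"

definition cnt :: "(nat list \<Rightarrow> bool) \<Rightarrow> nat \<Rightarrow> nat \<Rightarrow> nat \<Rightarrow> (vt \<times> vt) list \<Rightarrow> nat" where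
  "cnt X N \<tau> j ms = length (filter (\<lambda>(a, b). mval X N \<tau> j a \<and> mval X N \<tau> j b) ms)"

definition schema_ok :: "(nat list \<Rightarrow> bool) \<Rightarrow> nat list \<Rightarrow> nat \<Rightarrow> nat \<Rightarrow> schema \<Rightarrow> bool" where
  "schema_ok X y \<tau> j s \<longleftrightarrow> ((\<forall>c\<in>set (fst s). holds y \<tau> j c) \<longrightarrow> even (cnt X (length y) \<tau> j (snd s)))"

lemma cnt_simps [simp]:
  "cnt X N \<tau> j [] = 0"
  "cnt X N \<tau> j ((a, b) # ms) = of_bool (mval X N \<tau> j a \<and> mval X N \<tau> j b) + cnt X N \<tau> j ms"
  "cnt X N \<tau> j (ms @ ms') = cnt X N \<tau> j ms + cnt X N \<tau> j ms'"
  by (auto simp: cnt_def)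

text \<open>A halted configuration gets moves that reproduce it, so that the tableau can extend
  beyond the halting time.\<close>

definition moves :: "tm \<Rightarrow> nat \<times> nat list \<Rightarrow> nat \<times> (nat \<times> move) list" where
  "moves M p = (if fst p = 1 then (1, map (\<lambda>s. (s, N_move)) (snd p)) else delta M (fst p) (snd p))"

text \<open>State and all scanned symbols are combined into one variable. Since it determines the
  whole action, a cell at the next time is a sum of products of one such variable with at most one
  cell, so degree 2 suffices.\<close>

definition configs :: "tm \<Rightarrow> (nat \<times> nat list) list" where
  "configs M = List.product [0..<states M] (tups (symbols M) (tapes M))"

definition types :: "tm \<Rightarrow> ty list" where
  "types M = map (\<lambda>p. TP (fst p) (snd p)) (configs M) @
     concat (map (\<lambda>s. concat (map (\<lambda>k. map (TC s k) [0..<symbols M]) [0..<tapes M])) [True, False])"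

text \<open>
  Where the symbol at distance \<open>j\<close> on the given side of the head comes from when the head moves;
  \<open>None\<close> stands for the symbol that is written.
\<close>

fun source :: "bool \<Rightarrow> move \<Rightarrow> cnd \<Rightarrow> (bool \<times> col) option" where
  "source True N_move J0 = None"
| "source True N_move _ = Some (True, Same)"
| "source True R_move _ = Some (True, Next)"
| "source True L_move J0 = Some (False, Same)"
| "source True L_move J1 = None"
| "source True L_move _ = Some (True, Prev)"
| "source False N_move _ = Some (False, Same)"
| "source False R_move J0 = None"
| "source False R_move _ = Some (False, Prev)"
| "source False L_move _ = Some (False, Next)"

definition Pv :: "bool \<Rightarrow> nat \<times> nat list \<Rightarrow> vt" where
  "Pv b p = V b C0 (TP (fst p) (snd p))"

definition cell_monos :: "tm \<Rightarrow> bool \<Rightarrow> nat \<Rightarrow> nat \<Rightarrow> cnd \<Rightarrow> nat \<times> nat list \<Rightarrow> (vt \<times> vt) list" where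
  "cell_monos M s k a c p = (case snd (moves M p) ! k of (w, mv) \<Rightarrow>
     (case source s mv c of None \<Rightarrow> (if w = a then [(Pv False p, One)] else [])
      | Some (s', c') \<Rightarrow> [(Pv False p, V False c' (TC s' k a))]))"

definition value_schema :: "cnd list \<Rightarrow> bool \<Rightarrow> nat \<Rightarrow> nat \<Rightarrow> nat \<Rightarrow> schema" where
  "value_schema cs s k v a = (cs, (V False Same (TC s k a), One) # (if a = v then [(One, One)] else []))"

definition cells :: "tm \<Rightarrow> (bool \<times> nat \<times> nat) list" where
  "cells M = List.product [True, False] (List.product [0..<tapes M] [0..<symbols M])"

definition Pmonos :: "tm \<Rightarrow> (nat \<times> nat list \<Rightarrow> bool) \<Rightarrow> (vt \<times> vt) list" where
  "Pmonos M Q = map (\<lambda>p. (Pv False p, One)) (filter Q (configs M))"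

text \<open>Equations over the field of two elements only see parities: the sum makes the number of
  true configuration variables odd, and the pairwise products exclude two of them.\<close>

definition one_hot_schemas :: "tm \<Rightarrow> schema list" where
  "one_hot_schemas M = ([], (One, One) # Pmonos M (\<lambda>_. True)) #
     map (\<lambda>(p, p'). ([], [(Pv False p, Pv False p')])) (filter (\<lambda>(p, p'). p \<noteq> p') (List.product (configs M) (configs M)))"

definition scan_schemas :: "tm \<Rightarrow> schema list" where
  "scan_schemas M = map (\<lambda>(k, a). ([], (V False C0 (TC True k a), One) # Pmonos M (\<lambda>p. snd p ! k = a)))
     (List.product [0..<tapes M] [0..<symbols M])"

definition state_schemas :: "tm \<Rightarrow> schema list" where
  "state_schemas M = ([T0], (One, One) # Pmonos M (\<lambda>p. fst p = 0)) #
     map (\<lambda>q. ([TSym (\<lambda>s. s \<noteq> 6)], map (\<lambda>p. (Pv True p, One)) (filter (\<lambda>p. fst p = q) (configs M)) @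
       Pmonos M (\<lambda>p. fst (moves M p) = q))) [0..<states M]"

text \<open>The last row has no successor and the last column no right neighbour. In the last column
  the cells are instead set to blank by \<open>blank_schemas\<close>.\<close>

definition cell_schemas :: "tm \<Rightarrow> schema list" where
  "cell_schemas M = map (\<lambda>(c, s, k, a). ([TSym (\<lambda>s. s \<noteq> 6), JSym (\<lambda>s. s \<noteq> 6), c],
      (V True Same (TC s k a), One) # concat (map (cell_monos M s k a c) (configs M))))
     (List.product [J0, J1, J2] (cells M))"

definition blank_schemas :: "tm \<Rightarrow> schema list" where
  "blank_schemas M = map (\<lambda>(s, k, a). value_schema [JSym (\<lambda>s. s = 6)] s k 0 a) (cells M) @
     map (\<lambda>(s, k, a). value_schema [T0] s k 0 a) (filter (\<lambda>(s, k, a). \<not> s \<or> k \<noteq> 0) (cells M))"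

definition input_schemas :: "tm \<Rightarrow> schema list" where
  "input_schemas M =
     map (\<lambda>(l, a). value_schema [T0, JSym (\<lambda>s. s = l)] True 0 l a) (List.product [1, 2, 3] [0..<symbols M]) @
     map (value_schema [T0, JSym (\<lambda>s. s = 5)] True 0 0) [0..<symbols M]"

text \<open>The witness columns are left free except for their shape: bits, a terminator 3, blanks.
  A symbol is followed by a blank iff it is a blank or 3. The column after the input terminator is
  not blank, but the column after the witness block is, so a terminator must occur inside the
  block.\<close>

definition witness_schemas :: "tm \<Rightarrow> schema list" where
  "witness_schemas M =
     map (\<lambda>a. ([T0, JSym (\<lambda>s. s = 4)], [(V False Same (TC True 0 a), One)])) [4..<symbols M] @
     [([T0, JSym (\<lambda>s. s = 4)], (One, One) # map (\<lambda>a. (V False Same (TC True 0 a), One)) [0..<4])] @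
     map (\<lambda>(a, a'). ([T0, JSym (\<lambda>s. s = 4)], [(V False Same (TC True 0 a), V False Same (TC True 0 a'))]))
       (filter (\<lambda>(a, a'). a \<noteq> a') (List.product [0..<4] [0..<4])) @
     [([T0, JSym (\<lambda>s. s = 4)], [(V False Next (TC True 0 0), One), (V False Same (TC True 0 0), One), (V False Same (TC True 0 3), One)]),
      ([T0, JSym (\<lambda>s. s = 3)], [(V False Next (TC True 0 0), One)])]"

text \<open>
  The output tape ends with either \<open>[2, 3]\<close> or \<open>[1, 3]\<close>, so acceptance means that the symbol 1 is absent.
\<close>

definition accept_schemas :: "tm \<Rightarrow> schema list" where
  "accept_schemas M = map (\<lambda>s. ([TSym (\<lambda>s. s = 6)], [(V False Same (TC s (tapes M - 1) 1), One)])) [True, False]"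

definition core_schemas :: "tm \<Rightarrow> schema list" where
  "core_schemas M = one_hot_schemas M @ scan_schemas M @ state_schemas M @ cell_schemas M @ blank_schemas M @
     input_schemas M @ witness_schemas M @ accept_schemas M"

fun vt_types :: "vt \<Rightarrow> ty list" where
  "vt_types One = []"
| "vt_types (V b c \<theta>) = [\<theta>]"

definition schema_types :: "schema list \<Rightarrow> ty list" where
  "schema_types ss = concat (map (\<lambda>s. concat (map (\<lambda>(a, b). vt_types a @ vt_types b) (snd s))) ss)"

text \<open>Rank one only says that the matrix is a product of two vectors. The added equations
  compare its first row and first column, which makes the vectors agree on all variables that
  occur.\<close>

definition schemas :: "tm \<Rightarrow> schema list" where
  "schemas M = core_schemas M @
     map (\<lambda>\<theta>. ([], [(V False Same \<theta>, One), (One, V False Same \<theta>)])) (schema_types (core_schemas M))"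

lemma distinct_tups: "distinct (tups N d)"
  using map_tidx_tups[of N d] distinct_map[of "tidx N" "tups N d"] by simp

lemma distinct_configs: "distinct (configs M)"
  by (simp add: configs_def distinct_product distinct_tups)

lemma set_configs: "set (configs M) = {0..<states M} \<times> Tup (symbols M) (tapes M)"
  by (simp add: configs_def set_tups)

lemma set_cells: "set (cells M) = UNIV \<times> {0..<tapes M} \<times> {0..<symbols M}"
  by (auto simp: cells_def)

lemma types_TP: "p \<in> set (configs M) \<Longrightarrow> TP (fst p) (snd p) \<in> set (types M)"
  by (auto simp: types_def)

lemma types_TC: "k < tapes M \<Longrightarrow> a < symbols M \<Longrightarrow> TC s k a \<in> set (types M)"
  unfolding types_def by (cases s) force+

section \<open>The equations hold exactly for accepting computations\<close>

definition cell :: "bool \<Rightarrow> tape \<Rightarrow> nat \<Rightarrow> nat" where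
  "cell s t j = (if s then fst t (snd t + int j) else fst t (snd t - 1 - int j))"

lemma cell_act:
  assumes "c \<in> {J0, J1, J2}" "holds y \<tau> j c"
  shows "cell s (act (w, mv) t) j = (case source s mv c of None \<Rightarrow> w
    | Some (s', c') \<Rightarrow> cell s' t (the (column c' j)))"
proof -
  have "int (j - 1) = int j - 1" if "j \<noteq> 0" using that by simp
  then show ?thesis using assms by (cases s; cases mv) (auto simp: cell_def act_def algebra_simps)
qed

lemma source_column:
  assumes "c \<in> {J0, J1, J2}" "holds y \<tau> j c" "source s mv c = Some (s', c')" "Suc j < N"
  shows "\<exists>j'. column c' j = Some j' \<and> j' < N \<and> c' \<noteq> C0"
  using assms by (cases s; cases mv) auto

lemma cover_cond: "\<exists>c\<in>{J0, J1, J2}. holds y \<tau> j c"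
  by auto

text \<open>The \<open>h\<close> columns must take the witness together with its terminator, so
  witnesses are shorter than \<open>h\<close>. The bound on codes places every variable of the
  machine inside the tableau.\<close>

locale encoded =
  fixes M :: tm and xx :: "bool list" and h g :: nat and N :: nat and y :: "nat list"
  assumes wf: "wf_tm M" and h: "1 \<le> h" and g: "1 \<le> g"
    and y: "y = map bit_sym xx @ 3 # replicate h 4 @ replicate g 5 @ [6]" and N: "N = length y"
    and codes: "\<And>\<theta>. \<theta> \<in> set (types M) \<Longrightarrow> code \<theta> < N"
begin

abbreviation "n \<equiv> length xx"
abbreviation "kk \<equiv> tapes M"
abbreviation "ns \<equiv> symbols M"

lemma N_eq: "N = n + h + g + 2" by (simp add: N y)

lemma M_pos: "0 < kk" "4 \<le> ns" "2 \<le> states M" using wf by (auto simp: wf_tm_def)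

lemma y_nth: "i < N \<Longrightarrow> y ! i = (if i < n then bit_sym (xx ! i) else if i = n then 3 else if i \<le> n + h then 4
    else if i \<le> n + h + g then 5 else 6)"
  unfolding N_eq y by (auto simp: nth_append nth_Cons' less_diff_conv)

lemma y6: "i < N \<Longrightarrow> y ! i = 6 \<longleftrightarrow> Suc i = N"
  by (auto simp: y_nth bit_sym_def N_eq)

lemma moves_wf:
  assumes "p \<in> set (configs M)"
  shows "fst (moves M p) < states M" "length (snd (moves M p)) = kk" "\<And>w m. (w, m) \<in> set (snd (moves M p)) \<Longrightarrow> w < ns"
proof -
  obtain q ss where p: "p = (q, ss)" "q < states M" "length ss = kk" "\<forall>s\<in>set ss. s < ns"
  proof -
    have "fst p < states M" "length (snd p) = kk" "\<forall>s\<in>set (snd p). s < ns"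
      using assms by (auto simp: set_configs Tup_def)
    then show ?thesis by (intro that[of "fst p" "snd p"]) auto
  qed
  have d: "case delta M q ss of (q', acts) \<Rightarrow> q' < states M \<and> length acts = kk \<and> (\<forall>(s, m)\<in>set acts. s < ns)"
  proof -
    have "\<forall>q ss. q < states M \<longrightarrow> length ss = tapes M \<longrightarrow> (\<forall>s\<in>set ss. s < symbols M) \<longrightarrow>
      (case delta M q ss of (q', acts) \<Rightarrow> q' < states M \<and> length acts = tapes M \<and> (\<forall>(s, m)\<in>set acts. s < symbols M))"
      using wf unfolding wf_tm_def by (elim conjE)
    from this[rule_format, OF p(2-3)] p(4) show ?thesis by simp
  qed
  obtain q' acts where e: "delta M q ss = (q', acts)" by fastforce
  have m: "moves M p = (if q = 1 then (1, map (\<lambda>s. (s, N_move)) ss) else (q', acts))"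
    by (simp add: moves_def p(1) e)
  have d': "q' < states M" "length acts = kk" "\<forall>(s, m)\<in>set acts. s < ns" using d by (simp_all add: e)
  show "fst (moves M p) < states M" "length (snd (moves M p)) = kk" using p(2-4) d' M_pos by (auto simp: m)
  show "w < ns" if "(w, mv) \<in> set (snd (moves M p))" for w mv
    using that p(4) d'(3) by (auto simp: m split: if_splits)
qed

definition scanned :: "config \<Rightarrow> nat \<times> nat list" where
  "scanned c = (fst c, map scan (snd c))"

lemma step_moves: "step M c = (fst (moves M (scanned c)), map2 act (snd (moves M (scanned c))) (snd c))"
proof -
  obtain q ts where c: "c = (q, ts)" by (cases c)
  show ?thesis
  proof (cases "q = 1")
    case True
    have "map2 act (map (\<lambda>s. (s, N_move)) (map scan ts)) ts = ts" by (induction ts) auto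
    then show ?thesis using True c by (simp add: step_def moves_def scanned_def)
  next
    case False
    then show ?thesis using c by (simp add: step_def moves_def scanned_def split: prod.splits)
  qed
qed

definition wf_config :: "config \<Rightarrow> bool" where
  "wf_config c \<longleftrightarrow> fst c < states M \<and> length (snd c) = kk \<and> (\<forall>t\<in>set (snd c). \<forall>i. fst t i < ns)"

lemma wf_config_scanned: "wf_config c \<Longrightarrow> scanned c \<in> set (configs M)"
  by (cases c) (auto simp: wf_config_def scanned_def set_configs Tup_def scan_def)

lemma wf_config_step:
  assumes "wf_config c"
  shows "wf_config (step M c)"
proof -
  note m = moves_wf[OF wf_config_scanned[OF assms]]
  have "fst t i < ns" if t: "t \<in> set (map2 act (snd (moves M (scanned c))) (snd c))" for t i
  proof -
    obtain a t0 where "t = act a t0" "(a, t0) \<in> set (zip (snd (moves M (scanned c))) (snd c))" using t by auto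
    then have "t = act a t0" "a \<in> set (snd (moves M (scanned c)))" "t0 \<in> set (snd c)"
      by (auto dest: set_zip_leftD set_zip_rightD)
    then show ?thesis using m(3)[of "fst a" "snd a"] assms by (auto simp: act_def wf_config_def)
  qed
  then show ?thesis using m(1,2) assms unfolding step_moves wf_config_def by auto
qed

lemma step_nth: "wf_config c \<Longrightarrow> k < kk \<Longrightarrow> snd (step M c) ! k = act (snd (moves M (scanned c)) ! k) (snd c ! k)"
  using moves_wf(2)[OF wf_config_scanned, of c] by (simp add: step_moves wf_config_def)

definition run :: "bool list \<Rightarrow> nat \<Rightarrow> config" where
  "run w \<tau> = (step M ^^ \<tau>) (init M (enc [xx, w]))"

lemma run_Suc: "run w (Suc \<tau>) = step M (run w \<tau>)" by (simp add: run_def)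

lemma contents_less: "(\<forall>a\<in>set v. a < s) \<Longrightarrow> 0 < s \<Longrightarrow> contents v i < s"
  unfolding contents_def by auto

lemma wf_run: "wf_config (run w \<tau>)"
proof (induction \<tau>)
  case 0
  have "contents (enc [xx, w]) i < ns" for i using M_pos by (intro contents_less) (auto simp: bit_sym_def)
  moreover have "contents [] i < ns" for i using M_pos by (intro contents_less) auto
  ultimately show ?case using M_pos by (auto simp: run_def init_def wf_config_def)
next
  case (Suc \<tau>)
  then show ?case unfolding run_Suc by (rule wf_config_step)
qed

text \<open>A head moves by at most one cell per step, and nonblank symbols appear only where a head
  has been.\<close>

lemma run_bound:
  assumes "k < kk"
  shows "\<bar>snd (snd (run w \<tau>) ! k)\<bar> \<le> int \<tau> \<and>
    (\<forall>i. fst (snd (run w \<tau>) ! k) i \<noteq> 0 \<longrightarrow> - int \<tau> \<le> i \<and> i < int (length (enc [xx, w])) + int \<tau>)"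
proof (induction \<tau>)
  case 0
  have "snd (run w 0) ! k = (contents (enc [xx, w]), 0) \<or> snd (run w 0) ! k = (contents [], 0)"
    using assms by (cases k) (auto simp: run_def init_def)
  then show ?case by (auto simp: contents_def split: if_splits)
next
  case (Suc \<tau>)
  define a t where "a = snd (moves M (scanned (run w \<tau>))) ! k" and "t = snd (run w \<tau>) ! k"
  have e: "snd (run w (Suc \<tau>)) ! k = act a t" unfolding run_Suc a_def t_def by (rule step_nth[OF wf_run assms])
  have "\<bar>move_offset (snd a)\<bar> \<le> 1" by (cases "snd a") auto
  moreover have "\<bar>snd t\<bar> \<le> int \<tau>" "\<And>i. fst t i \<noteq> 0 \<Longrightarrow> - int \<tau> \<le> i \<and> i < int (length (enc [xx, w])) + int \<tau>"
    using Suc unfolding t_def by auto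
  moreover have "- int (Suc \<tau>) \<le> i \<and> i < int (length (enc [xx, w])) + int (Suc \<tau>)" if "fst (act a t) i \<noteq> 0" for i
    using that calculation(2,3) by (cases "i = snd t") (fastforce simp: act_def)+
  ultimately show ?case unfolding e by (auto simp: act_def)
qed

lemma run_halted:
  assumes "fst (run w T) = 1" "T \<le> \<tau>"
  shows "run w \<tau> = run w T"
  using assms(2)
proof (induction \<tau> rule: dec_induct)
  case (step \<tau>)
  have "step M (run w T) = run w T" using assms(1) by (cases "run w T") (simp add: step_def)
  then show ?case using step by (simp add: run_Suc)
qed simp

context
  fixes X :: "nat list \<Rightarrow> bool"
  assumes X0: "X [0, 0, 0]"
begin

definition hist :: "nat \<Rightarrow> nat \<Rightarrow> ty \<Rightarrow> bool" where
  "hist \<tau> j \<theta> \<longleftrightarrow> X [\<tau>, j, code \<theta>]"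

lemma mval_simps:
  "mval X N \<tau> j One"
  "\<theta> \<in> set (types M) \<Longrightarrow> \<tau> < N \<Longrightarrow> j < N \<Longrightarrow> mval X N \<tau> j (V False Same \<theta>) = hist \<tau> j \<theta>"
  "\<theta> \<in> set (types M) \<Longrightarrow> \<tau> < N \<Longrightarrow> mval X N \<tau> j (V False C0 \<theta>) = hist \<tau> 0 \<theta>"
  "\<theta> \<in> set (types M) \<Longrightarrow> Suc \<tau> < N \<Longrightarrow> mval X N \<tau> j (V True C0 \<theta>) = hist (Suc \<tau>) 0 \<theta>"
  "\<theta> \<in> set (types M) \<Longrightarrow> Suc \<tau> < N \<Longrightarrow> j < N \<Longrightarrow> mval X N \<tau> j (V True Same \<theta>) = hist (Suc \<tau>) j \<theta>"
  "\<theta> \<in> set (types M) \<Longrightarrow> \<tau> < N \<Longrightarrow> column c j = Some j' \<Longrightarrow> j' < N \<Longrightarrow> mval X N \<tau> j (V False c \<theta>) = hist \<tau> j' \<theta>"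
  using X0 codes[of \<theta>] by (auto simp: mval_def hist_def)

definition P_match :: "nat \<Rightarrow> nat \<times> nat list \<Rightarrow> bool" where
  "P_match \<tau> r \<longleftrightarrow> (\<forall>p\<in>set (configs M). hist \<tau> 0 (TP (fst p) (snd p)) \<longleftrightarrow> p = r)"

definition C_match :: "nat \<Rightarrow> tape list \<Rightarrow> bool" where
  "C_match \<tau> ts \<longleftrightarrow> (\<forall>s. \<forall>k<kk. \<forall>a<ns. \<forall>j<N. hist \<tau> j (TC s k a) \<longleftrightarrow> cell s (ts ! k) j = a)"

abbreviation ok :: "nat \<Rightarrow> nat \<Rightarrow> schema \<Rightarrow> bool" where "ok \<equiv> schema_ok X y"
abbreviation num :: "nat \<Rightarrow> nat \<Rightarrow> (vt \<times> vt) list \<Rightarrow> nat" where "num \<equiv> cnt X N"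

lemma ok_iff: "ok \<tau> j s \<longleftrightarrow> ((\<forall>c\<in>set (fst s). holds y \<tau> j c) \<longrightarrow> even (num \<tau> j (snd s)))"
  by (simp add: schema_ok_def N)

lemma mval_P: "p \<in> set (configs M) \<Longrightarrow> \<tau> < N \<Longrightarrow> mval X N \<tau> j (Pv False p) = hist \<tau> 0 (TP (fst p) (snd p))"
  unfolding Pv_def by (intro mval_simps types_TP)

lemma mval_P': "p \<in> set (configs M) \<Longrightarrow> Suc \<tau> < N \<Longrightarrow> mval X N \<tau> j (Pv True p) = hist (Suc \<tau>) 0 (TP (fst p) (snd p))"
  unfolding Pv_def by (intro mval_simps types_TP)

lemma length_filter_eq: "distinct ps \<Longrightarrow> r \<in> set ps \<Longrightarrow> length (filter (\<lambda>p. p = r \<and> Q p) ps) = of_bool (Q r)"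
  by (induction ps) (auto simp: filter_empty_conv)

lemma num_map_One: "num \<tau> j (map (\<lambda>p. (f p, One)) ps) = length (filter (\<lambda>p. mval X N \<tau> j (f p)) ps)"
  by (induction ps) (auto simp: mval_simps(1))

lemma num_Pmonos:
  assumes "P_match \<tau> r" "r \<in> set (configs M)" "\<tau> < N"
  shows "num \<tau> j (Pmonos M Q) = of_bool (Q r)"
proof -
  have "num \<tau> j (Pmonos M Q) = length (filter (\<lambda>p. p = r \<and> Q p) (configs M))"
    unfolding Pmonos_def num_map_One filter_filter
    using assms mval_P unfolding P_match_def by (intro arg_cong[where f = length] filter_cong) auto
  then show ?thesis using length_filter_eq[OF distinct_configs assms(2)] by simp
qed

lemma num_Pmonos':
  assumes "P_match (Suc \<tau>) r" "r \<in> set (configs M)" "Suc \<tau> < N"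
  shows "num \<tau> j (map (\<lambda>p. (Pv True p, One)) (filter Q (configs M))) = of_bool (Q r)"
proof -
  have "num \<tau> j (map (\<lambda>p. (Pv True p, One)) (filter Q (configs M))) = length (filter (\<lambda>p. p = r \<and> Q p) (configs M))"
    unfolding num_map_One filter_filter
    using assms mval_P' unfolding P_match_def by (intro arg_cong[where f = length] filter_cong) auto
  then show ?thesis using length_filter_eq[OF distinct_configs assms(2)] by simp
qed

lemma num_concat_zero: "(\<And>p. p \<in> set ps \<Longrightarrow> num \<tau> j (f p) = 0) \<Longrightarrow> num \<tau> j (concat (map f ps)) = 0"
  by (induction ps) auto

lemma num_concat:
  "distinct ps \<Longrightarrow> r \<in> set ps \<Longrightarrow> (\<And>p. p \<in> set ps \<Longrightarrow> p \<noteq> r \<Longrightarrow> num \<tau> j (f p) = 0) \<Longrightarrow>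
    num \<tau> j (concat (map f ps)) = num \<tau> j (f r)"
proof (induction ps)
  case (Cons a ps)
  show ?case
  proof (cases "a = r")
    case True
    then have "num \<tau> j (concat (map f ps)) = 0" using Cons.prems by (intro num_concat_zero) auto
    then show ?thesis using True by simp
  next
    case False
    then have "num \<tau> j (f a) = 0" using Cons.prems by simp
    moreover have "num \<tau> j (concat (map f ps)) = num \<tau> j (f r)" using Cons False by simp
    ultimately show ?thesis by simp
  qed
qed simp

lemma ok_value_schema:
  assumes "k < kk" "a < ns" "\<tau> < N" "j < N"
  shows "ok \<tau> j (value_schema cs s k v a) \<longleftrightarrow> ((\<forall>c\<in>set cs. holds y \<tau> j c) \<longrightarrow> (hist \<tau> j (TC s k a) \<longleftrightarrow> a = v))"
  using assms by (auto simp: ok_iff value_schema_def mval_simps types_TC)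

text \<open>Only the configuration that is present contributes to the sum over
  \<open>configs\<close>, and its product reads the cell from which the symbol comes.\<close>

lemma ok_cell_schema:
  assumes c: "c \<in> {J0, J1, J2}" "holds y \<tau> j c" and k: "k < kk" "a < ns" and \<tau>: "Suc \<tau> < N" "Suc j < N"
    and P: "P_match \<tau> (scanned cf)" "wf_config cf" and C: "C_match \<tau> (snd cf)"
  shows "ok \<tau> j ([TSym (\<lambda>s. s \<noteq> 6), JSym (\<lambda>s. s \<noteq> 6), c], (V True Same (TC s k a), One) # concat (map (cell_monos M s k a c) (configs M)))
    \<longleftrightarrow> (hist (Suc \<tau>) j (TC s k a) \<longleftrightarrow> cell s (snd (step M cf) ! k) j = a)"
proof -
  let ?r = "scanned cf"
  note r = wf_config_scanned[OF P(2)]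
  have "num \<tau> j (cell_monos M s k a c p) = 0" if "p \<in> set (configs M)" "p \<noteq> ?r" for p
    using that P \<tau> by (auto simp: cell_monos_def mval_P P_match_def split: prod.splits option.splits)
  then have "num \<tau> j (concat (map (cell_monos M s k a c) (configs M))) = num \<tau> j (cell_monos M s k a c ?r)"
    by (intro num_concat distinct_configs r)
  also have "\<dots> = of_bool (cell s (snd (step M cf) ! k) j = a)"
  proof -
    obtain w mv where a: "snd (moves M ?r) ! k = (w, mv)" by (metis surj_pair)
    have cs: "cell s (snd (step M cf) ! k) j = (case source s mv c of None \<Rightarrow> w
      | Some (s', c') \<Rightarrow> cell s' (snd cf ! k) (the (column c' j)))"
      unfolding step_nth[OF P(2) k(1)] a by (rule cell_act[OF c])
    have Pr: "mval X N \<tau> j (Pv False ?r)" using r P \<tau> by (simp add: mval_P P_match_def)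
    show ?thesis
    proof (cases "source s mv c")
      case None
      then show ?thesis using Pr by (simp add: cell_monos_def a cs mval_simps(1))
    next
      case (Some sc)
      obtain s' c' where sc: "sc = (s', c')" by (cases sc)
      then obtain j' where j': "column c' j = Some j'" "j' < N" using source_column[OF c] Some \<tau>(2) by blast
      have "mval X N \<tau> j (V False c' (TC s' k a)) = hist \<tau> j' (TC s' k a)"
        using j' k \<tau> by (intro mval_simps types_TC) auto
      also have "\<dots> = (cell s' (snd cf ! k) j' = a)" using C k j' by (simp add: C_match_def)
      finally show ?thesis using Some Pr sc j' by (simp add: cell_monos_def a cs)
    qed
  qed
  finally show ?thesis using c \<tau> k y6[of \<tau>] y6[of j]
    by (auto simp: ok_iff mval_simps types_TC)
qed

lemma ok_scan_schema:
  assumes "P_match \<tau> r" "r \<in> set (configs M)" "\<tau> < N" "k < kk" "a < ns"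
  shows "ok \<tau> j ([], (V False C0 (TC True k a), One) # Pmonos M (\<lambda>p. snd p ! k = a)) \<longleftrightarrow>
    (hist \<tau> 0 (TC True k a) \<longleftrightarrow> snd r ! k = a)"
  using assms by (auto simp: ok_iff mval_simps types_TC num_Pmonos)

lemma ok_state_schema:
  assumes "P_match \<tau> r" "r \<in> set (configs M)" "P_match (Suc \<tau>) r'" "r' \<in> set (configs M)" "Suc \<tau> < N"
  shows "ok \<tau> j ([TSym (\<lambda>s. s \<noteq> 6)], map (\<lambda>p. (Pv True p, One)) (filter (\<lambda>p. fst p = q) (configs M)) @
       Pmonos M (\<lambda>p. fst (moves M p) = q)) \<longleftrightarrow> (fst r' = q \<longleftrightarrow> fst (moves M r) = q)"
  using assms y6[of \<tau>] by (auto simp: ok_iff num_Pmonos num_Pmonos')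

lemma ok_init_schema:
  assumes "P_match 0 r" "r \<in> set (configs M)"
  shows "ok 0 j ([T0], (One, One) # Pmonos M (\<lambda>p. fst p = 0)) \<longleftrightarrow> fst r = 0"
proof -
  have "0 < N" using N_eq by simp
  then show ?thesis using assms by (auto simp: ok_iff num_Pmonos mval_simps)
qed

lemma one_hot:
  assumes ok: "\<And>s. s \<in> set (one_hot_schemas M) \<Longrightarrow> ok \<tau> 0 s" and \<tau>: "\<tau> < N"
  shows "\<exists>r\<in>set (configs M). P_match \<tau> r"
proof -
  have "ok \<tau> 0 ([], (One, One) # Pmonos M (\<lambda>_. True))" by (rule ok) (simp add: one_hot_schemas_def)
  then have "odd (num \<tau> 0 (Pmonos M (\<lambda>_. True)))" by (simp add: ok_iff mval_simps)
  then have "filter (\<lambda>p. mval X N \<tau> 0 (Pv False p)) (configs M) \<noteq> []"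
    unfolding Pmonos_def num_map_One by (auto simp del: filter_empty_conv)
  then obtain r where r: "r \<in> set (configs M)" "mval X N \<tau> 0 (Pv False r)" by (auto simp: filter_empty_conv)
  have "\<not> mval X N \<tau> 0 (Pv False p)" if "p \<in> set (configs M)" "p \<noteq> r" for p
  proof -
    have "ok \<tau> 0 ([], [(Pv False p, Pv False r)])"
      using that r by (intro ok) (auto simp: one_hot_schemas_def)
    then show ?thesis using r by (auto simp: ok_iff)
  qed
  then have "P_match \<tau> r" unfolding P_match_def using r mval_P[OF _ \<tau>] by auto
  then show ?thesis using r by blast
qed

end

end

text \<open>By induction on the number of columns: after a 3 everything is blank; otherwise the
  first symbol is a bit whose successor is not blank, so the rest has the same shape. The blank at
  \<open>h\<close> forces the 3 to occur before it.\<close>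

lemma witness_shape:
  fixes f :: "nat \<Rightarrow> nat"
  assumes "1 \<le> h" "\<And>i. i < h \<Longrightarrow> f i < 4" "\<And>i. i < h \<Longrightarrow> f (Suc i) = 0 \<longleftrightarrow> f i = 0 \<or> f i = 3" "f h = 0" "f 0 \<noteq> 0"
  shows "\<exists>w. length w < h \<and> (\<forall>i\<le>h. f i = contents (map bit_sym w @ [3]) (int i))"
  using assms
proof (induction h arbitrary: f)
  case (Suc h)
  show ?case
  proof (cases "f 0 = 3")
    case True
    have "f i = 0" if "0 < i" "i \<le> Suc h" for i
      using that
    proof (induction i)
      case (Suc i)
      then show ?case using Suc.prems Suc.IH \<open>f 0 = 3\<close> \<open>\<And>i. i < Suc h \<Longrightarrow> f (Suc i) = 0 \<longleftrightarrow> f i = 0 \<or> f i = 3\<close>[of i]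
        by (cases "i = 0") auto
    qed simp
    then have "\<forall>i\<le>Suc h. f i = contents (map bit_sym [] @ [3]) (int i)"
      using True by (auto simp: contents_def)
    then show ?thesis by (intro exI[of _ "[]"]) simp
  next
    case False
    then have "f 0 = 1 \<or> f 0 = 2" using Suc.prems(2)[of 0] Suc.prems(5) by auto
    then obtain b where f0: "f 0 = bit_sym b" by (metis bit_sym_def)
    have f1: "f (Suc 0) \<noteq> 0" using Suc.prems(3)[of 0] False Suc.prems(5) by simp
    then have "1 \<le> h" using Suc.prems(4) by (cases h) auto
    then obtain w where w: "length w < h" "\<forall>i\<le>h. f (Suc i) = contents (map bit_sym w @ [3]) (int i)"
      using Suc.IH[of "\<lambda>i. f (Suc i)"] Suc.prems f1 by auto
    have "f i = contents (map bit_sym (b # w) @ [3]) (int i)" if "i \<le> Suc h" for i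
    proof (cases i)
      case 0
      then show ?thesis using f0 by (auto simp: contents_def bit_sym_def)
    next
      case (Suc k)
      then show ?thesis
        using that w(2) contents_append_right[of "[bit_sym b]" "map bit_sym w @ [3]" k] by simp
    qed
    then show ?thesis using w(1) by (intro exI[of _ "b # w"] conjI allI impI) simp_all
  qed
qed simp

lemma core_schemas_mem:
  "s \<in> set (one_hot_schemas M) \<Longrightarrow> s \<in> set (core_schemas M)"
  "s \<in> set (scan_schemas M) \<Longrightarrow> s \<in> set (core_schemas M)"
  "s \<in> set (state_schemas M) \<Longrightarrow> s \<in> set (core_schemas M)"
  "s \<in> set (cell_schemas M) \<Longrightarrow> s \<in> set (core_schemas M)"
  "s \<in> set (blank_schemas M) \<Longrightarrow> s \<in> set (core_schemas M)"
  "s \<in> set (input_schemas M) \<Longrightarrow> s \<in> set (core_schemas M)"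
  "s \<in> set (witness_schemas M) \<Longrightarrow> s \<in> set (core_schemas M)"
  "s \<in> set (accept_schemas M) \<Longrightarrow> s \<in> set (core_schemas M)"
  by (simp_all add: core_schemas_def)

lemma schema_mem:
  "k < tapes M \<Longrightarrow> a < symbols M \<Longrightarrow>
    ([], (V False C0 (TC True k a), One) # Pmonos M (\<lambda>p. snd p ! k = a)) \<in> set (core_schemas M)"
  "([T0], (One, One) # Pmonos M (\<lambda>p. fst p = 0)) \<in> set (core_schemas M)"
  "q < states M \<Longrightarrow> ([TSym (\<lambda>s. s \<noteq> 6)], map (\<lambda>p. (Pv True p, One)) (filter (\<lambda>p. fst p = q) (configs M)) @
       Pmonos M (\<lambda>p. fst (moves M p) = q)) \<in> set (core_schemas M)"
  "c \<in> {J0, J1, J2} \<Longrightarrow> k < tapes M \<Longrightarrow> a < symbols M \<Longrightarrow> ([TSym (\<lambda>s. s \<noteq> 6), JSym (\<lambda>s. s \<noteq> 6), c],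
      (V True Same (TC b k a), One) # concat (map (cell_monos M b k a c) (configs M))) \<in> set (core_schemas M)"
  "k < tapes M \<Longrightarrow> a < symbols M \<Longrightarrow> value_schema [JSym (\<lambda>s. s = 6)] b k 0 a \<in> set (core_schemas M)"
  "k < tapes M \<Longrightarrow> a < symbols M \<Longrightarrow> \<not> b \<or> k \<noteq> 0 \<Longrightarrow> value_schema [T0] b k 0 a \<in> set (core_schemas M)"
  "l \<in> {1, 2, 3} \<Longrightarrow> a < symbols M \<Longrightarrow> value_schema [T0, JSym (\<lambda>s. s = l)] True 0 l a \<in> set (core_schemas M)"
  "a < symbols M \<Longrightarrow> value_schema [T0, JSym (\<lambda>s. s = 5)] True 0 0 a \<in> set (core_schemas M)"
  "4 \<le> a \<Longrightarrow> a < symbols M \<Longrightarrow> ([T0, JSym (\<lambda>s. s = 4)], [(V False Same (TC True 0 a), One)]) \<in> set (core_schemas M)"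
  "([T0, JSym (\<lambda>s. s = 4)], (One, One) # map (\<lambda>a. (V False Same (TC True 0 a), One)) [0..<4]) \<in> set (core_schemas M)"
  "a < 4 \<Longrightarrow> a' < 4 \<Longrightarrow> a \<noteq> a' \<Longrightarrow>
    ([T0, JSym (\<lambda>s. s = 4)], [(V False Same (TC True 0 a), V False Same (TC True 0 a'))]) \<in> set (core_schemas M)"
  "([T0, JSym (\<lambda>s. s = 4)], [(V False Next (TC True 0 0), One), (V False Same (TC True 0 0), One), (V False Same (TC True 0 3), One)])
    \<in> set (core_schemas M)"
  "([T0, JSym (\<lambda>s. s = 3)], [(V False Next (TC True 0 0), One)]) \<in> set (core_schemas M)"
  "([TSym (\<lambda>s. s = 6)], [(V False Same (TC b (tapes M - 1) 1), One)]) \<in> set (core_schemas M)"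
proof -
  note defs = one_hot_schemas_def scan_schemas_def state_schemas_def cell_schemas_def blank_schemas_def
    input_schemas_def witness_schemas_def accept_schemas_def set_append set_map list.set
  show "k < tapes M \<Longrightarrow> a < symbols M \<Longrightarrow>
    ([], (V False C0 (TC True k a), One) # Pmonos M (\<lambda>p. snd p ! k = a)) \<in> set (core_schemas M)"
    by (rule core_schemas_mem(2)) (unfold defs, rule image_eqI[of _ _ "(k, a)"], simp_all)
  show "([T0], (One, One) # Pmonos M (\<lambda>p. fst p = 0)) \<in> set (core_schemas M)"
    by (rule core_schemas_mem(3)) (simp add: defs)
  show "q < states M \<Longrightarrow> ([TSym (\<lambda>s. s \<noteq> 6)], map (\<lambda>p. (Pv True p, One)) (filter (\<lambda>p. fst p = q) (configs M)) @
       Pmonos M (\<lambda>p. fst (moves M p) = q)) \<in> set (core_schemas M)"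
    by (rule core_schemas_mem(3)) (unfold defs, rule insertI2, rule image_eqI[of _ _ q], simp_all)
  show "c \<in> {J0, J1, J2} \<Longrightarrow> k < tapes M \<Longrightarrow> a < symbols M \<Longrightarrow> ([TSym (\<lambda>s. s \<noteq> 6), JSym (\<lambda>s. s \<noteq> 6), c],
      (V True Same (TC b k a), One) # concat (map (cell_monos M b k a c) (configs M))) \<in> set (core_schemas M)"
    by (rule core_schemas_mem(4)) (unfold defs, rule image_eqI[of _ _ "(c, b, k, a)"], auto simp: set_cells)
  show "k < tapes M \<Longrightarrow> a < symbols M \<Longrightarrow> value_schema [JSym (\<lambda>s. s = 6)] b k 0 a \<in> set (core_schemas M)"
    by (rule core_schemas_mem(5)) (unfold defs, rule UnI1, rule image_eqI[of _ _ "(b, k, a)"], auto simp: set_cells)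
  show "k < tapes M \<Longrightarrow> a < symbols M \<Longrightarrow> \<not> b \<or> k \<noteq> 0 \<Longrightarrow> value_schema [T0] b k 0 a \<in> set (core_schemas M)"
    by (rule core_schemas_mem(5)) (unfold defs, rule UnI2, rule image_eqI[of _ _ "(b, k, a)"], auto simp: set_cells)
  show "l \<in> {1, 2, 3} \<Longrightarrow> a < symbols M \<Longrightarrow> value_schema [T0, JSym (\<lambda>s. s = l)] True 0 l a \<in> set (core_schemas M)"
    by (rule core_schemas_mem(6)) (unfold defs, rule UnI1, rule image_eqI[of _ _ "(l, a)"], auto)
  show "a < symbols M \<Longrightarrow> value_schema [T0, JSym (\<lambda>s. s = 5)] True 0 0 a \<in> set (core_schemas M)"
    by (rule core_schemas_mem(6)) (unfold defs, rule UnI2, rule image_eqI[of _ _ a], auto)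
  show "4 \<le> a \<Longrightarrow> a < symbols M \<Longrightarrow> ([T0, JSym (\<lambda>s. s = 4)], [(V False Same (TC True 0 a), One)]) \<in> set (core_schemas M)"
    by (rule core_schemas_mem(7)) (unfold defs, rule UnI1, rule image_eqI[of _ _ a], auto)
  show "([T0, JSym (\<lambda>s. s = 4)], (One, One) # map (\<lambda>a. (V False Same (TC True 0 a), One)) [0..<4]) \<in> set (core_schemas M)"
    by (rule core_schemas_mem(7)) (unfold defs, rule UnI2, rule UnI1, rule singletonI)
  show "a < 4 \<Longrightarrow> a' < 4 \<Longrightarrow> a \<noteq> a' \<Longrightarrow>
    ([T0, JSym (\<lambda>s. s = 4)], [(V False Same (TC True 0 a), V False Same (TC True 0 a'))]) \<in> set (core_schemas M)"
    by (rule core_schemas_mem(7)) (unfold defs, rule UnI2, rule UnI2, rule UnI1, rule image_eqI[of _ _ "(a, a')"], auto)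
  show "([T0, JSym (\<lambda>s. s = 4)], [(V False Next (TC True 0 0), One), (V False Same (TC True 0 0), One), (V False Same (TC True 0 3), One)])
    \<in> set (core_schemas M)"
    by (rule core_schemas_mem(7)) (unfold defs, rule UnI2, rule UnI2, rule UnI2, rule insertI1)
  show "([T0, JSym (\<lambda>s. s = 3)], [(V False Next (TC True 0 0), One)]) \<in> set (core_schemas M)"
    by (rule core_schemas_mem(7)) (unfold defs, rule UnI2, rule UnI2, rule UnI2, rule insertI2, rule singletonI)
  show "([TSym (\<lambda>s. s = 6)], [(V False Same (TC b (tapes M - 1) 1), One)]) \<in> set (core_schemas M)"
    by (rule core_schemas_mem(8)) (unfold defs, rule image_eqI[of _ _ b], auto)
qed

section \<open>Solutions of the equations yield accepting runs\<close>

context encoded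
begin

lemma ok_witness_schemas:
  assumes X0: "X [0, 0, 0]" and j: "j < N" "y ! j = 4"
  defines "H \<equiv> (\<lambda>a. hist X 0 j (TC True 0 a))"
  shows "(\<forall>a\<in>{4..<ns}. ok X 0 j ([T0, JSym (\<lambda>s. s = 4)], [(V False Same (TC True 0 a), One)])) \<longleftrightarrow> (\<forall>a\<in>{4..<ns}. \<not> H a)"
    "ok X 0 j ([T0, JSym (\<lambda>s. s = 4)], (One, One) # map (\<lambda>a. (V False Same (TC True 0 a), One)) [0..<4]) \<longleftrightarrow>
      odd (of_bool (H 0) + of_bool (H 1) + of_bool (H 2) + of_bool (H 3) :: nat)"
    "a < 4 \<Longrightarrow> a' < 4 \<Longrightarrow> ok X 0 j ([T0, JSym (\<lambda>s. s = 4)], [(V False Same (TC True 0 a), V False Same (TC True 0 a'))]) \<longleftrightarrow>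
      \<not> (H a \<and> H a')"
    "Suc j < N \<Longrightarrow> ok X 0 j ([T0, JSym (\<lambda>s. s = 4)], [(V False Next (TC True 0 0), One), (V False Same (TC True 0 0), One),
      (V False Same (TC True 0 3), One)]) \<longleftrightarrow> even (of_bool (hist X 0 (Suc j) (TC True 0 0)) + of_bool (H 0) + of_bool (H 3) :: nat)"
proof -
  have mv: "mval X N 0 j (V False Same (TC True 0 a)) = H a" if "a < ns" for a
    using mval_simps(2)[where X = X, OF X0, of "TC True 0 a" 0 j] that j types_TC[of 0 M a True] M_pos
      by (simp add: H_def)
  have mn: "Suc j < N \<Longrightarrow> mval X N 0 j (V False Next (TC True 0 0)) = hist X 0 (Suc j) (TC True 0 0)"
    using mval_simps(6)[where X = X, OF X0, of "TC True 0 0" 0 Next j "Suc j"] types_TC[of 0 M 0 True] M_pos by simp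
  have One: "mval X N 0 j One" using mval_simps(1)[where X = X, OF X0] .
  have u: "[0..<4] = [0, 1, 2, 3::nat]" by (simp add: upt_rec)
  have ns: "0 < ns" "Suc 0 < ns" "2 < ns" "3 < ns" using M_pos by auto
  show "(\<forall>a\<in>{4..<ns}. ok X 0 j ([T0, JSym (\<lambda>s. s = 4)], [(V False Same (TC True 0 a), One)])) \<longleftrightarrow> (\<forall>a\<in>{4..<ns}. \<not> H a)"
    by (auto simp: ok_iff[where X = X, OF X0] mv One j)
  show "ok X 0 j ([T0, JSym (\<lambda>s. s = 4)], (One, One) # map (\<lambda>a. (V False Same (TC True 0 a), One)) [0..<4]) \<longleftrightarrow>
      odd (of_bool (H 0) + of_bool (H 1) + of_bool (H 2) + of_bool (H 3) :: nat)"
    unfolding u by (simp add: ok_iff[where X = X, OF X0] mv One j ns)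
  show "ok X 0 j ([T0, JSym (\<lambda>s. s = 4)], [(V False Same (TC True 0 a), V False Same (TC True 0 a'))]) \<longleftrightarrow> \<not> (H a \<and> H a')"
    if "a < 4" "a' < 4"
    using that M_pos by (auto simp: ok_iff[where X = X, OF X0] mv j)
  show "ok X 0 j ([T0, JSym (\<lambda>s. s = 4)], [(V False Next (TC True 0 0), One), (V False Same (TC True 0 0), One),
      (V False Same (TC True 0 3), One)]) \<longleftrightarrow> even (of_bool (hist X 0 (Suc j) (TC True 0 0)) + of_bool (H 0) + of_bool (H 3) :: nat)"
    if "Suc j < N"
    using that by (simp add: ok_iff[where X = X, OF X0] mv mn One j ns)
qed

lemma ok_start_schema:
  assumes X0: "X [0, 0, 0]" and j: "Suc j < N" "y ! j = 3"
  shows "ok X 0 j ([T0, JSym (\<lambda>s. s = 3)], [(V False Next (TC True 0 0), One)]) \<longleftrightarrow> \<not> hist X 0 (Suc j) (TC True 0 0)"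
  using mval_simps(6)[where X = X, OF X0, of "TC True 0 0" 0 Next j "Suc j"] types_TC[of 0 M 0 True] M_pos j
  by (simp add: ok_iff[where X = X, OF X0] mval_simps(1)[where X = X, OF X0])

lemma ok_accept_schema:
  assumes X0: "X [0, 0, 0]" and "Suc \<tau> = N" "j < N"
  shows "ok X \<tau> j ([TSym (\<lambda>s. s = 6)], [(V False Same (TC s (kk - 1) 1), One)]) \<longleftrightarrow> \<not> hist X \<tau> j (TC s (kk - 1) 1)"
proof -
  have "\<tau> < N" "kk - 1 < kk" "1 < ns" using assms M_pos by auto
  then show ?thesis using assms y6[of \<tau>] types_TC[of "kk - 1" M 1 s]
    by (simp add: ok_iff[where X = X, OF X0] mval_simps[where X = X, OF X0])
qed

lemma enc_xx: "enc [xx, w] = (map bit_sym xx @ [3]) @ (map bit_sym w @ [3])" by simp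

lemma initial_cell:
  "k < kk \<Longrightarrow> cell s (snd (run w 0) ! k) j = (if s \<and> k = 0 then contents (enc [xx, w]) (int j) else 0)"
  by (cases k) (auto simp: run_def init_def cell_def contents_def)

lemma initial_left: "j \<le> n \<Longrightarrow> contents (enc [xx, w]) (int j) = y ! j"
  unfolding y by (auto simp: contents_def nth_append)

lemma initial_right: "contents (enc [xx, w]) (int (Suc n + i)) = contents (map bit_sym w @ [3]) (int i)"
  using contents_append_right[of "map bit_sym xx @ [3]" "map bit_sym w @ [3]" i] unfolding enc_xx by simp

context
  fixes T :: nat and acc :: "bool list \<Rightarrow> bool"
  assumes out: "\<And>w. length w < h \<Longrightarrow> outputs_within M (enc [xx, w]) (enc [[acc w]]) T" and T: "2 * T < g"
begin

lemma halting:
  assumes "length w < h"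
  obtains t0 where "t0 \<le> T" "\<And>\<tau>. t0 \<le> \<tau> \<Longrightarrow> run w \<tau> = run w t0" "fst (last (snd (run w t0))) = contents (enc [[acc w]])"
proof -
  obtain t0 where t0: "t0 \<le> T" "fst (run w t0) = 1" "fst (last (snd (run w t0))) = contents (enc [[acc w]])"
    using out[OF assms] unfolding outputs_within_def run_def[symmetric] by (auto simp: case_prod_unfold)
  show ?thesis by (rule that[OF t0(1) run_halted[OF t0(2)] t0(3)])
qed

text \<open>A halted run no longer changes, so the bounds for time \<open>T\<close> hold at all
  times.\<close>

lemma run_bound_T:
  assumes w: "length w < h" and k: "k < kk"
  shows "\<bar>snd (snd (run w \<tau>) ! k)\<bar> \<le> int T"
    "fst (snd (run w \<tau>) ! k) i \<noteq> 0 \<Longrightarrow> - int T \<le> i \<and> i < int (n + h + 1) + int T"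
proof -
  obtain t0 where t0: "t0 \<le> T" "\<And>\<tau>. t0 \<le> \<tau> \<Longrightarrow> run w \<tau> = run w t0" using halting[OF w] by blast
  define \<tau>' where "\<tau>' = min \<tau> t0"
  have e: "run w \<tau> = run w \<tau>'" using t0(2)[of \<tau>] by (auto simp: \<tau>'_def min_def)
  have le: "\<tau>' \<le> T" using t0 by (simp add: \<tau>'_def)
  have "length (enc [xx, w]) \<le> n + h + 1" using w by simp
  note b = run_bound[OF k, of w \<tau>']
  show "\<bar>snd (snd (run w \<tau>) ! k)\<bar> \<le> int T" unfolding e using b le by linarith
  show "fst (snd (run w \<tau>) ! k) i \<noteq> 0 \<Longrightarrow> - int T \<le> i \<and> i < int (n + h + 1) + int T"
    unfolding e using b le \<open>length (enc [xx, w]) \<le> n + h + 1\<close> by fastforce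
qed

text \<open>The written area reaches at most \<open>T\<close> cells beyond the input and the head
  strays at most \<open>T\<close> cells from its start. Hence all is blank from distance
  \<open>n + h + 1 + 2 * T\<close> on, and \<open>2 * T < g\<close> puts the last column
  there.\<close>

lemma blank_far:
  assumes w: "length w < h" and k: "k < kk" and j: "N \<le> Suc j"
  shows "cell s (snd (run w \<tau>) ! k) j = 0"
proof (rule ccontr)
  assume nz: "cell s (snd (run w \<tau>) ! k) j \<noteq> 0"
  have j': "int (n + h + g + 1) \<le> int j" using j N_eq by simp
  have p: "\<bar>snd (snd (run w \<tau>) ! k)\<bar> \<le> int T" by (rule run_bound_T[OF w k])
  show False
  proof (cases s)
    case True
    then show False using nz run_bound_T(2)[OF w k, of \<tau> "snd (snd (run w \<tau>) ! k) + int j"] p j' T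
      by (simp add: cell_def)
  next
    case False
    then show False using nz run_bound_T(2)[OF w k, of \<tau> "snd (snd (run w \<tau>) ! k) - 1 - int j"] p j' T
      by (simp add: cell_def)
  qed
qed

text \<open>The 1 of a rejecting output stands at position 0, which the tableau covers because the
  head ends within distance \<open>T\<close> of it. The last row is past the halting time.\<close>

lemma final_config:
  assumes w: "length w < h" and \<tau>: "Suc \<tau> = N"
  shows "acc w \<longleftrightarrow> (\<forall>s. \<forall>j<N. cell s (snd (run w \<tau>) ! (kk - 1)) j \<noteq> 1)"
proof -
  obtain t0 where t0: "t0 \<le> T" "\<And>\<tau>. t0 \<le> \<tau> \<Longrightarrow> run w \<tau> = run w t0" "fst (last (snd (run w t0))) = contents (enc [[acc w]])"
    by (rule halting[OF w]) blast
  have "t0 \<le> \<tau>" using t0(1) T \<tau> N_eq by simp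
  then have e: "run w \<tau> = run w t0" by (rule t0(2))
  have len: "length (snd (run w \<tau>)) = kk" using wf_run by (simp add: wf_config_def)
  define t where "t = snd (run w \<tau>) ! (kk - 1)"
  have "snd (run w \<tau>) \<noteq> []" using len M_pos by auto
  then have "last (snd (run w \<tau>)) = t" unfolding t_def using len by (simp add: last_conv_nth)
  then have ft: "fst t = contents (enc [[acc w]])" using t0(3) e by simp
  have ftv: "fst t i = (if i = 0 then bit_sym (acc w) else if i = 1 then 3 else 0)" for i
    unfolding ft by (auto simp: contents_def nth_Cons' nat_eq_iff)
  have p: "\<bar>snd t\<bar> \<le> int T" unfolding t_def using M_pos by (intro run_bound_T[OF w]) simp
  show ?thesis
  proof (cases "acc w")
    case True
    then show ?thesis unfolding t_def[symmetric] by (auto simp: cell_def ftv bit_sym_def)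
  next
    case False
    have "\<exists>s. \<exists>j<N. cell s t j = 1"
    proof (cases "snd t \<le> 0")
      case True
      then have "cell True t (nat (- snd t)) = 1" using False by (simp add: cell_def ftv bit_sym_def)
      moreover have "nat (- snd t) < N" using p T N_eq by linarith
      ultimately show ?thesis by blast
    next
      case pos: False
      then have "cell False t (nat (snd t - 1)) = 1" using False by (simp add: cell_def ftv bit_sym_def)
      moreover have "nat (snd t - 1) < N" using p T N_eq by linarith
      ultimately show ?thesis by blast
    qed
    then show ?thesis using False unfolding t_def[symmetric] by auto
  qed
qed

text \<open>The first row determines a word \<open>w\<close>. By induction on time every row is the
  configuration of the run on \<open>w\<close>, because the equations leave no choice for the next
  row. The acceptance equations then speak about the true output.\<close>

lemma tableau_sound:
  assumes X0: "X [0, 0, 0]" and ok: "\<And>\<tau> j s. \<tau> < N \<Longrightarrow> j < N \<Longrightarrow> s \<in> set (core_schemas M) \<Longrightarrow> ok X \<tau> j s"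
  shows "\<exists>w. length w < h \<and> acc w"
proof -
  have N0: "0 < N" "Suc n < N" "n < N" using N_eq by auto
  have val: "hist X \<tau> j (TC s k a) \<longleftrightarrow> a = v"
    if "value_schema cs s k v a \<in> set (core_schemas M)" "\<forall>c\<in>set cs. holds y \<tau> j c" "k < kk" "a < ns" "\<tau> < N" "j < N" for cs s k v a \<tau> j
    using ok[OF that(5,6,1)] ok_value_schema[where X = X, OF X0 that(3-6)] that(2) by simp
  have inp: "hist X 0 j (TC True 0 a) \<longleftrightarrow> a = y ! j" if "j \<le> n" "a < ns" for j a
  proof -
    have "y ! j \<in> {1, 2, 3}" using that N0 by (auto simp: y_nth bit_sym_def)
    then show ?thesis using that N0 M_pos
      by (intro val[where cs = "[T0, JSym (\<lambda>s. s = y ! j)]"]) (auto intro: schema_mem)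
  qed
  have last: "hist X \<tau> j (TC s k a) \<longleftrightarrow> a = 0" if "\<tau> < N" "Suc j = N" "k < kk" "a < ns" for \<tau> j s k a
    using that y6[of j] by (intro val[where cs = "[JSym (\<lambda>s. s = 6)]"]) (auto intro: schema_mem)
  have five: "hist X 0 j (TC True 0 a) \<longleftrightarrow> a = 0" if "n + h < j" "j < N" "a < ns" for j a
  proof (cases "Suc j = N")
    case True
    then show ?thesis using last that M_pos N0 by simp
  next
    case False
    then have "y ! j = 5" using that N_eq by (simp add: y_nth)
    then show ?thesis using that N0 M_pos
      by (intro val[where cs = "[T0, JSym (\<lambda>s. s = 5)]"]) (auto intro: schema_mem)
  qed
  have wit: "\<exists>v<4. \<forall>a<ns. hist X 0 j (TC True 0 a) \<longleftrightarrow> a = v" if j: "n < j" "j \<le> n + h" for j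
  proof -
    let ?H = "\<lambda>a. hist X 0 j (TC True 0 a)"
    have jN: "j < N" "y ! j = 4" using j N_eq by (auto simp: y_nth)
    note W = ok_witness_schemas[where X = X, OF X0 jN]
    have big: "\<forall>a\<in>{4..<ns}. \<not> ?H a"
      unfolding W(1)[symmetric] using N0 jN by (intro ballI ok) (auto intro: schema_mem)
    have sum: "odd (of_bool (?H 0) + of_bool (?H 1) + of_bool (?H 2) + of_bool (?H 3) :: nat)"
      unfolding W(2)[symmetric] using N0 jN by (intro ok) (auto intro: schema_mem)
    have excl: "\<not> (?H a \<and> ?H a')" if "a < 4" "a' < 4" "a \<noteq> a'" for a a'
      unfolding W(3)[OF that(1,2), symmetric] using N0 jN that by (intro ok) (auto intro: schema_mem)
    obtain v where v: "v < 4" "?H v"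
    proof -
      have "?H 0 \<or> ?H 1 \<or> ?H 2 \<or> ?H 3" using sum by (auto split: if_splits)
      then show ?thesis using that[of 0] that[of 1] that[of 2] that[of 3] by auto
    qed
    have "?H a \<longleftrightarrow> a = v" if "a < ns" for a
      using v big excl[of a v] that by (cases "a < 4") auto
    then show ?thesis using v by blast
  qed
  \<comment> \<open>The default 0 at \<open>i = h\<close> agrees with the blank that is forced in
    the first column after the witness block.\<close>
  define f where "f i = (if i < h then (THE v. v < 4 \<and> (\<forall>a<ns. hist X 0 (Suc n + i) (TC True 0 a) \<longleftrightarrow> a = v)) else 0)" for i
  have f: "f i < 4 \<and> (\<forall>a<ns. hist X 0 (Suc n + i) (TC True 0 a) \<longleftrightarrow> a = f i)" if i: "i < h" for i
  proof -
    obtain v where v: "v < 4" "\<forall>a<ns. hist X 0 (Suc n + i) (TC True 0 a) \<longleftrightarrow> a = v" using wit[of "Suc n + i"] i by auto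
    have "f i = v" unfolding f_def using i v M_pos by (auto intro!: the_equality)
    then show ?thesis using v by simp
  qed
  have f': "hist X 0 (Suc n + i) (TC True 0 a) \<longleftrightarrow> a = f i" if "i \<le> h" "a < ns" for i a
    using f[of i] five[of "Suc n + i" a] that N_eq g by (cases "i < h") (auto simp: f_def)
  obtain w where w: "length w < h" "\<forall>i\<le>h. f i = contents (map bit_sym w @ [3]) (int i)"
  proof -
    have "f (Suc i) = 0 \<longleftrightarrow> f i = 0 \<or> f i = 3" if i: "i < h" for i
    proof -
      let ?j = "Suc n + i"
      have j: "?j < N" "Suc ?j < N" "y ! ?j = 4" using i N_eq g by (auto simp: y_nth)
      have "even (of_bool (hist X 0 (Suc ?j) (TC True 0 0)) + of_bool (hist X 0 ?j (TC True 0 0)) + of_bool (hist X 0 ?j (TC True 0 3)) :: nat)"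
        unfolding ok_witness_schemas(4)[where X = X, OF X0 j(1,3,2), symmetric] using N0 j by (intro ok) (auto intro: schema_mem)
      then show ?thesis using f'[of i 0] f'[of i 3] f'[of "Suc i" 0] i M_pos by auto
    qed
    moreover have "f 0 \<noteq> 0"
    proof -
      have "\<not> hist X 0 (Suc n) (TC True 0 0)"
        using ok_start_schema[where X = X, OF X0, of n] N0 ok[of 0 n, OF _ _ schema_mem(13)] by (auto simp: y_nth)
      then show ?thesis using f'[of 0 0] M_pos h by auto
    qed
    moreover have "f h = 0" by (simp add: f_def)
    ultimately show ?thesis using witness_shape[of h f] h f that by blast
  qed
  have C_0: "C_match X 0 (snd (run w 0))"
    unfolding C_match_def[where X = X, OF X0]
  proof (intro allI impI)
    fix s k a j assume k: "k < kk" "a < ns" "j < N"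
    show "hist X 0 j (TC s k a) \<longleftrightarrow> cell s (snd (run w 0) ! k) j = a"
    proof (cases "s \<and> k = 0")
      case False
      then have "hist X 0 j (TC s k a) \<longleftrightarrow> a = 0"
        using k N0 by (intro val[where cs = "[T0]"]) (auto intro: schema_mem)
      then show ?thesis using False k by (auto simp: initial_cell)
    next
      case True
      have "hist X 0 j (TC True 0 a) \<longleftrightarrow> a = contents (enc [xx, w]) (int j)"
      proof (cases "j \<le> n")
        case True
        then show ?thesis unfolding initial_left[OF True] using inp k by simp
      next
        case False
        define i where "i = j - Suc n"
        have j: "j = Suc n + i" using False by (simp add: i_def)
        show ?thesis
        proof (cases "i \<le> h")
          case True
          then show ?thesis unfolding j initial_right using f'[of i a] w(2) k by simp
        next
          case False
          then have "contents (map bit_sym w @ [3]) (int i) = 0" using w(1) by (simp add: contents_def)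
          then show ?thesis unfolding j initial_right using five[of j a] False k j by simp
        qed
      qed
      then show ?thesis using True k by (auto simp: initial_cell)
    qed
  qed
  have one: "\<exists>r\<in>set (configs M). P_match X \<tau> r" if \<tau>: "\<tau> < N" for \<tau>
    by (rule one_hot[where X = X, OF X0 _ \<tau>], rule ok[OF \<tau> N0(1) core_schemas_mem(1)])
  have scan: "snd r = map scan ts"
    if r: "P_match X \<tau> r" "r \<in> set (configs M)" "\<tau> < N" and C: "C_match X \<tau> ts" "length ts = kk" for \<tau> r ts
  proof (rule nth_equalityI)
    have rl: "length (snd r) = kk" "\<forall>a\<in>set (snd r). a < ns" using r by (auto simp: set_configs Tup_def)
    then show "length (snd r) = length (map scan ts)" using C by simp
    fix k assume "k < length (snd r)"
    then have k: "k < kk" "snd r ! k < ns" using rl by auto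
    have "hist X \<tau> 0 (TC True k (snd r ! k)) \<longleftrightarrow> snd r ! k = snd r ! k"
      unfolding ok_scan_schema[where X = X, OF X0 r k, symmetric, of 0]
      using r N0 k by (intro ok) (auto intro: schema_mem)
    then have "cell True (ts ! k) 0 = snd r ! k" using C(1) k N0 by (simp add: C_match_def[where X = X, OF X0])
    then show "snd r ! k = map scan ts ! k" using C k by (simp add: cell_def scan_def)
  qed
  have all: "C_match X \<tau> (snd (run w \<tau>)) \<and> P_match X \<tau> (scanned (run w \<tau>))" if "\<tau> < N" for \<tau>
    using that
  proof (induction \<tau>)
    case 0
    obtain r where r: "r \<in> set (configs M)" "P_match X 0 r" using one[OF N0(1)] by blast
    have "snd r = map scan (snd (run w 0))"
      using scan[OF r(2,1) N0(1) C_0] wf_run[of w 0] by (simp add: wf_config_def)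
    moreover have "fst r = 0"
      unfolding ok_init_schema[where X = X, OF X0 r(2,1), symmetric, of 0] using N0 by (intro ok) (auto intro: schema_mem)
    moreover have "fst (run w 0) = 0" by (simp add: run_def init_def)
    ultimately have "r = scanned (run w 0)" by (simp add: scanned_def prod_eq_iff)
    then show ?case using r C_0 by simp
  next
    case (Suc \<tau>)
    let ?c = "run w \<tau>" and ?c' = "run w (Suc \<tau>)"
    have IH: "C_match X \<tau> (snd ?c)" "P_match X \<tau> (scanned ?c)" "\<tau> < N" using Suc by auto
    note rc = wf_config_scanned[OF wf_run[of w \<tau>]]
    have C: "C_match X (Suc \<tau>) (snd ?c')"
      unfolding C_match_def[where X = X, OF X0]
    proof (intro allI impI)
      fix s k a j assume k: "k < kk" "a < ns" "j < N"
      show "hist X (Suc \<tau>) j (TC s k a) \<longleftrightarrow> cell s (snd ?c' ! k) j = a"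
      proof (cases "Suc j = N")
        case True
        then show ?thesis using last[OF Suc.prems True k(1,2)] blank_far[OF w(1) k(1), of j] by auto
      next
        case False
        then have j: "Suc j < N" using k by simp
        \<comment> \<open>The cases column 0, column 1 and all later columns are exhaustive, so one
          of the cell schemas applies.\<close>
        obtain c where c: "c \<in> {J0, J1, J2}" "holds y \<tau> j c" using cover_cond by blast
        show ?thesis unfolding run_Suc ok_cell_schema[where X = X, OF X0 c k(1,2) Suc.prems j IH(2) wf_run IH(1), symmetric]
          using IH(3) k c(1) by (intro ok) (auto intro: schema_mem)
      qed
    qed
    obtain r where r: "r \<in> set (configs M)" "P_match X (Suc \<tau>) r" using one[OF Suc.prems] by blast
    have "snd r = map scan (snd ?c')"
      using scan[OF r(2,1) Suc.prems C] wf_run[of w "Suc \<tau>"] by (simp add: wf_config_def)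
    moreover have "fst r = fst ?c'"
    proof -
      have q: "fst r < states M" using r by (auto simp: set_configs)
      have "fst r = fst r \<longleftrightarrow> fst (moves M (scanned ?c)) = fst r"
        by (rule iffD1[OF ok_state_schema[where X = X, OF X0 IH(2) rc r(2,1) Suc.prems, of 0 "fst r"]])
          (rule ok[OF IH(3) N0(1) schema_mem(3)[OF q]])
      then show ?thesis by (simp add: run_Suc step_moves)
    qed
    ultimately have "r = scanned ?c'" by (simp add: scanned_def prod_eq_iff)
    then show ?case using r C by simp
  qed
  define \<tau> where "\<tau> = N - 1"
  have \<tau>: "Suc \<tau> = N" "\<tau> < N" using N0 by (auto simp: \<tau>_def)
  have "cell s (snd (run w \<tau>) ! (kk - 1)) j \<noteq> 1" if "j < N" for s j
  proof -
    have "\<not> hist X \<tau> j (TC s (kk - 1) 1)"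
      unfolding ok_accept_schema[where X = X, OF X0 \<tau>(1) that, symmetric] using \<tau> that
      by (intro ok schema_mem) auto
    then show ?thesis using all[OF \<tau>(2)] that M_pos by (auto simp: C_match_def[where X = X, OF X0])
  qed
  then have "acc w" using final_config[OF w(1) \<tau>(1)] by blast
  then show ?thesis using w by blast
qed

end

end

section \<open>Accepting runs yield solutions of the equations\<close>

context encoded
begin

lemma tableau_complete:
  fixes T :: nat and acc :: "bool list \<Rightarrow> bool"
  assumes out: "\<And>w. length w < h \<Longrightarrow> outputs_within M (enc [xx, w]) (enc [[acc w]]) T" and T: "2 * T < g"
    and w: "length w < h" "acc w"
  obtains X where "X [0, 0, 0]" "\<And>\<tau> j s. \<tau> < N \<Longrightarrow> j < N \<Longrightarrow> s \<in> set (core_schemas M) \<Longrightarrow> ok X \<tau> j s"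
proof -
  define tr where "tr \<tau> j \<theta> \<longleftrightarrow> (case \<theta> of TP q ss \<Rightarrow> j = 0 \<and> (q, ss) = scanned (run w \<tau>)
    | TC s k a \<Rightarrow> cell s (snd (run w \<tau>) ! k) j = a)" for \<tau> j \<theta>
  define X where "X i \<longleftrightarrow> i = [0, 0, 0] \<or> (\<exists>\<tau> j \<theta>. i = [\<tau>, j, code \<theta>] \<and> tr \<tau> j \<theta>)" for i
  have X0: "X [0, 0, 0]" by (simp add: X_def)
  have hist: "hist X \<tau> j \<theta> \<longleftrightarrow> tr \<tau> j \<theta>" for \<tau> j \<theta>
    unfolding hist_def[where X = X, OF X0] X_def by auto
  have P: "P_match X \<tau> (scanned (run w \<tau>))" for \<tau>
    unfolding P_match_def[where X = X, OF X0] hist tr_def by auto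
  have C: "C_match X \<tau> (snd (run w \<tau>))" for \<tau>
    unfolding C_match_def[where X = X, OF X0] hist tr_def by auto
  have HC: "hist X \<tau> j (TC s k a) \<longleftrightarrow> cell s (snd (run w \<tau>) ! k) j = a" for \<tau> j s k a
    by (simp add: hist tr_def)
  note sc = wf_config_scanned[OF wf_run]
  note iff = ok_iff[where X = X, OF X0]
  have N0: "0 < N" using N_eq by simp
  define v where "v i = contents (map bit_sym w @ [3]) (int i)" for i
  have v: "v i = (if i < length w then bit_sym (w ! i) else if i = length w then 3 else 0)" for i
    by (auto simp: v_def contents_def nth_append)
  have v4: "v i < 4" for i by (simp add: v bit_sym_def)
  have row: "hist X 0 (Suc n + i) (TC True 0 a) \<longleftrightarrow> v i = a" for i a
    unfolding HC v_def initial_right[symmetric] using M_pos by (simp add: initial_cell del: enc_Cons)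
  have bf: "cell b (snd (run w \<tau>) ! k) j = 0" if "k < kk" "N \<le> Suc j" for b \<tau> k j
    by (rule blank_far[where T = T and acc = acc, OF _ T w(1) that]) (rule out)
  have fc: "acc w \<longleftrightarrow> (\<forall>s. \<forall>j<N. cell s (snd (run w \<tau>) ! (kk - 1)) j \<noteq> 1)" if "Suc \<tau> = N" for \<tau>
    by (rule final_config[where T = T and acc = acc, OF _ T w(1) that]) (rule out)
  have fam: "ok X \<tau> j s" if \<tau>: "\<tau> < N" "j < N" and s: "s \<in> set (core_schemas M)" for \<tau> j s
  proof -
    have val: "ok X \<tau> j (value_schema cs b k u a)"
      if "k < kk" "a < ns" "\<forall>c\<in>set cs. holds y \<tau> j c \<Longrightarrow> cell b (snd (run w \<tau>) ! k) j = u" for cs b k u a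
      using ok_value_schema[where X = X, OF X0 that(1,2) \<tau>] that(3) by (auto simp: HC)
    have oneh: "ok X \<tau> j s" if s: "s \<in> set (one_hot_schemas M)"
    proof -
      consider "s = ([], (One, One) # Pmonos M (\<lambda>_. True))"
        | p p' where "p \<in> set (configs M)" "p' \<in> set (configs M)" "p \<noteq> p'" "s = ([], [(Pv False p, Pv False p')])"
        using s unfolding one_hot_schemas_def by auto
      then show ?thesis
      proof cases
        case 1
        then show ?thesis using num_Pmonos[where X = X, OF X0 P sc \<tau>(1)] by (simp add: iff mval_simps(1)[where X = X, OF X0])
      next
        case 2
        have "\<not> (hist X \<tau> 0 (TP (fst p) (snd p)) \<and> hist X \<tau> 0 (TP (fst p') (snd p')))"
          using P[of \<tau>, unfolded P_match_def[where X = X, OF X0]] 2(1-3) by (metis (no_types, lifting))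
        then show ?thesis using 2 \<tau> by (auto simp: iff mval_P[where X = X, OF X0])
      qed
    qed
    have scan: "ok X \<tau> j s" if s: "s \<in> set (scan_schemas M)"
    proof -
      obtain k a where k: "k < kk" "a < ns" and e: "s = ([], (V False C0 (TC True k a), One) # Pmonos M (\<lambda>p. snd p ! k = a))"
        using s unfolding scan_schemas_def by auto
      have "length (snd (run w \<tau>)) = kk" using wf_run by (simp add: wf_config_def)
      then have "hist X \<tau> 0 (TC True k a) \<longleftrightarrow> snd (scanned (run w \<tau>)) ! k = a"
        using k by (simp add: HC scanned_def cell_def scan_def)
      then show ?thesis unfolding e using ok_scan_schema[where X = X, OF X0 P sc \<tau>(1) k] by blast
    qed
    have state: "ok X \<tau> j s" if s: "s \<in> set (state_schemas M)"
    proof -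
      consider "s = ([T0], (One, One) # Pmonos M (\<lambda>p. fst p = 0))"
        | q where "s = ([TSym (\<lambda>s. s \<noteq> 6)], map (\<lambda>p. (Pv True p, One)) (filter (\<lambda>p. fst p = q) (configs M)) @
       Pmonos M (\<lambda>p. fst (moves M p) = q))"
        using s unfolding state_schemas_def by auto
      then show ?thesis
      proof cases
        case 1
        show ?thesis
        proof (cases "\<tau> = 0")
          case True
          have "fst (scanned (run w 0)) = 0" by (simp add: scanned_def run_def init_def)
          then show ?thesis unfolding 1 True using ok_init_schema[where X = X, OF X0 P sc] by blast
        qed (simp add: 1 iff)
      next
        case 2
        show ?thesis
        proof (cases "Suc \<tau> < N")
          case True
          have "fst (scanned (run w (Suc \<tau>))) = fst (moves M (scanned (run w \<tau>)))"
            by (simp add: run_Suc step_moves scanned_def[of "(_, _)"])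
          then show ?thesis unfolding 2 using ok_state_schema[where X = X, OF X0 P sc P sc True] by simp
        next
          case False
          then show ?thesis using \<tau> y6[of \<tau>] by (simp add: 2 iff)
        qed
      qed
    qed
    have cellc: "ok X \<tau> j s" if s: "s \<in> set (cell_schemas M)"
    proof -
      obtain c b k a where c: "c \<in> {J0, J1, J2}" and k: "k < kk" "a < ns" and
        e: "s = ([TSym (\<lambda>s. s \<noteq> 6), JSym (\<lambda>s. s \<noteq> 6), c], (V True Same (TC b k a), One) # concat (map (cell_monos M b k a c) (configs M)))"
        using s unfolding cell_schemas_def by (auto simp: set_cells)
      show ?thesis
      proof (cases "Suc \<tau> < N \<and> Suc j < N \<and> holds y \<tau> j c")
        case True
        have "hist X (Suc \<tau>) j (TC b k a) \<longleftrightarrow> cell b (snd (step M (run w \<tau>)) ! k) j = a"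
          unfolding HC run_Suc ..
        then show ?thesis unfolding e using ok_cell_schema[where X = X and j = j and s = b, OF X0 c _ k _ _ P wf_run C] True by blast
      next
        case False
        then show ?thesis using \<tau> y6[of \<tau>] y6[of j] by (auto simp: e iff)
      qed
    qed
    have blank: "ok X \<tau> j s" if s: "s \<in> set (blank_schemas M)"
    proof -
      consider x where "x \<in> set (cells M)" "s = (case x of (b, k, a) \<Rightarrow> value_schema [JSym (\<lambda>s. s = 6)] b k 0 a)"
        | x where "x \<in> set (filter (\<lambda>(s, k, a). \<not> s \<or> k \<noteq> 0) (cells M))" "s = (case x of (b, k, a) \<Rightarrow> value_schema [T0] b k 0 a)"
        using s unfolding blank_schemas_def set_append set_map by (elim UnE imageE)
      then show ?thesis
      proof cases
        case 1
        obtain b k a where x: "x = (b, k, a)" by (cases x)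
        have k: "k < kk" "a < ns" using 1 by (auto simp: x set_cells)
        show ?thesis unfolding 1(2) x prod.case
        proof (rule val[OF k])
          assume "\<forall>c\<in>set [JSym (\<lambda>s. s = 6)]. holds y \<tau> j c"
          then have "N \<le> Suc j" using y6[OF \<tau>(2)] by simp
          then show "cell b (snd (run w \<tau>) ! k) j = 0" by (rule bf[OF k(1)])
        qed
      next
        case 2
        obtain b k a where x: "x = (b, k, a)" by (cases x)
        have k: "k < kk" "a < ns" "\<not> b \<or> k \<noteq> 0" using 2 by (auto simp: x set_cells)
        show ?thesis unfolding 2(2) x prod.case
        proof (rule val[OF k(1,2)])
          assume "\<forall>c\<in>set [T0]. holds y \<tau> j c"
          then show "cell b (snd (run w \<tau>) ! k) j = 0" using k by (auto simp: initial_cell)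
        qed
      qed
    qed
    have input: "ok X \<tau> j s" if s: "s \<in> set (input_schemas M)"
    proof -
      consider x where "x \<in> set (List.product [1, 2, 3] [0..<ns])" "s = (case x of (l, a) \<Rightarrow> value_schema [T0, JSym (\<lambda>s. s = l)] True 0 l a)"
        | a where "a \<in> set [0..<ns]" "s = value_schema [T0, JSym (\<lambda>s. s = 5)] True 0 0 a"
        using s unfolding input_schemas_def set_append set_map by (elim UnE imageE)
      then show ?thesis
      proof cases
        case 1
        obtain l a where x: "x = (l, a)" by (cases x)
        have la: "l \<in> {1, 2, 3}" "a < ns" using 1(1) by (auto simp: x)
        show ?thesis unfolding 1(2) x prod.case
        proof (rule val[OF M_pos(1) la(2)])
          assume "\<forall>c\<in>set [T0, JSym (\<lambda>s. s = l)]. holds y \<tau> j c"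
          then have c: "\<tau> = 0" "y ! j = l" by auto
          then have "j \<le> n" using la(1) y_nth[OF \<tau>(2)] by (auto split: if_splits)
          then show "cell True (snd (run w \<tau>) ! 0) j = l" using c initial_left[of j w] M_pos
            by (simp add: initial_cell del: enc_Cons)
        qed
      next
        case 2
        have a: "a < ns" using 2(1) by simp
        show ?thesis unfolding 2(2)
        proof (rule val[OF M_pos(1) a])
          assume "\<forall>c\<in>set [T0, JSym (\<lambda>s. s = 5)]. holds y \<tau> j c"
          then have c: "\<tau> = 0" "y ! j = 5" by auto
          then have "n + h < j" using y_nth[OF \<tau>(2)] by (auto simp: bit_sym_def split: if_splits)
          then obtain i where i: "j = Suc n + i" "h \<le> i" using less_iff_Suc_add[of "n + h" j] by auto
          then have "contents (enc [xx, w]) (int j) = 0" using v[of i] w(1) unfolding i(1) initial_right v_def by simp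
          then show "cell True (snd (run w \<tau>) ! 0) j = 0" using c M_pos by (simp add: initial_cell del: enc_Cons)
        qed
      qed
    qed
    have wit: "ok X \<tau> j s" if s: "s \<in> set (witness_schemas M)"
    proof (cases "\<tau> = 0 \<and> y ! j = 4")
      case True
      then have j4: "y ! j = 4" and \<tau>0: "\<tau> = 0" by auto
      have "n < j" "j \<le> n + h" using j4 y_nth[OF \<tau>(2)] by (auto simp: bit_sym_def split: if_splits)
      then obtain i where i: "j = Suc n + i" "i < h" using less_iff_Suc_add[of n j] by auto
      note W = ok_witness_schemas[where X = X, OF X0 \<tau>(2) j4]
      have H: "hist X 0 j (TC True 0 a) \<longleftrightarrow> v i = a" for a unfolding i(1) by (rule row)
      have H': "hist X 0 (Suc j) (TC True 0 a) \<longleftrightarrow> v (Suc i) = a" for a using row[of "Suc i" a] by (simp add: i(1))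
      have Sj: "Suc j < N" using i N_eq g by simp
      have vi: "v i = 0 \<or> v i = 1 \<or> v i = 2 \<or> v i = 3" using v4[of i] by auto
      have chain: "v (Suc i) = 0 \<longleftrightarrow> v i = 0 \<or> v i = 3" by (auto simp: v bit_sym_def)
      have 1: "ok X 0 j ([T0, JSym (\<lambda>s. s = 4)], [(V False Same (TC True 0 a), One)])" if "4 \<le> a" "a < ns" for a
      proof -
        have "\<forall>a\<in>{4..<ns}. \<not> hist X 0 j (TC True 0 a)" using H v4[of i] by auto
        from iffD2[OF W(1) this] show ?thesis using that by simp
      qed
      have 2: "ok X 0 j ([T0, JSym (\<lambda>s. s = 4)], (One, One) # map (\<lambda>a. (V False Same (TC True 0 a), One)) [0..<4])"
        using vi by (subst W(2)) (auto simp: H)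
      have 3: "ok X 0 j ([T0, JSym (\<lambda>s. s = 4)], [(V False Same (TC True 0 a), V False Same (TC True 0 a'))])"
        if "a < 4" "a' < 4" "a \<noteq> a'" for a a'
        using that by (subst W(3)) (auto simp: H)
      have 4: "ok X 0 j ([T0, JSym (\<lambda>s. s = 4)], [(V False Next (TC True 0 0), One), (V False Same (TC True 0 0), One), (V False Same (TC True 0 3), One)])"
        using chain by (subst W(4)[OF Sj]) (auto simp: H H')
      have 5: "ok X 0 j ([T0, JSym (\<lambda>s. s = 3)], [(V False Next (TC True 0 0), One)])" using j4 by (simp add: iff)
      show ?thesis using s 1 2 3 4 5 unfolding witness_schemas_def \<tau>0 by auto
    next
      case False
      show ?thesis
      proof (cases "\<tau> = 0 \<and> y ! j = 3")
        case True
        then have jn: "j = n" using y_nth[OF \<tau>(2)] by (auto simp: bit_sym_def split: if_splits)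
        have "Suc j < N" using jn N_eq by simp
        moreover have "\<not> hist X 0 (Suc j) (TC True 0 0)" using row[of 0 0] by (simp add: jn v bit_sym_def)
        ultimately have "ok X 0 j ([T0, JSym (\<lambda>s. s = 3)], [(V False Next (TC True 0 0), One)])"
          using ok_start_schema[where X = X, OF X0, of j] True by simp
        then show ?thesis using s True unfolding witness_schemas_def by (auto simp: iff)
      next
        case F: False
        show ?thesis using s False F unfolding witness_schemas_def by (auto simp: iff)
      qed
    qed
    have accs: "ok X \<tau> j s" if s: "s \<in> set (accept_schemas M)"
    proof -
      obtain b where e: "s = ([TSym (\<lambda>s. s = 6)], [(V False Same (TC b (kk - 1) 1), One)])"
        using s unfolding accept_schemas_def by auto
      show ?thesis
      proof (cases "Suc \<tau> = N")
        case True
        have "\<not> hist X \<tau> j (TC b (kk - 1) 1)"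
          using fc[OF True] w(2) \<tau>(2) by (auto simp: HC)
        then show ?thesis unfolding e using ok_accept_schema[where X = X, OF X0 True \<tau>(2), of b] by simp
      next
        case False
        then show ?thesis using \<tau> y6[of \<tau>] by (simp add: e iff)
      qed
    qed
    show ?thesis using s oneh scan state cellc blank input wit accs unfolding core_schemas_def by auto
  qed
  show ?thesis by (rule that[OF X0 fam])
qed

end

section \<open>The verifier and its analysis\<close>

lemma sg_odd_add: "sg (odd (a + b)) = sg (odd a) * sg (odd (b::nat))"
  by (auto simp: sg_def)

lemma sg_odd_sum: "sg (odd (\<Sum>i\<in>S. f i)) = (\<Prod>i\<in>S. sg (odd (f i :: nat)))"
proof (induction S rule: infinite_finite_induct)
  case (insert i S)
  show ?case by (simp only: sum.insert[OF insert.hyps] prod.insert[OF insert.hyps] sg_odd_add insert.IH)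
qed simp_all

lemma sg_odd_sum_list: "sg (odd (sum_list (map f as))) = prod_list (map (\<lambda>a. sg (odd (f a :: nat))) as)"
proof (induction as)
  case (Cons a as)
  show ?case by (simp only: list.map sum_list.Cons prod_list.Cons sg_odd_add Cons)
qed simp

lemma prod_list_concat: "prod_list (concat xss) = prod_list (map prod_list xss)"
  by (induction xss) auto

lemma prod_list_prod: "prod_list (map (\<lambda>x. \<Prod>k\<in>K. f x k) xs) = (\<Prod>k\<in>K. prod_list (map (\<lambda>x. f x k) xs))"
  by (induction xs) (auto simp: prod.distrib)

lemma prod_list_upt: "prod_list (map f [0..<m]) = (\<Prod>j<m. f j)"
  by (induction m) (auto simp: mult.commute)

lemma prod_list_enumerate:
  "prod_list (map (\<lambda>(n, s). if n = n' then g s else 1) (List.enumerate k ss)) =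
    (if k \<le> n' \<and> n' < k + length ss then g (ss ! (n' - k)) else 1)"
  by (induction ss arbitrary: k) (auto simp: nth_Cons' Suc_diff_Suc)

lemma prod_Tup_Cons: "(\<Prod>c\<in>Tup N (Suc d). f c) = (\<Prod>i<N. \<Prod>c\<in>Tup N d. f (i # c))"
proof -
  have b: "bij_betw (\<lambda>(i, c). i # c) ({..<N} \<times> Tup N d) (Tup N (Suc d))"
    by (rule bij_betwI[where g = "\<lambda>c. (hd c, tl c)"]) (auto simp: Tup_def length_Suc_conv)
  have "(\<Prod>c\<in>Tup N (Suc d). f c) = (\<Prod>x\<in>{..<N} \<times> Tup N d. f (case x of (i, c) \<Rightarrow> i # c))"
    by (rule prod.reindex_bij_betw[OF b, symmetric])
  then show ?thesis by (simp add: prod.cartesian_product case_prod_unfold)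
qed

fun upd :: "(nat \<Rightarrow> nat) \<Rightarrow> nat list \<Rightarrow> nat list \<Rightarrow> nat \<Rightarrow> nat" where
  "upd e (v # vs) (i # is) = upd (e(v := i)) vs is"
| "upd e _ _ = e"

lemma upd_other: "v \<notin> set vs \<Longrightarrow> upd e vs is v = e v"
  by (induction e vs "is" rule: upd.induct) auto

lemma map_upd: "distinct vs \<Longrightarrow> length is = length vs \<Longrightarrow> map (upd e vs is) vs = is"
  by (induction e vs "is" rule: upd.induct) (auto simp: upd_other)

lemma sg_count_nest:
  "sg (odd (count_nest N vs h e)) = (\<Prod>k\<in>Tup N (length vs). sg (odd (h (upd e vs k))))"
proof (induction vs arbitrary: e)
  case (Cons v vs)
  show ?case by (simp only: count_nest.simps sg_odd_sum Cons length_Cons prod_Tup_Cons upd.simps)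
qed simp

lemma list_nest_tups:
  "list_nest N vs (\<lambda>e. [f e]) e = map (\<lambda>k. f (upd e vs k)) (tups N (length vs))"
  by (induction vs arbitrary: e) (auto simp: map_concat o_def)

section \<open>Formulas that compute the questions\<close>

fun conj_fm :: "fm list \<Rightarrow> fm" where
  "conj_fm [] = TT"
| "conj_fm (\<phi> # \<phi>s) = And \<phi> (conj_fm \<phi>s)"

lemma eval_conj [simp]: "eval y R e (conj_fm \<phi>s) \<longleftrightarrow> (\<forall>\<phi>\<in>set \<phi>s. eval y R e \<phi>)"
  by (induction \<phi>s) auto

lemma wf_conj [simp]: "wf_fm d ny N (conj_fm \<phi>s) \<longleftrightarrow> (\<forall>\<phi>\<in>set \<phi>s. wf_fm d ny N \<phi>)"
  by (induction \<phi>s) auto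

fun cnd_fm :: "nat \<Rightarrow> nat \<Rightarrow> cnd \<Rightarrow> fm" where
  "cnd_fm kt kj (TSym A) = Sym kt A"
| "cnd_fm kt kj T0 = EqC kt 0"
| "cnd_fm kt kj (JSym A) = Sym kj A"
| "cnd_fm kt kj J0 = EqC kj 0"
| "cnd_fm kt kj J1 = EqC kj 1"
| "cnd_fm kt kj J2 = And (Not (EqC kj 0)) (Not (EqC kj 1))"

lemma eval_cnd: "eval y R e (cnd_fm kt kj c) \<longleftrightarrow> holds y (e kt) (e kj) c"
  by (cases c) auto

fun col_fm :: "nat \<Rightarrow> nat \<Rightarrow> col \<Rightarrow> fm" where
  "col_fm kj v C0 = EqC v 0"
| "col_fm kj v Same = Eq kj v"
| "col_fm kj v Next = Sc kj v"
| "col_fm kj v Prev = Sc v kj"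

fun match_fm :: "nat \<Rightarrow> nat \<Rightarrow> vt \<Rightarrow> nat \<Rightarrow> nat \<Rightarrow> nat \<Rightarrow> fm" where
  "match_fm kt kj One v0 v1 v2 = And (EqC v0 0) (And (EqC v1 0) (EqC v2 0))"
| "match_fm kt kj (V b c \<theta>) v0 v1 v2 = And (if b then Sc kt v0 else Eq kt v0) (And (col_fm kj v1 c) (EqC v2 (code \<theta>)))"

lemma eval_match:
  assumes "e v0 < N" "e v1 < N" "e v2 < N"
  shows "eval y R e (match_fm kt kj v v0 v1 v2) \<longleftrightarrow> index N (e kt) (e kj) v = Some [e v0, e v1, e v2]"
proof (cases v)
  case (V b c \<theta>)
  then show ?thesis using assms by (cases c; cases b) (auto split: if_splits)
qed auto

definition mono_index :: "nat \<Rightarrow> nat \<Rightarrow> nat \<Rightarrow> vt \<times> vt \<Rightarrow> nat list list" where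
  "mono_index N \<tau> j ab = (case index N \<tau> j (fst ab) of None \<Rightarrow> [] | Some i \<Rightarrow>
     (case index N \<tau> j (snd ab) of None \<Rightarrow> [] | Some i' \<Rightarrow> [i @ i']))"

text \<open>An equation is numbered by time, column and schema. A number without a schema, or at a
  position that fails the conditions, gets the empty list and so imposes nothing.\<close>

definition equations :: "tm \<Rightarrow> nat list \<Rightarrow> nat list \<Rightarrow> nat list list" where
  "equations M y k = (if k ! 2 < length (schemas M) \<and> (\<forall>c\<in>set (fst (schemas M ! (k ! 2))). holds y (k ! 0) (k ! 1) c)
     then concat (map (mono_index (length y) (k ! 0) (k ! 1)) (snd (schemas M ! (k ! 2)))) else [])"

lemma length_index: "index N \<tau> j v = Some i \<Longrightarrow> length i = 3"
  by (cases v) (auto split: option.splits if_splits)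

lemma index_Tup: "0 < N \<Longrightarrow> index N \<tau> j v = Some i \<Longrightarrow> i \<in> Tup N 3"
  by (cases v) (auto simp: Tup_def split: option.splits if_splits)

lemma mono_index_Tup: "0 < N \<Longrightarrow> p \<in> set (mono_index N \<tau> j ab) \<Longrightarrow> p \<in> Tup N 6"
  using index_Tup[of N \<tau> j] append_Tup[of _ 3 _ N 3] length_index[of N \<tau> j]
  by (auto simp: mono_index_def split: option.splits)

lemma equations_Tup: "y \<noteq> [] \<Longrightarrow> p \<in> set (equations M y k) \<Longrightarrow> p \<in> Tup (length y) 6"
  using mono_index_Tup[of "length y"] by (auto simp: equations_def split: if_splits)

lemma prod_mono_index:
  "prod_list (map (\<lambda>p. sg (x (take 3 p) \<and> x (drop 3 p))) (concat (map (mono_index N \<tau> j) ms))) = sg (odd (cnt x N \<tau> j ms))"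
proof (induction ms)
  case (Cons ab ms)
  obtain a b where ab: "ab = (a, b)" by (cases ab)
  have "prod_list (map (\<lambda>p. sg (x (take 3 p) \<and> x (drop 3 p))) (mono_index N \<tau> j (a, b))) = sg (mval x N \<tau> j a \<and> mval x N \<tau> j b)"
    using length_index[of N \<tau> j a] by (auto simp: mono_index_def mval_def split: option.splits)
  then show ?case using Cons by (simp add: ab sg_odd_add del: even_add odd_add) (auto simp: sg_def)
qed simp

text \<open>Formulas cannot mention the list of positions. They compare the two halves of a tuple
  with the two factors of each product, which gives the same parity.\<close>

lemma prod_match:
  assumes "length f = 3" "length g = 3"
  shows "prod_list (map (\<lambda>(a, b). sg (Q \<and> index N \<tau> j a = Some f \<and> index N \<tau> j b = Some g)) ms) =
    prod_list (map (\<lambda>p. sg (Q \<and> f @ g = p)) (concat (map (mono_index N \<tau> j) ms)))"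
proof (induction ms)
  case (Cons ab ms)
  obtain a b where ab: "ab = (a, b)" by (cases ab)
  have "sg (Q \<and> index N \<tau> j a = Some f \<and> index N \<tau> j b = Some g) = prod_list (map (\<lambda>p. sg (Q \<and> f @ g = p)) (mono_index N \<tau> j (a, b)))"
  proof (cases "index N \<tau> j a"; cases "index N \<tau> j b")
    fix i i' assume i: "index N \<tau> j a = Some i" "index N \<tau> j b = Some i'"
    have "f @ g = i @ i' \<longleftrightarrow> f = i \<and> g = i'" using length_index[OF i(1)] assms by auto
    moreover have "(i = f \<and> i' = g) = (f = i \<and> g = i')" by auto
    ultimately show ?thesis using i by (simp add: mono_index_def)
  qed (auto simp: mono_index_def)
  then show ?case using Cons by (simp add: ab)
qed simp

definition first_items :: "nat \<Rightarrow> (nat list \<times> fm) list" where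
  "first_items m = [([], Look 1 [6 + 6 * m..<6 + 12 * m])]"

text \<open>Coins are read with \<open>d = 6 * m\<close>, so tapes 3 to \<open>2 + 6 * m\<close> are
  counters. The next three tapes hold time, column and schema number of an equation, and those from
  \<open>6 + 6 * m\<close> to \<open>5 + 12 * m\<close> the coordinates of the bit being
  computed.\<close>

definition loop_vars :: "nat \<Rightarrow> nat list" where
  "loop_vars m = [3 + 6 * m, 4 + 6 * m, 5 + 6 * m]"

text \<open>Parities of items add, so each product of a schema gets an item of its own. It counts
  the instances of schema \<open>n\<close> with coefficient 1 in which this product stands at the
  entry named by factor \<open>j\<close> of the current coordinates.\<close>

definition equation_item :: "nat \<Rightarrow> nat \<Rightarrow> nat \<Rightarrow> cnd list \<Rightarrow> vt \<times> vt \<Rightarrow> nat list \<times> fm" where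
  "equation_item m j n cs ab = (let c = [6 + 6 * m..<6 + 12 * m]; o' = 6 + 6 * m + 6 * j; kt = 3 + 6 * m; kj = 4 + 6 * m in
     (loop_vars m, conj_fm ([Look (2 + j) (loop_vars m @ take (6 * j) c @ drop (6 * j + 6) c), EqC (5 + 6 * m) n] @
       map (cnd_fm kt kj) cs @
       [match_fm kt kj (fst ab) o' (o' + 1) (o' + 2), match_fm kt kj (snd ab) (o' + 3) (o' + 4) (o' + 5)])))"

text \<open>The items of the first question are included, so the emitted word is the first question
  plus the shift.\<close>

definition second_items :: "tm \<Rightarrow> nat \<Rightarrow> nat \<Rightarrow> (nat list \<times> fm) list" where
  "second_items M m t = (let c = [6 + 6 * m..<6 + 12 * m] in
     first_items m @
     [([], And (Look 0 []) (conj_fm (map (\<lambda>v. EqC v 0) c)))] @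
     map (\<lambda>\<tau>. ([], conj_fm (map (\<lambda>j. Look (2 + m + \<tau> * (2 * m) + j) (take 3 (drop (3 * j) c))) [0..<2 * m]))) [0..<t] @
     concat (map (\<lambda>j. concat (map (\<lambda>(n, s). map (equation_item m j n (fst s)) (snd s)) (List.enumerate 0 (schemas M)))) [0..<m]))"

lemma take_6_drop: "k + 6 \<le> length c \<Longrightarrow> take 6 (drop k c) = [c ! k, c ! (k + 1), c ! (k + 2)] @ [c ! (k + 3), c ! (k + 4), c ! (k + 5)]"
  by (rule nth_equalityI) (auto simp: less_Suc_eq numeral_eq_Suc)

lemma sg_equation_item:
  assumes y: "N = length y" and j: "j < m" and e: "e = upd (\<lambda>_. 0) [6 + 6 * m..<6 + 12 * m] c" and c: "c \<in> Tup N (6 * m)"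
  shows "sg (odd (item_val y R e (equation_item m j n cs ab))) =
    (\<Prod>k\<in>Tup N 3. sg (R (2 + j) (k @ take (6 * j) c @ drop (6 * j + 6) c) \<and> k ! 2 = n \<and> (\<forall>a\<in>set cs. holds y (k ! 0) (k ! 1) a) \<and>
      index N (k ! 0) (k ! 1) (fst ab) = Some (take 3 (take 6 (drop (6 * j) c))) \<and>
      index N (k ! 0) (k ! 1) (snd ab) = Some (drop 3 (take 6 (drop (6 * j) c)))))"
proof -
  let ?c = "[6 + 6 * m..<6 + 12 * m]"
  have len: "length c = 6 * m" "\<forall>v\<in>set c. v < N" using c by (auto simp: Tup_def)
  have me: "map e ?c = c" unfolding e by (rule map_upd) (auto simp: len)
  have "sg (odd (item_val y R e (equation_item m j n cs ab))) =
    (\<Prod>k\<in>Tup N 3. sg (odd (of_bool (eval y R (upd e (loop_vars m) k) (snd (equation_item m j n cs ab))) :: nat)))"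
    unfolding item_val_def sg_count_nest by (simp add: equation_item_def Let_def loop_vars_def y numeral_3_eq_3)
  also have "\<dots> = (\<Prod>k\<in>Tup N 3. sg (R (2 + j) (k @ take (6 * j) c @ drop (6 * j + 6) c) \<and> k ! 2 = n \<and> (\<forall>a\<in>set cs. holds y (k ! 0) (k ! 1) a) \<and>
      index N (k ! 0) (k ! 1) (fst ab) = Some (take 3 (take 6 (drop (6 * j) c))) \<and>
      index N (k ! 0) (k ! 1) (snd ab) = Some (drop 3 (take 6 (drop (6 * j) c)))))"
  proof (intro prod.cong refl)
    fix k assume k: "k \<in> Tup N 3"
    obtain k0 k1 k2 where kk: "k = [k0, k1, k2]" using k by (auto simp: Tup_def numeral_3_eq_3 length_Suc_conv)
    define e' where "e' = upd e (loop_vars m) k"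
    have e'v: "e' (3 + 6 * m) = k0" "e' (4 + 6 * m) = k1" "e' (5 + 6 * m) = k2"
      by (simp_all add: e'_def kk loop_vars_def)
    have e'c: "e' v = e v" if "v \<in> set ?c" for v using that by (simp add: e'_def kk loop_vars_def)
    have "map e' (loop_vars m @ take (6 * j) ?c @ drop (6 * j + 6) ?c) = k @ take (6 * j) (map e ?c) @ drop (6 * j + 6) (map e ?c)"
      using e'c by (auto simp: e'v kk loop_vars_def take_map drop_map dest: in_set_takeD in_set_dropD)
    then have 1: "map e' (loop_vars m @ take (6 * j) ?c @ drop (6 * j + 6) ?c) = k @ take (6 * j) c @ drop (6 * j + 6) c" unfolding me .
    have nth: "e' (6 + 6 * m + i) = c ! i" "c ! i < N" if "i < 6 * m" for i
    proof -
      have "e' (6 + 6 * m + i) = e (6 + 6 * m + i)" using that by (intro e'c) auto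
      also have "\<dots> = map e ?c ! i" using that by (simp del: upt_Suc)
      finally show "e' (6 + 6 * m + i) = c ! i" unfolding me .
      show "c ! i < N" using that len by simp
    qed
    have six: "take 6 (drop (6 * j) c) = [c ! (6 * j), c ! (6 * j + 1), c ! (6 * j + 2)] @ [c ! (6 * j + 3), c ! (6 * j + 4), c ! (6 * j + 5)]"
      using j len by (intro take_6_drop) auto
    have nths: "e' (6 + 6 * m + 6 * j + i) = c ! (6 * j + i)" "c ! (6 * j + i) < N" if "i < 6" for i
      using nth[of "6 * j + i"] that j by (simp_all add: add.assoc)
    have m1: "eval y R e' (match_fm (3 + 6 * m) (4 + 6 * m) v (6 + 6 * m + 6 * j) (6 + 6 * m + 6 * j + 1) (6 + 6 * m + 6 * j + 2)) \<longleftrightarrow>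
      index N k0 k1 v = Some (take 3 (take 6 (drop (6 * j) c)))" for v
      using nths[of 0] nths[of 1] nths[of 2] by (subst eval_match[where N = N]) (simp_all add: six e'v)
    have m2: "eval y R e' (match_fm (3 + 6 * m) (4 + 6 * m) v (6 + 6 * m + 6 * j + 3) (6 + 6 * m + 6 * j + 4) (6 + 6 * m + 6 * j + 5)) \<longleftrightarrow>
      index N k0 k1 v = Some (drop 3 (take 6 (drop (6 * j) c)))" for v
      using nths[of 3] nths[of 4] nths[of 5] by (subst eval_match[where N = N]) (simp_all add: six e'v)
    have "eval y R e' (snd (equation_item m j n cs ab)) \<longleftrightarrow> R (2 + j) (k @ take (6 * j) c @ drop (6 * j + 6) c) \<and> k ! 2 = n \<and> (\<forall>a\<in>set cs. holds y (k ! 0) (k ! 1) a) \<and>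
      index N (k ! 0) (k ! 1) (fst ab) = Some (take 3 (take 6 (drop (6 * j) c))) \<and>
      index N (k ! 0) (k ! 1) (snd ab) = Some (drop 3 (take 6 (drop (6 * j) c)))"
    proof -
      have "eval y R e' (snd (equation_item m j n cs ab)) \<longleftrightarrow>
        R (2 + j) (map e' (loop_vars m @ take (6 * j) ?c @ drop (6 * j + 6) ?c)) \<and> e' (5 + 6 * m) = n \<and>
        (\<forall>a\<in>set cs. eval y R e' (cnd_fm (3 + 6 * m) (4 + 6 * m) a)) \<and>
        eval y R e' (match_fm (3 + 6 * m) (4 + 6 * m) (fst ab) (6 + 6 * m + 6 * j) (6 + 6 * m + 6 * j + 1) (6 + 6 * m + 6 * j + 2)) \<and>
        eval y R e' (match_fm (3 + 6 * m) (4 + 6 * m) (snd ab) (6 + 6 * m + 6 * j + 3) (6 + 6 * m + 6 * j + 4) (6 + 6 * m + 6 * j + 5))"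
        unfolding equation_item_def Let_def snd_conv eval_conj by (simp add: ball_Un del: upt_Suc take_upt drop_upt map_append) blast
      then show ?thesis unfolding 1 m1 m2 eval_cnd e'v by (simp add: kk)
    qed
    then show "sg (odd (of_bool (eval y R (upd e (loop_vars m) k) (snd (equation_item m j n cs ab))) :: nat)) =
      sg (R (2 + j) (k @ take (6 * j) c @ drop (6 * j + 6) c) \<and> k ! 2 = n \<and> (\<forall>a\<in>set cs. holds y (k ! 0) (k ! 1) a) \<and>
      index N (k ! 0) (k ! 1) (fst ab) = Some (take 3 (take 6 (drop (6 * j) c))) \<and>
      index N (k ! 0) (k ! 1) (snd ab) = Some (drop 3 (take 6 (drop (6 * j) c))))"
      unfolding e'_def by simp
  qed
  finally show ?thesis .
qed

lemma sg_equation_items: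
  assumes y: "N = length y" and j: "j < m" and e: "e = upd (\<lambda>_. 0) [6 + 6 * m..<6 + 12 * m] c" and c: "c \<in> Tup N (6 * m)"
  shows "prod_list (map (\<lambda>a. sg (odd (item_val y R e a))) (concat (map (\<lambda>(n, s). map (equation_item m j n (fst s)) (snd s)) (List.enumerate 0 (schemas M))))) =
    (\<Prod>k\<in>Tup N 3. prod_list (map (\<lambda>p. sg (R (2 + j) (k @ take (6 * j) c @ drop (6 * j + 6) c) \<and> take 6 (drop (6 * j) c) = p)) (equations M y k)))"
proof -
  let ?Q = "\<lambda>k. R (2 + j) (k @ take (6 * j) c @ drop (6 * j + 6) c)"
  let ?s = "take 6 (drop (6 * j) c)"
  let ?B = "\<lambda>k cs. (\<forall>a\<in>set cs. holds y (k ! 0) (k ! 1) a)"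
  let ?I = "\<lambda>k ab. index N (k ! 0) (k ! 1) (fst ab) = Some (take 3 ?s) \<and> index N (k ! 0) (k ! 1) (snd ab) = Some (drop 3 ?s)"
  have len: "length (take 3 ?s) = 3" "length (drop 3 ?s) = 3" using c j by (auto simp: Tup_def)
  have "prod_list (map (\<lambda>a. sg (odd (item_val y R e a))) (concat (map (\<lambda>(n, s). map (equation_item m j n (fst s)) (snd s)) (List.enumerate 0 (schemas M))))) =
    prod_list (map (\<lambda>(n, s). prod_list (map (\<lambda>ab. \<Prod>k\<in>Tup N 3. sg (?Q k \<and> k ! 2 = n \<and> ?B k (fst s) \<and> ?I k ab)) (snd s))) (List.enumerate 0 (schemas M)))"
    unfolding map_concat prod_list_concat map_map
    by (intro arg_cong[where f = prod_list] map_cong refl) (simp only: o_def case_prod_unfold map_map sg_equation_item[OF assms])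
  also have "\<dots> = (\<Prod>k\<in>Tup N 3. prod_list (map (\<lambda>(n, s). prod_list (map (\<lambda>ab. sg (?Q k \<and> k ! 2 = n \<and> ?B k (fst s) \<and> ?I k ab)) (snd s))) (List.enumerate 0 (schemas M))))"
    unfolding prod_list_prod case_prod_unfold ..
  also have "\<dots> = (\<Prod>k\<in>Tup N 3. prod_list (map (\<lambda>p. sg (?Q k \<and> ?s = p)) (equations M y k)))"
  proof (intro prod.cong refl)
    fix k assume "k \<in> Tup N 3"
    let ?g = "\<lambda>s. prod_list (map (\<lambda>ab. sg (?Q k \<and> ?B k (fst s) \<and> ?I k ab)) (snd s))"
    have one: "prod_list (map (\<lambda>ab. sg False) ms) = 1" for ms :: "(vt \<times> vt) list" by (induction ms) auto
    have "prod_list (map (\<lambda>(n, s). prod_list (map (\<lambda>ab. sg (?Q k \<and> k ! 2 = n \<and> ?B k (fst s) \<and> ?I k ab)) (snd s))) (List.enumerate 0 (schemas M))) =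
      prod_list (map (\<lambda>(n, s). if n = k ! 2 then ?g s else 1) (List.enumerate 0 (schemas M)))"
      \<comment> \<open>For a schema with a number other than \<open>k ! 2\<close> all formulas are
        false, and its factor is 1.\<close>
      using one by (intro arg_cong[where f = prod_list] map_cong refl) (auto split: prod.splits)
    also have "\<dots> = (if k ! 2 < length (schemas M) then ?g (schemas M ! (k ! 2)) else 1)"
      unfolding prod_list_enumerate by simp
    also have "\<dots> = prod_list (map (\<lambda>p. sg (?Q k \<and> ?s = p)) (equations M y k))"
    proof (cases "k ! 2 < length (schemas M) \<and> ?B k (fst (schemas M ! (k ! 2)))")
      case True
      have "?g (schemas M ! (k ! 2)) = prod_list (map (\<lambda>(a, b). sg (?Q k \<and> index N (k ! 0) (k ! 1) a = Some (take 3 ?s) \<and> index N (k ! 0) (k ! 1) b = Some (drop 3 ?s))) (snd (schemas M ! (k ! 2))))"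
        using True by (intro arg_cong[where f = prod_list] map_cong refl) auto
      also have "\<dots> = prod_list (map (\<lambda>p. sg (?Q k \<and> ?s = p)) (equations M y k))"
        unfolding prod_match[OF len] append_take_drop_id using True by (simp add: equations_def y)
      finally show ?thesis using True by simp
    next
      case False
      have "?g (schemas M ! (k ! 2)) = prod_list (map (\<lambda>ab. sg False) (snd (schemas M ! (k ! 2))))"
        if "k ! 2 < length (schemas M)"
        using False that by (intro arg_cong[where f = prod_list] map_cong refl arg_cong[where f = sg]) blast
      moreover have "equations M y k = []" using False by (simp only: equations_def if_False)
      ultimately show ?thesis unfolding one by simp
    qed
    finally show "prod_list (map (\<lambda>(n, s). prod_list (map (\<lambda>ab. sg (?Q k \<and> k ! 2 = n \<and> ?B k (fst s) \<and> ?I k ab)) (snd s))) (List.enumerate 0 (schemas M))) =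
      prod_list (map (\<lambda>p. sg (?Q k \<and> ?s = p)) (equations M y k))" .
  qed
  finally show ?thesis .
qed

lemma horner_coeffs: "horner (coeffs p) n = poly p n"
  by (induction p) (auto simp: cCons_def)

lemma sg_inj: "sg a = sg b \<longleftrightarrow> a = b"
  by (auto simp: sg_def)

context game
begin

lemma first_word:
  assumes y: "N = length y"
  shows "out_word y (R r) [6 + 6 * m..<6 + 12 * m] (first_items m) = map (R r 1) (tups N (6 * m))"
proof -
  let ?c = "[6 + 6 * m..<6 + 12 * m]"
  have l: "length ?c = 6 * m" by simp
  have "odd (sum_list (map (item_val y (R r) (upd (\<lambda>_. 0) ?c c)) (first_items m))) = R r 1 c"
    if "c \<in> set (tups N (6 * m))" for c
  proof -
    have "map (upd (\<lambda>_. 0) ?c c) ?c = c" using that by (intro map_upd) (auto simp: set_tups Tup_def)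
    then show ?thesis by (simp add: first_items_def item_val_def del: upt_Suc)
  qed
  then show ?thesis unfolding out_word_def list_nest_tups l y[symmetric] by (intro map_cong) auto
qed

lemma second_word:
  assumes y: "N = length y" and E: "\<E> = equations M y"
  shows "out_word y (R r) [6 + 6 * m..<6 + 12 * m] (second_items M m t) = xorl (map (R r 1) (tups N (6 * m))) (zvec r)"
proof -
  let ?c = "[6 + 6 * m..<6 + 12 * m]"
  have l: "length ?c = 6 * m" by simp
  have bit: "odd (sum_list (map (item_val y (R r) (upd (\<lambda>_. 0) ?c c)) (second_items M m t))) = (R r 1 c \<noteq> (shift r c = -1))"
    if "c \<in> set (tups N (6 * m))" for c
  proof -
    define e where "e = upd (\<lambda>_. 0) ?c c"
    have c: "c \<in> C" using that by (simp add: set_tups)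
    then have lc: "length c = 6 * m" by (simp add: Tup_def)
    have me: "map e ?c = c" unfolding e_def using lc by (intro map_upd) auto
    have zero: "(\<forall>v\<in>set ?c. e v = 0) \<longleftrightarrow> c = replicate (6 * m) 0"
    proof -
      have "(\<forall>v\<in>set ?c. e v = 0) \<longleftrightarrow> (\<forall>a\<in>set (map e ?c). a = 0)" by (simp del: upt_Suc set_upt)
      also have "\<dots> \<longleftrightarrow> c = replicate (6 * m) 0" unfolding me using lc by (metis replicate_eqI in_set_replicate)
      finally show ?thesis .
    qed
    let ?v = "\<lambda>a. sg (odd (item_val y (R r) e a))"
    have i1: "prod_list (map ?v (first_items m)) = sg (R r 1 c)"
      using me by (simp add: first_items_def item_val_def del: upt_Suc)
    have i2: "?v ([], And (Look 0 []) (conj_fm (map (\<lambda>v. EqC v 0) ?c))) = sg (R r 0 [] \<and> c = replicate (6 * m) 0)"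
      using zero by (simp add: item_val_def del: upt_Suc set_upt)
    have i3: "?v ([], conj_fm (map (\<lambda>j. Look (2 + m + \<tau> * (2 * m) + j) (take 3 (drop (3 * j) ?c))) [0..<2 * m])) =
      sg (\<forall>j<2 * m. R r (2 + m + \<tau> * (2 * m) + j) (take 3 (drop (3 * j) c)))" for \<tau>
    proof -
      have 1: "map e (take 3 (drop (3 * j) ?c)) = take 3 (drop (3 * j) c)" for j
        unfolding take_map[symmetric] drop_map[symmetric] me ..
      have 2: "eval y (R r) e (conj_fm (map f [0..<2 * m])) \<longleftrightarrow> (\<forall>j<2 * m. eval y (R r) e (f j))" for f by auto
      show ?thesis unfolding item_val_def fst_conv snd_conv count_nest.simps 2 eval.simps 1 by simp
    qed
    have i4: "prod_list (map ?v (concat (map (\<lambda>(n, s). map (equation_item m j n (fst s)) (snd s)) (List.enumerate 0 (schemas M))))) =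
      (\<Prod>\<kappa>\<in>I3. prod_list (map (\<lambda>p. sg (R r (2 + j) (\<kappa> @ take (6 * j) c @ drop (6 * j + 6) c) \<and> take 6 (drop (6 * j) c) = p)) (\<E> \<kappa>)))"
      if "j < m" for j
      unfolding E by (rule sg_equation_items[OF y that e_def c])
    have "sg (odd (sum_list (map (item_val y (R r) e) (second_items M m t)))) = sg (R r 1 c) * (sg (R r 0 [] \<and> c = replicate (6 * m) 0) *
      ((\<Prod>\<tau><t. sg (\<forall>j<2 * m. R r (2 + m + \<tau> * (2 * m) + j) (take 3 (drop (3 * j) c)))) *
      (\<Prod>j<m. \<Prod>\<kappa>\<in>I3. prod_list (map (\<lambda>p. sg (R r (2 + j) (\<kappa> @ take (6 * j) c @ drop (6 * j + 6) c) \<and> take 6 (drop (6 * j) c) = p)) (\<E> \<kappa>)))))"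
      unfolding sg_odd_sum_list unfolding second_items_def Let_def map_append prod_list.append i1
    proof (intro arg_cong2[where f = "(*)"] refl)
      show "prod_list (map ?v [([], And (Look 0 []) (conj_fm (map (\<lambda>v. EqC v 0) ?c)))]) = sg (R r 0 [] \<and> c = replicate (6 * m) 0)"
        unfolding list.map i2 by simp
      show "prod_list (map ?v (map (\<lambda>\<tau>. ([], conj_fm (map (\<lambda>j. Look (2 + m + \<tau> * (2 * m) + j) (take 3 (drop (3 * j) ?c))) [0..<2 * m]))) [0..<t])) =
        (\<Prod>\<tau><t. sg (\<forall>j<2 * m. R r (2 + m + \<tau> * (2 * m) + j) (take 3 (drop (3 * j) c))))"
        unfolding map_map o_def i3 prod_list_upt ..
      show "prod_list (map ?v (concat (map (\<lambda>j. concat (map (\<lambda>(n, s). map (equation_item m j n (fst s)) (snd s)) (List.enumerate 0 (schemas M)))) [0..<m]))) =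
        (\<Prod>j<m. \<Prod>\<kappa>\<in>I3. prod_list (map (\<lambda>p. sg (R r (2 + j) (\<kappa> @ take (6 * j) c @ drop (6 * j + 6) c) \<and> take 6 (drop (6 * j) c) = p)) (\<E> \<kappa>)))"
      proof -
        have "prod_list (map ?v (concat (map f [0..<k]))) = (\<Prod>j<k. prod_list (map ?v (f j)))" for f :: "nat \<Rightarrow> (nat list \<times> fm) list" and k
          by (induction k) (auto simp: mult.commute)
        then show ?thesis using i4 by simp
      qed
    qed
    also have "\<dots> = sg (R r 1 c) * shift r c" by (simp add: shift_def mult.assoc)
    also have "\<dots> = sg (R r 1 c \<noteq> (shift r c = -1))"
      using shift_pm[of r c] by (auto simp: sg_def)
    finally show ?thesis unfolding e_def sg_inj .
  qed
  have "out_word y (R r) ?c (second_items M m t) = map (\<lambda>c. R r 1 c \<noteq> (shift r c = -1)) (tups N (6 * m))"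
    unfolding out_word_def list_nest_tups l y[symmetric] using bit by (intro map_cong) auto
  also have "\<dots> = xorl (map (R r 1) (tups N (6 * m))) (zvec r)"
    unfolding xorl_def zvec_def by (rule nth_equalityI) (auto simp: length_tups)
  finally show ?thesis .
qed

lemma block_one:
  assumes r: "r \<in> BL (N * L)"
  shows "map (R r 1) (tups N (6 * m)) = take L (drop L r)"
proof (rule nth_equalityI)
  have len: "length r = N * L" using r by (simp add: BL_def)
  have "2 * L \<le> N * L" using N2 by (rule mult_le_mono1)
  then have LL: "L \<le> N * L - L" "L \<le> length r" unfolding len by linarith+
  then show "length (map (R r 1) (tups N (6 * m))) = length (take L (drop L r))"
    unfolding length_map length_tups length_take length_drop len by simp
  fix i assume "i < length (map (R r 1) (tups N (6 * m)))"
  then have i: "i < L" by (simp add: length_tups)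
  have "tups N (6 * m) ! i \<in> Tup N (6 * m)" using i set_tups[of N "6 * m"] length_tups[of N "6 * m"] nth_mem by metis
  then have "R r 1 (tups N (6 * m) ! i) = r ! (1 * L + tidx N (tups N (6 * m) ! i))"
    using N2 by (intro coin[OF r]) auto
  also have "\<dots> = r ! (L + i)" using i by (simp add: tidx_nth_tups)
  finally show "map (R r 1) (tups N (6 * m)) ! i = take L (drop L r) ! i"
    using i LL(2) by (simp add: length_tups)
qed

text \<open>Acceptance means that the signs of \<open>b\<close> and of both answers multiply to 1;
  the indicator of this event is half of one plus the product.\<close>

lemma accept_prob_bias:
  assumes y: "y = word_y as bs (map bit_sym x)" "N = length y" and E: "\<E> = equations M y"
    and p: "poly p (length x) = N * L"
  shows "accept_prob 2 p (queries (6 * m) as bs [6 + 6 * m..<6 + 12 * m] (first_items m) (second_items M m t)) verdict P x =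
    (1 + bias (\<lambda>q. sg (P 0 q)) (\<lambda>q. sg (P 1 q))) / 2"
proof -
  let ?Q = "queries (6 * m) as bs [6 + 6 * m..<6 + 12 * m] (first_items m) (second_items M m t)"
  have "accept_prob 2 p ?Q verdict P x = avg (N * L) (\<lambda>r. of_bool (verdict [x, r, map (\<lambda>i. P i (?Q [x, r] ! i)) [0..<2]]))"
    unfolding accept_prob_def p by (rule prob_uniform_BL)
  also have "\<dots> = avg (N * L) (\<lambda>r. (1 / 2) * (1 + sg (r ! 0) * sg (P 0 (take L (drop L r))) * sg (P 1 (xorl (take L (drop L r)) (zvec r)))))"
  proof (rule avg_cong)
    fix r assume r: "r \<in> BL (N * L)"
    have "?Q [x, r] = [take L (drop L r), xorl (take L (drop L r)) (zvec r)]"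
      unfolding queries_def Let_def using first_word[OF y(2), of r] second_word[OF y(2) E, of r] block_one[OF r]
      by (simp add: y(1)[symmetric] y(2)[symmetric] del: upt_Suc)
    then have "map (\<lambda>i. P i (?Q [x, r] ! i)) [0..<2] = [P 0 (take L (drop L r)), P 1 (xorl (take L (drop L r)) (zvec r))]"
      by (simp add: upt_rec)
    then show "of_bool (verdict [x, r, map (\<lambda>i. P i (?Q [x, r] ! i)) [0..<2]]) =
      (1 / 2) * (1 + sg (r ! 0) * sg (P 0 (take L (drop L r))) * sg (P 1 (xorl (take L (drop L r)) (zvec r))))"
      by (simp only:) (auto simp: verdict_def sg_def)
  qed
  also have "\<dots> = (1 / 2) * (1 + bias (\<lambda>q. sg (P 0 q)) (\<lambda>q. sg (P 1 q)))"
    unfolding avg_cmult avg_add avg_const bias_def ..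
  finally show ?thesis by simp
qed

end

section \<open>Rank-one solutions of the equations\<close>

lemma schemas_core: "k < length (core_schemas M) \<Longrightarrow> schemas M ! k = core_schemas M ! k"
  by (simp add: schemas_def nth_append)

lemma index_cases:
  assumes "index N \<tau> j v = Some i"
  obtains "i = [0, 0, 0]" "v = One" | b c \<theta> \<tau>' j' where "v = V b c \<theta>" "i = [\<tau>', j', code \<theta>]" "\<tau>' < N" "j' < N" "code \<theta> < N"
  using assms by (cases v) (auto split: option.splits if_splits)

context encoded
begin

lemma prod_equations:
  assumes k: "k < length (schemas M)" and h: "\<forall>c\<in>set (fst (schemas M ! k)). holds y \<tau> j c"
  shows "equations M y [\<tau>, j, k] = concat (map (mono_index N \<tau> j) (snd (schemas M ! k)))"
  using assms by (simp add: equations_def N)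

lemma length_y: "length y = N"
  by (simp add: N)

text \<open>A rank-one solution is a product of \<open>x\<close> and \<open>x'\<close>. The symmetry
  schemas identify the two vectors on all variables in the schemas, so \<open>x\<close> is an
  assignment solving the quadratic equations, and \<open>tableau_sound\<close> extracts an accepted
  witness from it.\<close>

lemma no_rank_one_equations:
  fixes T :: nat and acc :: "bool list \<Rightarrow> bool"
  assumes out: "\<And>w. length w < h \<Longrightarrow> outputs_within M (enc [xx, w]) (enc [[acc w]]) T" and T: "2 * T < g"
    and none: "\<And>w. length w < h \<Longrightarrow> \<not> acc w" and len: "length (schemas M) \<le> N"
    and tensor: "tensor N L"
  shows "tensor.no_rank_one N (equations M y) (Tup N 3)"
proof -
  interpret tensor N L "equations M y" by (rule tensor)
  show ?thesis unfolding no_rank_one_def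
  proof (intro allI impI notI)
    fix X x x' assume X0: "X (replicate 3 0 @ replicate 3 0)"
      and eq: "\<forall>\<kappa>\<in>I3. prod_list (map (\<lambda>p. sg (X p)) (equations M y \<kappa>)) = 1"
      and rk: "\<forall>i\<in>I3. \<forall>i'\<in>I3. X (i @ i') = (x i \<and> x' i')"
    have N0: "0 < N" using N_eq by simp
    have z: "[0, 0, 0] \<in> I3" using N0 by (simp add: Tup_def)
    have x0: "x [0, 0, 0]" "x' [0, 0, 0]" using X0 rk z by (auto simp: numeral_3_eq_3)
    have same: "x [\<tau>, j, code \<theta>] = x' [\<tau>, j, code \<theta>]"
      if \<theta>: "\<theta> \<in> set (schema_types (core_schemas M))" "\<tau> < N" "j < N" "code \<theta> < N" for \<tau> j \<theta>
    proof -
      let ?s = "([], [(V False Same \<theta>, One), (One, V False Same \<theta>)]) :: schema"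
      have "?s \<in> set (schemas M)" using \<theta>(1) by (auto simp: schemas_def)
      then obtain k where k: "k < length (schemas M)" "schemas M ! k = ?s" by (auto simp: in_set_conv_nth)
      have i: "[\<tau>, j, code \<theta>] \<in> I3" using \<theta> by (simp add: Tup_def)
      have "equations M y [\<tau>, j, k] = [[\<tau>, j, code \<theta>] @ [0, 0, 0], [0, 0, 0] @ [\<tau>, j, code \<theta>]]"
        using prod_equations[OF k(1), of \<tau> j] \<theta> by (simp add: k(2) mono_index_def)
      moreover have "[\<tau>, j, k] \<in> I3" using \<theta> k len by (simp add: Tup_def)
      ultimately have "sg (X ([\<tau>, j, code \<theta>] @ [0, 0, 0])) * sg (X ([0, 0, 0] @ [\<tau>, j, code \<theta>])) = 1"
        using eq by fastforce
      moreover have "X ([\<tau>, j, code \<theta>] @ [0, 0, 0]) = x [\<tau>, j, code \<theta>]" "X ([0, 0, 0] @ [\<tau>, j, code \<theta>]) = x' [\<tau>, j, code \<theta>]"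
        using rk z i x0 by blast+
      ultimately show ?thesis by (auto simp: sg_def split: if_splits)
    qed
    have "\<exists>w. length w < h \<and> acc w"
    proof (rule tableau_sound[where T = T and X = x])
      fix \<tau> j s assume \<tau>: "\<tau> < N" "j < N" and s: "s \<in> set (core_schemas M)"
      obtain k where k: "k < length (core_schemas M)" "core_schemas M ! k = s" using s by (auto simp: in_set_conv_nth)
      then have k': "k < length (schemas M)" "schemas M ! k = s" by (simp_all add: schemas_def nth_append)
      show "schema_ok x y \<tau> j s"
      proof (cases "\<forall>c\<in>set (fst s). holds y \<tau> j c")
        case False
        then show ?thesis by (auto simp: schema_ok_def)
      next
        case True
        have e: "equations M y [\<tau>, j, k] = concat (map (mono_index N \<tau> j) (snd s))"
          using prod_equations[OF k'(1), of \<tau> j] True k' by simp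
        have same': "x i = x' i" "i \<in> I3" if v: "v \<in> fst ` set (snd s) \<union> snd ` set (snd s)" "index N \<tau> j v = Some i" for v i
        proof -
          show "i \<in> I3" using index_Tup[OF N0 v(2)] .
          show "x i = x' i"
          proof (rule index_cases[OF v(2)])
            fix b c \<theta> \<tau>' j' assume i: "v = V b c \<theta>" "i = [\<tau>', j', code \<theta>]" "\<tau>' < N" "j' < N" "code \<theta> < N"
            have "\<theta> \<in> set (schema_types (core_schemas M))"
              using s v(1) i(1) unfolding schema_types_def by force
            then show ?thesis using same i by simp
          qed (use x0 in simp)
        qed
        have "X p = (x (take 3 p) \<and> x (drop 3 p))" if p: "p \<in> set (equations M y [\<tau>, j, k])" for p
        proof -
          obtain ab where ab: "ab \<in> set (snd s)" "p \<in> set (mono_index N \<tau> j ab)" using p unfolding e by auto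
          obtain i where i1: "index N \<tau> j (fst ab) = Some i" using ab(2)
            by (cases "index N \<tau> j (fst ab)") (auto simp: mono_index_def)
          obtain i' where i2: "index N \<tau> j (snd ab) = Some i'" using ab(2) i1
            by (cases "index N \<tau> j (snd ab)") (auto simp: mono_index_def)
          have "p = i @ i'" using ab(2) i1 i2 by (simp add: mono_index_def)
          note i = i1 i2 this
          have "x i = x' i" "i \<in> I3" "x i' = x' i'" "i' \<in> I3" using same'[OF _ i(1)] same'[OF _ i(2)] ab(1) by auto
          then show ?thesis using rk i(3) length_index[OF i(1)] by simp
        qed
        then have "prod_list (map (\<lambda>p. sg (X p)) (equations M y [\<tau>, j, k])) = prod_list (map (\<lambda>p. sg (x (take 3 p) \<and> x (drop 3 p))) (equations M y [\<tau>, j, k]))"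
          by (intro arg_cong[where f = prod_list] map_cong) auto
        also have "\<dots> = sg (odd (cnt x N \<tau> j (snd s)))" unfolding e prod_mono_index ..
        finally have "sg (odd (cnt x N \<tau> j (snd s))) = 1"
          using eq \<tau> k' len by (simp add: Tup_def)
        then show ?thesis by (auto simp: schema_ok_def length_y sg_def split: if_splits)
      qed
    qed (use out T x0 in auto)
    then show False using none by blast
  qed
qed

lemma equations_solution:
  assumes X0: "X [0, 0, 0]" and ok: "\<And>\<tau> j s. \<tau> < N \<Longrightarrow> j < N \<Longrightarrow> s \<in> set (core_schemas M) \<Longrightarrow> schema_ok X y \<tau> j s"
    and k: "k \<in> Tup N 3"
  shows "prod_list (map (\<lambda>p. sg (X (take 3 p) \<and> X (drop 3 p))) (equations M y k)) = 1"
proof -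
  obtain \<tau> j n where kk: "k = [\<tau>, j, n]" "\<tau> < N" "j < N" using k by (auto simp: Tup_def numeral_3_eq_3 length_Suc_conv)
  show ?thesis
  proof (cases "n < length (schemas M) \<and> (\<forall>c\<in>set (fst (schemas M ! n)). holds y \<tau> j c)")
    case False
    then have "equations M y k = []" by (auto simp: equations_def kk)
    then show ?thesis by simp
  next
    case True
    then have e: "equations M y k = concat (map (mono_index N \<tau> j) (snd (schemas M ! n)))" unfolding kk
      by (intro prod_equations) auto
    have "schema_ok X y \<tau> j (schemas M ! n)"
    proof (cases "n < length (core_schemas M)")
      case True
      then show ?thesis using ok[OF kk(2,3)] by (simp add: schemas_core)
    next
      \<comment> \<open>In a symmetry schema both products have the same value, so their sum is even
        for every assignment.\<close>
      case F: False
      then have "schemas M ! n \<in> (\<lambda>\<theta>. ([], [(V False Same \<theta>, One), (One, V False Same \<theta>)])) ` set (schema_types (core_schemas M))"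
        using True F unfolding schemas_def by (auto simp: nth_append)
      then obtain \<theta> where "schemas M ! n = ([], [(V False Same \<theta>, One), (One, V False Same \<theta>)])" by blast
      then show ?thesis by (simp add: schema_ok_def)
    qed
    then have "even (cnt X N \<tau> j (snd (schemas M ! n)))" using True by (simp add: schema_ok_def N)
    then show ?thesis unfolding e prod_mono_index by simp
  qed
qed

end

section \<open>Assembling the verifier\<close>

lemma outputs_within_mono: "outputs_within M w v T \<Longrightarrow> T \<le> T' \<Longrightarrow> outputs_within M w v T'"
  unfolding outputs_within_def by (meson order_trans)

lemma wf_cnd_fm: "3 + d \<le> kt \<Longrightarrow> kt < 2 + ny \<Longrightarrow> 3 + d \<le> kj \<Longrightarrow> kj < 2 + ny \<Longrightarrow> wf_fm d ny N (cnd_fm kt kj c)"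
  by (cases c) auto

lemma wf_match_fm:
  assumes "\<And>u. u \<in> {kt, kj, v0, v1, v2} \<Longrightarrow> 3 + d \<le> u \<and> u < 2 + ny" "kt \<noteq> v0" "kj \<noteq> v1"
  shows "wf_fm d ny N (match_fm kt kj v v0 v1 v2)"
proof (cases v)
  case (V b c \<theta>)
  then show ?thesis using assms by (cases c) auto
qed (use assms in auto)

lemma wf_items:
  assumes m: "1 \<le> m" and N: "2 + m + t * (2 * m) \<le> N" and a: "a \<in> set (first_items m) \<union> set (second_items M m t)"
  shows "(\<forall>v\<in>set (fst a). 3 + 6 * m \<le> v \<and> v < 2 + (4 + 12 * m)) \<and> distinct (fst a) \<and>
    set (fst a) \<inter> set [6 + 6 * m..<6 + 12 * m] = {} \<and> wf_fm (6 * m) (4 + 12 * m) N (snd a)"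
proof -
  let ?c = "[6 + 6 * m..<6 + 12 * m]"
  have sub: "3 + 6 * m \<le> v \<and> v < 2 + (4 + 12 * m)" if "v \<in> set ?c" for v using that by auto
  consider "a = ([], Look 1 ?c)" | "a = ([], And (Look 0 []) (conj_fm (map (\<lambda>v. EqC v 0) ?c)))"
    | \<tau> where "\<tau> < t" "a = ([], conj_fm (map (\<lambda>j. Look (2 + m + \<tau> * (2 * m) + j) (take 3 (drop (3 * j) ?c))) [0..<2 * m]))"
    | j n cs ab where "j < m" "a = equation_item m j n cs ab"
  proof -
    have "a \<in> set (first_items m) \<or> a = ([], And (Look 0 []) (conj_fm (map (\<lambda>v. EqC v 0) ?c))) \<or>
      (\<exists>\<tau><t. a = ([], conj_fm (map (\<lambda>j. Look (2 + m + \<tau> * (2 * m) + j) (take 3 (drop (3 * j) ?c))) [0..<2 * m]))) \<or>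
      (\<exists>j<m. \<exists>n cs ab. a = equation_item m j n cs ab)"
      using a unfolding second_items_def Let_def set_append set_concat set_map by (auto simp del: upt_Suc) blast+
    then show ?thesis using that unfolding first_items_def by auto
  qed
  then show ?thesis
  proof cases
    case 1
    then show ?thesis using N by auto
  next
    case 2
    then show ?thesis using N by auto
  next
    case 3
    have "2 + m + \<tau> * (2 * m) + j < N" if "j \<in> set [0..<2 * m]" for j
    proof -
      have "Suc \<tau> * (2 * m) \<le> t * (2 * m)" using 3 by (intro mult_le_mono1) auto
      then show ?thesis using N that by simp
    qed
    moreover have "v \<in> set (take 3 (drop (3 * j) ?c)) \<Longrightarrow> v \<in> set ?c" for v j by (meson in_set_takeD in_set_dropD)
    ultimately show ?thesis using m sub unfolding 3 by (auto simp del: upt_Suc set_upt take_upt drop_upt)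
  next
    case 4
    have b: "2 + j < N" using 4 m N by (cases t) auto
    have sub2: "v \<in> set ?c" if "v \<in> set (take (6 * j) ?c @ drop (6 * j + 6) ?c)" for v
      using that by (auto simp del: set_upt take_upt drop_upt dest: in_set_takeD in_set_dropD)
    have len: "length (loop_vars m @ take (6 * j) ?c @ drop (6 * j + 6) ?c) \<le> 6 * m" using 4
      by (simp add: loop_vars_def)
    have lv: "\<forall>v\<in>set (loop_vars m @ take (6 * j) ?c @ drop (6 * j + 6) ?c). 3 + 6 * m \<le> v \<and> v < 2 + (4 + 12 * m)"
      using sub2 sub by (auto simp: loop_vars_def simp del: set_upt take_upt drop_upt)
    have w1: "wf_fm (6 * m) (4 + 12 * m) N (Look (2 + j) (loop_vars m @ take (6 * j) ?c @ drop (6 * j + 6) ?c))"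
      using b len lv by (simp only: wf_fm.simps)
    have w2: "wf_fm (6 * m) (4 + 12 * m) N (cnd_fm (3 + 6 * m) (4 + 6 * m) c)" for c
      using m by (intro wf_cnd_fm) auto
    have w3: "wf_fm (6 * m) (4 + 12 * m) N (match_fm (3 + 6 * m) (4 + 6 * m) v (6 + 6 * m + 6 * j + i) (6 + 6 * m + 6 * j + i + 1) (6 + 6 * m + 6 * j + i + 2))"
      if "i \<le> 3" for v i
      using that 4(1) by (intro wf_match_fm) auto
    have "wf_fm (6 * m) (4 + 12 * m) N (snd (equation_item m j n cs ab))"
      unfolding equation_item_def Let_def snd_conv wf_conj set_append list.set set_map
      using w1 w2 w3[of 0 "fst ab"] w3[of 3 "snd ab"] m
      by (auto simp del: upt_Suc set_upt take_upt drop_upt simp: add.assoc)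
    then show ?thesis unfolding 4(2) using m by (auto simp: equation_item_def Let_def loop_vars_def)
  qed
qed

theorem theorem10:
  fixes \<epsilon> :: real
  assumes "\<epsilon> > 0"
  shows "NP \<subseteq> MIP1 2 (1 - \<epsilon>) (1 / 2 + \<epsilon>)"
proof
  fix S assume "S \<in> NP"
  then obtain p :: "nat poly" and R where R: "polytime_decides_on {[x, w] | x w. True} R"
    and S: "\<And>x. x \<in> S \<longleftrightarrow> (\<exists>w. length w \<le> poly p (length x) \<and> R [x, w])" unfolding NP_def by blast
  obtain M and pM :: "nat poly" where M: "wf_tm M"
    and out0: "\<forall>ws\<in>{[x, w] | x w. True}. outputs_within M (enc ws) (enc [[R ws]]) (poly pM (length (enc ws)))"
    using R unfolding polytime_decides_on_def polytime_on_def by blast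
  have out: "outputs_within M (enc [x, w]) (enc [[R [x, w]]]) (poly pM (length (enc [x, w])))" for x w
    using out0 by blast
  obtain m t where m: "1 \<le> m" and hi: "(1 - 2 * (3 / 8) ^ m) ^ t \<le> 2 * \<epsilon>" and lo: "1 - 2 * \<epsilon> \<le> (1 - 2 * (1 / 4) ^ m) ^ t"
    using exists_parameters[OF assms] by blast
  \<comment> \<open>The loop length must be at least the number of coin blocks and the number of
    schemas, and larger than all type codes; \<open>c0\<close> pads the word accordingly.\<close>
  define c0 where "c0 = 2 + m + t * (2 * m) + length (schemas M) + sum_list (map (\<lambda>\<theta>. Suc (code \<theta>)) (types M))"
  \<comment> \<open>The argument of \<open>pM\<close> is the largest length of
    \<open>enc [x, w]\<close>, the 2 being for the two terminators.\<close>
  define T where "T n = poly pM (poly p n + (2 + n))" for n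
  \<comment> \<open>One column more than the longest witness, for its terminator.\<close>
  define ph where "ph = p + 1"
  define pg where "pg = [:2:] * pcompose pM (p + [:2, 1:]) + [:c0:]"
  \<comment> \<open>With \<open>N\<close> the length of the loop word, this is \<open>N\<close> coin
    tables of \<open>N ^ (6 * m)\<close> entries.\<close>
  define pr where "pr = ([:2, 1:] + ph + pg) ^ Suc (6 * m)"
  have ph: "poly ph n = poly p n + 1" for n by (simp add: ph_def)
  have pg: "poly pg n = 2 * T n + c0" for n by (simp add: pg_def T_def poly_pcompose)
  have pr: "poly pr n = (n + poly ph n + poly pg n + 2) ^ Suc (6 * m)" for n
    by (simp add: pr_def poly_power del: power_Suc)
  define y where "y x = word_y (coeffs ph) (coeffs pg) (map bit_sym x)" for x
  have y: "y x = map bit_sym x @ 3 # replicate (poly ph (length x)) 4 @ replicate (poly pg (length x)) 5 @ [6]" for x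
    by (simp add: y_def word_y_def horner_coeffs)
  have len: "length (y x) = length x + poly ph (length x) + poly pg (length x) + 2" for x by (simp add: y)
  have c0: "c0 \<le> length (y x)" for x unfolding len pg by simp
  let ?A1 = "first_items m" and ?A2 = "second_items M m t" and ?cs = "[6 + 6 * m..<6 + 12 * m]"
  let ?Q = "queries (6 * m) (coeffs ph) (coeffs pg) ?cs ?A1 ?A2"
  have ver: "verifier 2 pr ?Q verdict"
    unfolding verifier_def
  proof (intro conjI allI impI)
    show "polytime_on {[x, r] |x r. length r = poly pr (length x)} ?Q"
    proof (rule polytime_queries[where ny = "4 + 12 * m"])
      show "poly pr (length x) = length (word_y (coeffs ph) (coeffs pg) (map bit_sym x)) ^ Suc (6 * m)" for x :: "bool list"
        unfolding pr y_def[symmetric] len ..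
      fix x a assume "a \<in> set ?A1 \<union> set ?A2"
      moreover have "2 + m + t * (2 * m) \<le> length (word_y (coeffs ph) (coeffs pg) (map bit_sym x))"
        using c0[of x] unfolding c0_def y_def by linarith
      ultimately show "(\<forall>v\<in>set (fst a). 3 + 6 * m \<le> v \<and> v < 2 + (4 + 12 * m)) \<and> distinct (fst a) \<and>
        set (fst a) \<inter> set ?cs = {} \<and> wf_fm (6 * m) (4 + 12 * m) (length (word_y (coeffs ph) (coeffs pg) (map bit_sym x))) (snd a)"
        by (intro wf_items[OF m])
    qed (use m in auto)
    have "poly pr n \<ge> 1" for n unfolding pr by (simp add: Suc_le_eq)
    then show "polytime_decides_on {[x, r, a] |x r a. length r = poly pr (length x) \<and> length a = 2} verdict"
      by (rule polytime_verdict)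
    show "length (?Q [x, r]) = 2" for x r by (simp add: queries_def Let_def)
  qed
  have enc: "encoded M x (poly ph (length x)) (poly pg (length x)) (length (y x)) (y x)" for x
  proof
    fix \<theta> assume "\<theta> \<in> set (types M)"
    then have "Suc (code \<theta>) \<le> sum_list (map (\<lambda>\<theta>. Suc (code \<theta>)) (types M))" by (intro member_le_sum_list) auto
    then show "code \<theta> < length (y x)" using c0[of x] unfolding c0_def by linarith
  qed (auto simp: M ph pg c0_def y)
  have gam: "game (length (y x)) m (equations M (y x)) t" for x
  proof
    have "2 \<le> length (y x)" by (simp add: len)
    then show "0 < length (y x)" by linarith
    then show "length (y x) ^ 3 \<le> length (y x) ^ (6 * m)" using m \<open>2 \<le> length (y x)\<close>
      by (intro power_increasing) linarith+
    show "2 + m + t * (2 * m) \<le> length (y x)" using c0[of x] unfolding c0_def by linarith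
    show "p' \<in> Tup (length (y x)) 6" if "p' \<in> set (equations M (y x) \<kappa>)" for \<kappa> p'
      using equations_Tup[OF _ that] \<open>0 < length (y x)\<close> by auto
  qed (rule m)
  have out': "outputs_within M (enc [x, w]) (enc [[R [x, w]]]) (T (length x))"
    if "length w < poly ph (length x)" for x w
    unfolding T_def using that by (intro outputs_within_mono[OF out] poly_nat_mono) (simp add: ph)
  have T: "2 * T (length x) < poly pg (length x)" for x unfolding pg by (simp add: c0_def)
  have prob: "accept_prob 2 pr ?Q verdict P x =
      (1 + game.bias (length (y x)) m (equations M (y x)) t (\<lambda>q. sg (P 0 q)) (\<lambda>q. sg (P 1 q))) / 2" for P x
    by (rule game.accept_prob_bias[OF gam y_def refl refl]) (simp add: pr len)
  have complete: "\<exists>P. 1 - \<epsilon> \<le> accept_prob 2 pr ?Q verdict P x" if xS: "x \<in> S" for x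
  proof -
    interpret encoded M x "poly ph (length x)" "poly pg (length x)" "length (y x)" "y x" by (rule enc)
    interpret game "length (y x)" m "equations M (y x)" t by (rule gam)
    obtain w where w: "length w < poly ph (length x)" "R [x, w]" using xS S[of x] by (auto simp: ph less_Suc_eq_le)
    obtain X where X: "X [0, 0, 0]" "\<And>\<tau> j s. \<tau> < length (y x) \<Longrightarrow> j < length (y x) \<Longrightarrow> s \<in> set (core_schemas M) \<Longrightarrow> schema_ok X (y x) \<tau> j s"
      by (rule tableau_complete[where T = "T (length x)" and acc = "\<lambda>w. R [x, w]", OF _ T w]) (use out' in blast)+
    let ?w = "map (honest X m) (tups (length (y x)) (6 * m))"
    have chi: "sg (chi ?w q = -1) = chi ?w q" for q
    proof -
      have "chi ?w q = 1 \<or> chi ?w q = -1" unfolding chi_def by (intro prod_pm) (auto simp: sg_def)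
      then show ?thesis by (auto simp: sg_def)
    qed
    have "bias (chi ?w) (chi ?w) = (1 - 2 * (1 / 4) ^ m) ^ t"
    proof (rule bias_honest)
      show "X (replicate 3 0)" using X(1) by (simp add: numeral_3_eq_3)
      show "prod_list (map (\<lambda>p. sg (X (take 3 p) \<and> X (drop 3 p))) (equations M (y x) \<kappa>)) = 1" if "\<kappa> \<in> I3" for \<kappa>
        using X that by (intro equations_solution)
    qed
    \<comment> \<open>Both provers answer with the inner product of the question and the power of
      the solution \<open>X\<close>, which as a sign is the character of that power.\<close>
    then have "accept_prob 2 pr ?Q verdict (\<lambda>_ q. chi ?w q = -1) x = (1 + (1 - 2 * (1 / 4) ^ m) ^ t) / 2"
      unfolding prob chi by simp
    also have "\<dots> \<ge> 1 - \<epsilon>" using lo by simp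
    finally show ?thesis by blast
  qed
  have sound: "accept_prob 2 pr ?Q verdict P x \<le> 1 / 2 + \<epsilon>" if "x \<notin> S" for P x
  proof -
    interpret encoded M x "poly ph (length x)" "poly pg (length x)" "length (y x)" "y x" by (rule enc)
    interpret game "length (y x)" m "equations M (y x)" t by (rule gam)
    have "no_rank_one I3"
    proof (rule no_rank_one_equations[where T = "T (length x)" and acc = "\<lambda>w. R [x, w]"])
      show "\<not> R [x, w]" if "length w < poly ph (length x)" for w
        using that \<open>x \<notin> S\<close> S[of x] by (auto simp: ph less_Suc_eq_le)
      show "length (schemas M) \<le> length (y x)" using c0[of x] unfolding c0_def by linarith
    qed (use out' T tensor_axioms in auto)
    then have "bias (\<lambda>q. sg (P 0 q)) (\<lambda>q. sg (P 1 q)) \<le> (1 - 2 * (3 / 8) ^ m) ^ t"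
      by (rule bias_le) simp_all
    then show ?thesis unfolding prob using hi by simp
  qed
  show "S \<in> MIP1 2 (1 - \<epsilon>) (1 / 2 + \<epsilon>)"
    unfolding MIP1_def using ver complete sound by blast
qed

end
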